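(* Let $M=M_N$ be positive integers with $M\le N$, $M\to\infty$ and $M/N\to0$ as $N\to\infty$. Let $Q_{M,N}$ be the probability law on $\mathbb{R}^M$ with density proportional to $$\prod_{i=1}^M\lambda_i^{2(N-M)}\prod_{1\le i<j\le M}|\lambda_i-\lambda_j|^2\prod_{i=1}^M e^{-N\lambda_i^2/2}$$ with respect to Lebesgue measure. Let $\Theta_M>0$, with $\Theta_M\to0$, satisfy $M^2\log\Theta_M^{-2}=NM\Theta_M^2$. For $(\lambda_1,\ldots,\lambda_M)$ distributed according to $Q_{M,N}$ define $$\alpha_i=\Theta_M^{-1}(\lambda_i-\sqrt2)\ \text{ if }\lambda_i\ge0,\qquad \beta_i=\Theta_M^{-1}(\lambda_i+\sqrt2)\ \text{ if }\lambda_i<0,$$ and $$\mu_{\alpha,M}=\frac1M\sum_{i:\lambda_i\ge0}\delta_{\alpha_i},\qquad \mu_{\beta,M}=\frac1M\sum_{i:\lambda_i<0}\delta_{-\beta_i}.$$ Then, under the law $Q_{M,N}$, the pair $(\mu_{\alpha,M},\mu_{\beta,M})\in\mathcal{M}$ satisfies a large deviation principle with speed $\Lambda_M:=M^2\log\Theta_M^{-2}$ and good rate function $$\bar I_{\alpha,\beta}(\mu_\alpha,\mu_\beta)=I_{\alpha,\beta}(\mu_\alpha,\mu_\beta)-\inf_{(\mu,\nu)\in\mathcal{M}}I_{\alpha,\beta}(\mu,\nu),$$ where $$I_{\alpha,\beta}(\mu_\alpha,\mu_\beta)=\int x^2\,d\mu_\alpha(x)+\int x^2\,d\mu_\beta(x)-\iint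 1\,d\mu_\alpha(x)\,d\mu_\beta(y).$$
   Context: $\mathcal{M}_{\le1}(\mathbb{R})$ is the space of finite positive Borel measures on $\mathbb{R}$ with total mass at most $1$, with the weak topology induced by the bounded-Lipschitz metric $d_{BL}(\mu,\nu)=\sup_f|\int f\,d\mu-\int f\,d\nu|$ over $f:\mathbb{R}\to\mathbb{R}$ with Lipschitz constant at most $1$ and $|f|\le1$. Write $\operatorname{mass}(\mu)=\int1\,d\mu$ and $$\mathcal{M}=\{(\mu,\nu)\in\mathcal{M}_{\le1}(\mathbb{R})\times\mathcal{M}_{\le1}(\mathbb{R}):\operatorname{mass}(\mu)+\operatorname{mass}(\nu)=1\},$$ with the topology inherited from the product (metric $d_{BL}\oplus d_{BL}$). Large deviation principle: a sequence of random elements of a Polish space $X$ with laws $\mu_N$ satisfies a large deviation principle with speed $a_N\to\infty$ and rate function $I$ if (a) $I:X\to[0,\infty]$ is lower semicontinuous; (b) for every open $O\subset X$, $\liminf_{N}\frac1{a_N}\log\mu_N(O)\ge-\inf_O I$; (c) for every closed $F\subset X$, $\limsup_{N}\frac1{a_N}\log\mu_N(F)\le-\inf_F I$. The rate function is good if $\{I\le C\}$ is compact for every $C\ge 0$. *)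

theory Defs
  imports "HOL-Probability.Probability"
begin

definition submeasures :: "real measure set"
  where "submeasures = {\<mu>. subprob_space \<mu> \<and> sets \<mu> = sets borel}"

definition BL_functions :: "(real \<Rightarrow> real) set"
  where "BL_functions = {f. 1-lipschitz_on UNIV f \<and> (\<forall>x. \<bar>f x\<bar> \<le> 1)}"

text \<open>The supremum is over a bounded set only for finite measures. The value \<open>0\<close> outside
  \<^term>\<open>submeasures\<close> is there because \<^locale>\<open>Metric_space\<close> demands nonnegativity and
  symmetry of the distance on the whole type.\<close>

definition dBL :: "real measure \<Rightarrow> real measure \<Rightarrow> real"
  where "dBL \<mu> \<nu> = (if \<mu> \<in> submeasures \<and> \<nu> \<in> submeasures
    then SUP f\<in>BL_functions. \<bar>(LINT x|\<mu>. f x) - (LINT x|\<nu>. f x)\<bar> else 0)"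

lemma zero_in_BL_functions: "(\<lambda>_. 0) \<in> BL_functions"
  by (auto simp: BL_functions_def lipschitz_on_def)

lemma BL_functions_measurable: "f \<in> BL_functions \<Longrightarrow> f \<in> borel_measurable borel"
  by (auto simp: BL_functions_def
      intro!: borel_measurable_continuous_onI lipschitz_on_continuous_on)

lemma BL_functions_integrable:
  assumes "\<mu> \<in> submeasures" "f \<in> BL_functions"
  shows "integrable \<mu> f" "\<bar>LINT x|\<mu>. f x\<bar> \<le> 1"
proof -
  interpret subprob_space \<mu> using assms by (simp add: submeasures_def)
  have [measurable_cong]: "sets \<mu> = sets borel" using assms by (simp add: submeasures_def)
  have [measurable]: "f \<in> borel_measurable borel" using assms BL_functions_measurable by blast
  have b: "\<bar>f x\<bar> \<le> 1" for x using assms by (auto simp: BL_functions_def)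
  show i: "integrable \<mu> f" by (rule integrable_const_bound[of _ 1]) (use b in auto)
  have "\<bar>LINT x|\<mu>. f x\<bar> \<le> (LINT x|\<mu>. \<bar>f x\<bar>)" by (rule integral_abs_bound)
  also have "\<dots> \<le> (LINT x|\<mu>. 1)" by (rule integral_mono) (use i b in auto)
  also have "\<dots> \<le> 1" using subprob_measure_le_1[of "space \<mu>"] by simp
  finally show "\<bar>LINT x|\<mu>. f x\<bar> \<le> 1" .
qed

lemma dBL_bdd_above:
  assumes "\<mu> \<in> submeasures" "\<nu> \<in> submeasures"
  shows "bdd_above ((\<lambda>f. \<bar>(LINT x|\<mu>. f x) - (LINT x|\<nu>. f x)\<bar>) ` BL_functions)"
proof (rule bdd_aboveI2[where M = 2])
  fix f assume "f \<in> BL_functions"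
  then show "\<bar>(LINT x|\<mu>. f x) - (LINT x|\<nu>. f x)\<bar> \<le> 2"
    using BL_functions_integrable(2)[OF assms(1)] BL_functions_integrable(2)[OF assms(2)]
    by fastforce
qed

lemma dBL_upper:
  assumes "\<mu> \<in> submeasures" "\<nu> \<in> submeasures" "f \<in> BL_functions"
  shows "\<bar>(LINT x|\<mu>. f x) - (LINT x|\<nu>. f x)\<bar> \<le> dBL \<mu> \<nu>"
  using cSUP_upper[OF assms(3) dBL_bdd_above[OF assms(1,2)]] assms(1,2) by (simp add: dBL_def)

lemma dBL_least:
  assumes "\<mu> \<in> submeasures" "\<nu> \<in> submeasures"
    and "\<And>f. f \<in> BL_functions \<Longrightarrow> \<bar>(LINT x|\<mu>. f x) - (LINT x|\<nu>. f x)\<bar> \<le> c"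
  shows "dBL \<mu> \<nu> \<le> c"
proof -
  have "(SUP f\<in>BL_functions. \<bar>(LINT x|\<mu>. f x) - (LINT x|\<nu>. f x)\<bar>) \<le> c"
    by (rule cSUP_least) (use zero_in_BL_functions assms(3) in auto)
  then show ?thesis using assms(1,2) by (simp add: dBL_def)
qed

lemma dBL_zero_imp_eq:
  assumes \<mu>: "\<mu> \<in> submeasures" and \<nu>: "\<nu> \<in> submeasures" and z: "dBL \<mu> \<nu> = 0"
  shows "\<mu> = \<nu>"
proof (rule cdf_unique')
  interpret \<mu>: subprob_space \<mu> using \<mu> by (simp add: submeasures_def)
  interpret \<nu>: subprob_space \<nu> using \<nu> by (simp add: submeasures_def)
  have s[measurable_cong]: "sets \<mu> = sets borel" "sets \<nu> = sets borel"
    using \<mu> \<nu> by (auto simp: submeasures_def)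
  then have sp: "space \<mu> = UNIV" "space \<nu> = UNIV"
    using sets_eq_imp_space_eq[OF s(1)] sets_eq_imp_space_eq[OF s(2)] by auto
  show "finite_borel_measure \<mu>" "finite_borel_measure \<nu>"
    by unfold_locales (use s in auto)
  have BL: "(LINT x|\<mu>. f x) = (LINT x|\<nu>. f x)" if "f \<in> BL_functions" for f
    using dBL_upper[OF \<mu> \<nu> that] z by simp
  show "cdf \<mu> = cdf \<nu>"
  proof
    fix a :: real
    define g where "g n x = max 0 (min 1 (1 - real n * (x - a)))" for n :: nat and x :: real
    have lip: "(max 1 (real n))-lipschitz_on UNIV (g n)" for n
    proof (rule lipschitz_onI)
      fix x y :: real
      have "\<bar>g n x - g n y\<bar> \<le> \<bar>real n * (x - a) - real n * (y - a)\<bar>"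
        unfolding g_def by linarith
      also have "\<dots> = real n * \<bar>x - y\<bar>"
        by (simp add: right_diff_distrib[symmetric] abs_mult)
      also have "\<dots> \<le> max 1 (real n) * \<bar>x - y\<bar>" by (intro mult_right_mono) auto
      finally show "dist (g n x) (g n y) \<le> max 1 (real n) * dist x y" by (simp add: dist_real_def)
    qed simp
    have gm[measurable]: "g n \<in> borel_measurable borel" for n
      unfolding g_def by measurable
    have eq: "(LINT x|\<mu>. g n x) = (LINT x|\<nu>. g n x)" for n
    proof -
      define K where "K = max 1 (real n)"
      have K: "K \<ge> 1" by (simp add: K_def)
      have "(\<lambda>x. g n x / K) \<in> BL_functions"
        unfolding BL_functions_def
      proof (intro CollectI conjI allI lipschitz_onI)
        fix x y :: real
        have "\<bar>g n x - g n y\<bar> \<le> K * \<bar>x - y\<bar>"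
          using lipschitz_onD[OF lip, of x y n] by (simp add: dist_real_def K_def)
        then show "dist (g n x / K) (g n y / K) \<le> 1 * dist x y"
          using K by (simp add: dist_real_def diff_divide_distrib[symmetric] divide_le_eq mult.commute)
        have "\<bar>g n x\<bar> \<le> 1" by (auto simp: g_def)
        then show "\<bar>g n x / K\<bar> \<le> 1" using K by (simp add: divide_le_eq)
      qed simp
      from BL[OF this] show ?thesis using K by simp
    qed
    have lim: "(\<lambda>n. g n x) \<longlonglongrightarrow> indicator {..a} x" for x
    proof (cases "x \<le> a")
      case True
      then have "g n x = 1" for n
        by (auto simp: g_def max_def min_def mult_nonneg_nonpos not_le)
      with True show ?thesis by simp
    next
      case False
      obtain N :: nat where N: "1 / (x - a) \<le> real N" using real_arch_simple by blast
      have "\<forall>\<^sub>F n in sequentially. g n x = 0"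
      proof (rule eventually_sequentiallyI[of N])
        fix n assume "N \<le> n"
        then have "1 / (x - a) \<le> real n" using N by simp
        then have "1 \<le> real n * (x - a)" using False by (simp add: field_simps)
        then show "g n x = 0" by (simp add: g_def)
      qed
      then have "(\<lambda>n. g n x) \<longlonglongrightarrow> 0" by (rule tendsto_eventually)
      with False show ?thesis by simp
    qed
    have conv: "(\<lambda>n. LINT x|\<rho>. g n x) \<longlonglongrightarrow> cdf \<rho> a"
      if "finite_measure \<rho>" "sets \<rho> = sets borel" "space \<rho> = UNIV" for \<rho>
    proof -
      interpret finite_measure \<rho> by fact
      note that(2)[measurable_cong]
      have "(\<lambda>n. LINT x|\<rho>. g n x) \<longlonglongrightarrow> (LINT x|\<rho>. indicator {..a} x)"
        by (rule integral_dominated_convergence[where w = "\<lambda>_. 1"])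
          (use lim in \<open>auto simp: g_def\<close>)
      then show ?thesis using that(3) by (simp add: cdf_def)
    qed
    have "(\<lambda>n. LINT x|\<mu>. g n x) \<longlonglongrightarrow> cdf \<mu> a"
      by (rule conv) (use s sp in \<open>auto intro: \<mu>.finite_measure_axioms\<close>)
    moreover have "(\<lambda>n. LINT x|\<mu>. g n x) \<longlonglongrightarrow> cdf \<nu> a"
      unfolding eq by (rule conv) (use s sp in \<open>auto intro: \<nu>.finite_measure_axioms\<close>)
    ultimately show "cdf \<mu> a = cdf \<nu> a" by (rule LIMSEQ_unique)
  qed
qed

lemma Metric_space_dBL: "Metric_space submeasures dBL"
proof
  show "0 \<le> dBL \<mu> \<nu>" for \<mu> \<nu>
    using dBL_upper[OF _ _ zero_in_BL_functions, of \<mu> \<nu>]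
    by (cases "\<mu> \<in> submeasures \<and> \<nu> \<in> submeasures") (auto simp: dBL_def)
  show "dBL \<mu> \<nu> = dBL \<nu> \<mu>" for \<mu> \<nu>
    by (simp add: dBL_def abs_minus_commute conj_commute)
  show "dBL \<mu> \<nu> = 0 \<longleftrightarrow> \<mu> = \<nu>" if "\<mu> \<in> submeasures" "\<nu> \<in> submeasures" for \<mu> \<nu>
  proof
    show "\<mu> = \<nu>" if "dBL \<mu> \<nu> = 0"
      using dBL_zero_imp_eq \<open>\<mu> \<in> submeasures\<close> \<open>\<nu> \<in> submeasures\<close> that by blast
    show "dBL \<mu> \<nu> = 0" if "\<mu> = \<nu>"
    proof -
      have "BL_functions \<noteq> {}" using zero_in_BL_functions by blast
      then show ?thesis using that by (simp add: dBL_def)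
    qed
  qed
  show "dBL \<mu> \<rho> \<le> dBL \<mu> \<nu> + dBL \<nu> \<rho>"
    if "\<mu> \<in> submeasures" "\<nu> \<in> submeasures" "\<rho> \<in> submeasures" for \<mu> \<nu> \<rho>
  proof (rule dBL_least[OF that(1,3)])
    fix f assume f: "f \<in> BL_functions"
    show "\<bar>(LINT x|\<mu>. f x) - (LINT x|\<rho>. f x)\<bar> \<le> dBL \<mu> \<nu> + dBL \<nu> \<rho>"
      using dBL_upper[OF that(1,2) f] dBL_upper[OF that(2,3) f] by linarith
  qed
qed

definition submeasure_topology :: "real measure topology"
  where "submeasure_topology = Metric_space.mtopology submeasures dBL"

lemma topspace_submeasure_topology: "topspace submeasure_topology = submeasures"
  by (simp add: submeasure_topology_def Metric_space.topspace_mtopology[OF Metric_space_dBL])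

definition mass :: "real measure \<Rightarrow> real"
  where "mass \<mu> = (LINT x|\<mu>. 1)"

definition mass_one_pairs :: "(real measure \<times> real measure) set"
  where "mass_one_pairs =
    {(\<mu>, \<nu>). \<mu> \<in> submeasures \<and> \<nu> \<in> submeasures \<and> mass \<mu> + mass \<nu> = 1}"

definition pair_topology :: "(real measure \<times> real measure) topology"
  where "pair_topology =
    subtopology (prod_topology submeasure_topology submeasure_topology) mass_one_pairs"

lemma topspace_pair_topology: "topspace pair_topology = mass_one_pairs"
  by (auto simp: pair_topology_def topspace_submeasure_topology mass_one_pairs_def)

definition borel_of :: "'a topology \<Rightarrow> 'a measure"
  where "borel_of X = sigma (topspace X) {U. openin X U}"

definition ereal_ln :: "real \<Rightarrow> ereal"
  where "ereal_ln p = (if p = 0 then -\<infinity> else ereal (ln p))"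

definition lower_semicontinuous :: "'a topology \<Rightarrow> ('a \<Rightarrow> ereal) \<Rightarrow> bool"
  where "lower_semicontinuous X f \<longleftrightarrow> (\<forall>c. openin X {x \<in> topspace X. c < f x})"

text \<open>\<open>Z N\<close> is a random element of \<open>X\<close> on the probability space \<open>P N\<close>. Sequences are indexed
  by \<open>N \<ge> 1\<close>; nothing is required at \<open>N = 0\<close>. The infimum over the empty set is \<open>\<infinity>\<close>.\<close>

definition satisfies_LDP ::
    "'a topology \<Rightarrow> (nat \<Rightarrow> 'b measure) \<Rightarrow> (nat \<Rightarrow> 'b \<Rightarrow> 'a) \<Rightarrow> (nat \<Rightarrow> real) \<Rightarrow> ('a \<Rightarrow> ereal) \<Rightarrow> bool"
  where "satisfies_LDP X P Z a I \<longleftrightarrow>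
    (\<forall>N\<ge>1. prob_space (P N) \<and> Z N \<in> measurable (P N) (borel_of X)) \<and>
    filterlim a at_top sequentially \<and>
    (\<forall>x\<in>topspace X. 0 \<le> I x) \<and>
    lower_semicontinuous X I \<and>
    (\<forall>G. openin X G \<longrightarrow>
      liminf (\<lambda>N. ereal (1 / a N) * ereal_ln (measure (distr (P N) (borel_of X) (Z N)) G))
        \<ge> - (INF x\<in>G. I x)) \<and>
    (\<forall>F. closedin X F \<longrightarrow>
      limsup (\<lambda>N. ereal (1 / a N) * ereal_ln (measure (distr (P N) (borel_of X) (Z N)) F))
        \<le> - (INF x\<in>F. I x))"

definition good_rate_function :: "'a topology \<Rightarrow> ('a \<Rightarrow> ereal) \<Rightarrow> bool"
  where "good_rate_function X I \<longleftrightarrow>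
    (\<forall>C::real. C \<ge> 0 \<longrightarrow> compactin X {x \<in> topspace X. I x \<le> ereal C})"

text \<open>Vectors in \<open>\<real>\<^sup>M\<close> are functions on the index set \<open>{..<M}\<close>, so indices start at \<open>0\<close>. In the
  exponent \<open>2 * (N - M)\<close> the subtraction is on naturals, which is exact for \<open>M \<le> N\<close>.\<close>

definition lborel_vec :: "nat \<Rightarrow> (nat \<Rightarrow> real) measure"
  where "lborel_vec M = (\<Pi>\<^sub>M i\<in>{..<M}. lborel)"

definition Q_weight :: "nat \<Rightarrow> nat \<Rightarrow> (nat \<Rightarrow> real) \<Rightarrow> real"
  where "Q_weight M N lam =
    (\<Prod>i<M. lam i ^ (2 * (N - M))) *
    (\<Prod>j<M. \<Prod>i<j. \<bar>lam i - lam j\<bar> ^ 2) *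
    (\<Prod>i<M. exp (- (real N * (lam i)\<^sup>2 / 2)))"

definition Q_law :: "nat \<Rightarrow> nat \<Rightarrow> (nat \<Rightarrow> real) measure"
  where "Q_law M N = density (lborel_vec M)
    (\<lambda>lam. ennreal (Q_weight M N lam) / (\<integral>\<^sup>+ x. ennreal (Q_weight M N x) \<partial>lborel_vec M))"

text \<open>\<open>(1/M) \<Sum>\<^sub>i\<^sub>\<in>\<^sub>J \<delta>(x i)\<close>, the sum of Dirac masses being the push-forward under \<open>x\<close> of
  counting measure on \<open>J\<close>.\<close>

definition empirical_part :: "nat \<Rightarrow> nat set \<Rightarrow> (nat \<Rightarrow> real) \<Rightarrow> real measure"
  where "empirical_part M J x = scale_measure (ennreal (1 / real M)) (distr (count_space J) borel x)"

definition alpha :: "real \<Rightarrow> (nat \<Rightarrow> real) \<Rightarrow> nat \<Rightarrow> real"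
  where "alpha \<Theta> lam i = inverse \<Theta> * (lam i - sqrt 2)"

definition beta :: "real \<Rightarrow> (nat \<Rightarrow> real) \<Rightarrow> nat \<Rightarrow> real"
  where "beta \<Theta> lam i = inverse \<Theta> * (lam i + sqrt 2)"

definition mu_alpha :: "nat \<Rightarrow> real \<Rightarrow> (nat \<Rightarrow> real) \<Rightarrow> real measure"
  where "mu_alpha M \<Theta> lam = empirical_part M {i\<in>{..<M}. lam i \<ge> 0} (alpha \<Theta> lam)"

definition mu_beta :: "nat \<Rightarrow> real \<Rightarrow> (nat \<Rightarrow> real) \<Rightarrow> real measure"
  where "mu_beta M \<Theta> lam = empirical_part M {i\<in>{..<M}. lam i < 0} (\<lambda>i. - beta \<Theta> lam i)"

definition I_alpha_beta :: "real measure \<times> real measure \<Rightarrow> ereal"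
  where "I_alpha_beta = (\<lambda>(\<mu>, \<nu>).
    enn2ereal (\<integral>\<^sup>+ x. ennreal (x\<^sup>2) \<partial>\<mu>) + enn2ereal (\<integral>\<^sup>+ x. ennreal (x\<^sup>2) \<partial>\<nu>)
    - ereal (LINT x|\<mu>. (LINT y|\<nu>. 1)))"

definition I_bar :: "real measure \<times> real measure \<Rightarrow> ereal"
  where "I_bar p = I_alpha_beta p - (INF q\<in>mass_one_pairs. I_alpha_beta q)"

end

theory Submission
  imports Defs "HOL-Real_Asymp.Real_Asymp"
begin

text \<open>
  Around each of the two minima \<open>\<plusminus>sqrt 2\<close> of the potential \<open>t\<^sup>2/2 - 2 ln \<bar>t\<bar>\<close> a particle is written as
  \<open>\<bar>lam i\<bar> = sqrt 2 + \<Theta> * x i\<close>. With \<open>L = ln (\<Theta> powi (-2))\<close> the balance condition reads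
  \<open>N * \<Theta>\<^sup>2 = M * L\<close>, so the second order Taylor term \<open>N * \<Theta>\<^sup>2 * (x i)\<^sup>2\<close> of the confining energy,
  summed over the particles, is the speed \<open>M\<^sup>2 * L\<close> times the second moment of the empirical measures.
  Two particles in the same well are at distance \<open>\<Theta> * \<bar>x i - x j\<bar>\<close>; the factor \<open>\<Theta>\<^sup>2 = exp (- L)\<close> in the
  squared Vandermonde determinant costs \<open>L\<close> per such pair, and with \<open>a\<close> particles on one side and \<open>b\<close> on
  the other there are about \<open>(a\<^sup>2 + b\<^sup>2)/2 = M\<^sup>2/4 + (a - b)\<^sup>2/4\<close> of them. What remains of the interaction,
  of order \<open>M\<^sup>2\<close>, and the entropy are negligible against \<open>M\<^sup>2 * L\<close> because \<open>L\<close> tends to infinity.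
  The \<open>M\<^sup>2/4\<close> is absorbed in the normalisation, and the rate is
  \<open>\<integral>x\<^sup>2 d\<mu> + \<integral>x\<^sup>2 d\<nu> + (mass \<mu> - mass \<nu>)\<^sup>2/4\<close>, which for total mass one is \<^const>\<open>I_bar\<close>
  (\<open>I_bar_eq\<close>).

  The upper bound must hold for all configurations, including those far from the wells, where the potential
  lies only above half of the quadratic. The square is therefore replaced by \<open>soft_square k\<close>, which is
  quadratic up to \<open>k + 1\<close> and linear beyond, and increases to the square. \<open>Q_weight_upper\<close> bounds the
  density pointwise by the energy built from \<open>soft_square k\<close> and keeps a Gaussian factor whose integral is
  at most one for large \<open>N\<close>. This energy still has compact level sets (\<open>compactin_soft_square_ball\<close>), so that on a closed
  set a strict lower bound on the limiting energy already holds for some \<open>k\<close>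
  (\<open>closed_above_level_soft_square\<close>).

  For the lower bound near a pair of finite energy, the particles are put at quantiles of the two measures
  (\<open>quantile_points\<close>) and spread out by a small drift \<open>r * i / M\<close>, which keeps particles
  \<open>i < j\<close> in the same well at least \<open>r * (j - i) / (2 * M)\<close> apart. Since \<open>fact j \<ge> M^j * exp (- M)\<close>, the
  resulting product of gaps is at least \<open>exp (- C * M\<^sup>2)\<close>, and integrating the density over a box of side
  \<open>\<Theta> * r / (2 * M)\<close> loses nothing at the speed \<open>M\<^sup>2 * L\<close> (\<open>Q_weight_integral_lower\<close>).
  The two bounds applied to the whole space identify the partition function, and dividing by it gives the
  principle for the normalised law.
\<close>

section \<open>Empirical measures\<close>

lemma submeasuresD:
  assumes "\<mu> \<in> submeasures"
  shows "subprob_space \<mu>" "finite_measure \<mu>" "sets \<mu> = sets borel" "space \<mu> = UNIV"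
proof -
  show "subprob_space \<mu>" and s: "sets \<mu> = sets borel" using assms by (auto simp: submeasures_def)
  then interpret subprob_space \<mu> by simp
  show "finite_measure \<mu>" by unfold_locales
  show "space \<mu> = UNIV" using sets_eq_imp_space_eq[OF s] by simp
qed

lemma measurable_submeasure: "\<mu> \<in> submeasures \<Longrightarrow> f \<in> measurable borel X \<Longrightarrow> f \<in> measurable \<mu> X"
  using measurable_cong_sets[OF submeasuresD(3) refl] by blast

lemma BL_functionsD:
  assumes "f \<in> BL_functions" shows "\<bar>f x\<bar> \<le> 1" "\<bar>f x - f y\<bar> \<le> \<bar>x - y\<bar>"
  using assms lipschitz_onD[of 1 UNIV f x y] by (auto simp: BL_functions_def dist_real_def)

lemma borel_measurable_lipschitz:
  fixes h :: "real \<Rightarrow> real"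
  assumes "\<And>a b. \<bar>h a - h b\<bar> \<le> K * \<bar>a - b\<bar>" "0 \<le> K" shows "h \<in> borel_measurable borel"
  by (rule borel_measurable_continuous_onI, rule lipschitz_on_continuous_on[of K], rule lipschitz_onI)
     (use assms in \<open>auto simp: dist_real_def\<close>)

lemma mass_eq_measure: "\<mu> \<in> submeasures \<Longrightarrow> mass \<mu> = measure \<mu> UNIV"
  using submeasuresD(4)[of \<mu>] by (simp add: mass_def)

lemma mass_bounds:
  assumes "\<mu> \<in> submeasures" shows "0 \<le> mass \<mu>" "mass \<mu> \<le> 1"
proof -
  interpret subprob_space \<mu> by (rule submeasuresD[OF assms])
  show "0 \<le> mass \<mu>" "mass \<mu> \<le> 1"
    using subprob_measure_le_1[of UNIV] by (auto simp: mass_eq_measure[OF assms])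
qed

lemma emeasure_UNIV_eq_mass:
  assumes "\<mu> \<in> submeasures" shows "emeasure \<mu> UNIV = ennreal (mass \<mu>)"
proof -
  interpret finite_measure \<mu> by (rule submeasuresD[OF assms])
  show ?thesis by (simp add: mass_eq_measure[OF assms] emeasure_eq_measure)
qed

lemma abs_integral_BL_le_mass:
  assumes \<mu>: "\<mu> \<in> submeasures" and f: "f \<in> BL_functions" shows "\<bar>LINT x|\<mu>. f x\<bar> \<le> mass \<mu>"
proof -
  interpret finite_measure \<mu> by (rule submeasuresD[OF \<mu>])
  have "\<bar>LINT x|\<mu>. f x\<bar> \<le> (LINT x|\<mu>. \<bar>f x\<bar>)" by (rule integral_abs_bound)
  also have "\<dots> \<le> (LINT x|\<mu>. 1)"
    by (rule integral_mono) (use BL_functions_integrable(1)[OF \<mu> f] BL_functionsD(1)[OF f] in auto)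
  finally show ?thesis by (simp add: mass_def)
qed

lemma sets_empirical_part[simp]: "sets (empirical_part M J x) = sets borel"
  by (simp add: empirical_part_def)

lemma space_empirical_part[simp]: "space (empirical_part M J x) = UNIV"
  by (simp add: empirical_part_def space_scale_measure)

lemma nn_integral_empirical_part:
  assumes [measurable]: "f \<in> borel_measurable borel" and "finite J"
  shows "(\<integral>\<^sup>+ z. f z \<partial>empirical_part M J x) = ennreal (1 / real M) * (\<Sum>i\<in>J. f (x i))"
  using assms by (simp add: empirical_part_def nn_integral_scale_measure nn_integral_distr
      nn_integral_count_space_finite)

lemma emeasure_empirical_part_UNIV:
  assumes "finite J" shows "emeasure (empirical_part M J x) UNIV = ennreal (real (card J) / real M)"
proof -
  have "emeasure (empirical_part M J x) UNIV = (\<integral>\<^sup>+ z. 1 \<partial>empirical_part M J x)"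
    by (simp add: nn_integral_const)
  also have "\<dots> = ennreal (1 / real M) * of_nat (card J)"
    using assms by (subst nn_integral_empirical_part) auto
  also have "\<dots> = ennreal (real (card J) / real M)"
    by (simp add: ennreal_of_nat_eq_real_of_nat ennreal_mult[symmetric])
  finally show ?thesis .
qed

lemma empirical_part_in_submeasures:
  assumes "1 \<le> M" "J \<subseteq> {..<M}" shows "empirical_part M J x \<in> submeasures"
proof -
  have fin: "finite J" using assms(2) finite_subset by blast
  have "emeasure (empirical_part M J x) UNIV = ennreal (real (card J) / real M)"
    by (rule emeasure_empirical_part_UNIV[OF fin])
  also have "\<dots> \<le> 1"
    using assms card_mono[OF _ assms(2)] by (simp add: divide_le_eq)
  finally show ?thesis
    by (auto simp: submeasures_def intro!: subprob_spaceI)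
qed

text \<open>The formula for nonnegative integrands is transferred to bounded ones by adding the bound.\<close>
lemma integral_empirical_part:
  fixes f :: "real \<Rightarrow> real"
  assumes [measurable]: "f \<in> borel_measurable borel" and J: "1 \<le> M" "J \<subseteq> {..<M}"
    and bnd: "\<And>z. \<bar>f z\<bar> \<le> B"
  shows "(LINT z|empirical_part M J x. f z) = (\<Sum>i\<in>J. f (x i)) / real M"
proof -
  have fin: "finite J" using J(2) finite_subset by blast
  have sub: "empirical_part M J x \<in> submeasures" by (rule empirical_part_in_submeasures[OF J])
  interpret finite_measure "empirical_part M J x" by (rule submeasuresD[OF sub])
  have m1: "f \<in> borel_measurable (empirical_part M J x)"
    by (subst measurable_cong_sets[OF sets_empirical_part refl]) (rule assms(1))
  have intf: "integrable (empirical_part M J x) f"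
    using bnd m1 by (intro integrable_const_bound[of _ B]) auto
  then have int: "integrable (empirical_part M J x) (\<lambda>z. f z + B)" by simp
  have nn: "0 \<le> f z + B" for z using bnd[of z] by linarith
  have "ennreal (LINT z|empirical_part M J x. f z + B) = (\<integral>\<^sup>+ z. ennreal (f z + B) \<partial>empirical_part M J x)"
    by (rule nn_integral_eq_integral[symmetric]) (use int nn in auto)
  also have "\<dots> = ennreal (1 / real M) * (\<Sum>i\<in>J. ennreal (f (x i) + B))"
    by (rule nn_integral_empirical_part) (use fin in auto)
  also have "\<dots> = ennreal ((\<Sum>i\<in>J. f (x i) + B) / real M)"
    using nn by (simp add: sum_nonneg ennreal_mult[symmetric])
  finally have 1: "(LINT z|empirical_part M J x. f z + B) = (\<Sum>i\<in>J. f (x i) + B) / real M"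
    using nn by (simp add: sum_nonneg integral_nonneg_AE)
  have m: "measure (empirical_part M J x) UNIV = card J / real M"
    using emeasure_empirical_part_UNIV[OF fin, of M x] by (simp add: emeasure_eq_measure)
  from intf have "(LINT z|empirical_part M J x. f z + B) = (LINT z|empirical_part M J x. f z) + B * (card J / real M)"
    by (simp add: m)
  with 1 show ?thesis by (simp add: sum.distrib add_divide_distrib mult.commute)
qed

lemma mass_empirical_part:
  assumes "1 \<le> M" "J \<subseteq> {..<M}" shows "mass (empirical_part M J x) = card J / real M"
  using integral_empirical_part[OF _ assms, of "\<lambda>_. 1" 1 x] by (simp add: mass_def)

text \<open>Moving atoms moves the empirical measure by at most the mean displacement; this gives both the continuity
  behind measurability and the stability of the lower bound under small perturbations of a configuration.\<close>
lemma dBL_empirical_part_le: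
  assumes J: "1 \<le> M" "J \<subseteq> {..<M}"
  shows "dBL (empirical_part M J x) (empirical_part M J y) \<le> (\<Sum>i\<in>J. \<bar>x i - y i\<bar>) / real M"
proof (rule dBL_least)
  fix f assume f: "f \<in> BL_functions"
  have [measurable]: "f \<in> borel_measurable borel" using f BL_functions_measurable by blast
  note b = BL_functionsD(1)[OF f] and l = BL_functionsD(2)[OF f]
  have "\<bar>(LINT z|empirical_part M J x. f z) - (LINT z|empirical_part M J y. f z)\<bar>
      = \<bar>\<Sum>i\<in>J. f (x i) - f (y i)\<bar> / real M"
    using b by (simp add: integral_empirical_part[OF _ J, of f 1] sum_subtractf
        diff_divide_distrib[symmetric])
  also have "\<dots> \<le> (\<Sum>i\<in>J. \<bar>x i - y i\<bar>) / real M"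
    by (intro divide_right_mono order_trans[OF sum_abs] sum_mono l) auto
  finally show "\<bar>(LINT z|empirical_part M J x. f z) - (LINT z|empirical_part M J y. f z)\<bar>
    \<le> (\<Sum>i\<in>J. \<bar>x i - y i\<bar>) / real M" .
qed (use J in \<open>auto intro: empirical_part_in_submeasures\<close>)

text \<open>Criterion by which a box of configurations around \<open>y\<close> is seen to lie in a given neighbourhood.\<close>
lemma dBL_le_of_averages:
  assumes A: "1 \<le> M" "A \<subseteq> {..<M}" and \<rho>: "\<rho> \<in> submeasures" and s: "0 \<le> s"
    and avg: "\<And>f. f \<in> BL_functions \<Longrightarrow> \<bar>(\<Sum>i\<in>A. f (y i)) / real M - (LINT x|\<rho>. f x)\<bar> \<le> t"
    and near: "\<And>i. i < M \<Longrightarrow> \<bar>x i - y i\<bar> \<le> s"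
  shows "dBL \<rho> (empirical_part M A x) \<le> t + s"
proof -
  note E = empirical_part_in_submeasures[OF A]
  have "dBL \<rho> (empirical_part M A y) \<le> t"
  proof (rule dBL_least[OF \<rho> E])
    fix f assume f: "f \<in> BL_functions"
    have "(LINT z|empirical_part M A y. f z) = (\<Sum>i\<in>A. f (y i)) / real M"
      using BL_functionsD(1)[OF f] by (intro integral_empirical_part[OF BL_functions_measurable[OF f] A]) auto
    then show "\<bar>(LINT x|\<rho>. f x) - (LINT x|empirical_part M A y. f x)\<bar> \<le> t" using avg[OF f] by (simp add: abs_minus_commute)
  qed
  moreover have "dBL (empirical_part M A y) (empirical_part M A x) \<le> s"
  proof -
    have "(\<Sum>i\<in>A. \<bar>y i - x i\<bar>) \<le> (\<Sum>i\<in>A. s)"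
      using A near by (intro sum_mono) (auto simp: abs_minus_commute)
    also have "\<dots> = real (card A) * s" by simp
    also have "\<dots> \<le> real M * s" using card_mono[OF finite_lessThan A(2)] s by (intro mult_right_mono) auto
    finally have "(\<Sum>i\<in>A. \<bar>y i - x i\<bar>) / real M \<le> s" using A by (simp add: divide_le_eq mult.commute)
    then show ?thesis by (rule order_trans[OF dBL_empirical_part_le[OF A]])
  qed
  ultimately show ?thesis using Metric_space.triangle[OF Metric_space_dBL \<rho> E[of y] E[of x]] by linarith
qed

section \<open>Continuity and semicontinuity of integral functionals\<close>

lemma integral_lipschitz_dBL:
  fixes f :: "real \<Rightarrow> real"
  assumes \<mu>: "\<mu> \<in> submeasures" and \<nu>: "\<nu> \<in> submeasures"
    and lip: "\<And>x y. \<bar>f x - f y\<bar> \<le> K * \<bar>x - y\<bar>" and bnd: "\<And>x. \<bar>f x\<bar> \<le> K" and K: "0 < K"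
  shows "\<bar>(LINT x|\<mu>. f x) - (LINT x|\<nu>. f x)\<bar> \<le> K * dBL \<mu> \<nu>"
proof -
  have "(\<lambda>x. f x / K) \<in> BL_functions"
    unfolding BL_functions_def
  proof (intro CollectI conjI allI lipschitz_onI)
    fix x y :: real
    show "dist (f x / K) (f y / K) \<le> 1 * dist x y"
      using K lip[of x y] by (simp add: dist_real_def diff_divide_distrib[symmetric] divide_le_eq mult.commute)
    show "\<bar>f x / K\<bar> \<le> 1" using K bnd[of x] by (simp add: divide_le_eq)
  qed simp
  from dBL_upper[OF \<mu> \<nu> this] show ?thesis
    using K by (simp add: diff_divide_distrib[symmetric] divide_le_eq mult.commute)
qed

lemma continuous_map_integral:
  fixes f :: "real \<Rightarrow> real"
  assumes lip: "\<And>x y. \<bar>f x - f y\<bar> \<le> K * \<bar>x - y\<bar>" and bnd: "\<And>x. \<bar>f x\<bar> \<le> K" and K: "0 < K"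
  shows "continuous_map submeasure_topology euclideanreal (\<lambda>\<mu>. LINT x|\<mu>. f x)"
proof -
  have "continuous_map submeasure_topology (Metric_space.mtopology UNIV dist) (\<lambda>\<mu>. LINT x|\<mu>. f x)"
    unfolding submeasure_topology_def Metric_space.metric_continuous_map[OF Metric_space_dBL Met_TC.Metric_space_axioms]
  proof (intro conjI ballI allI impI)
    fix \<mu> :: "real measure" and e :: real assume \<mu>: "\<mu> \<in> submeasures" and e: "0 < e"
    show "\<exists>\<delta>>0. \<forall>\<nu>. \<nu> \<in> submeasures \<and> dBL \<mu> \<nu> < \<delta> \<longrightarrow> dist (LINT x|\<mu>. f x) (LINT x|\<nu>. f x) < e"
    proof (intro exI[of _ "e / K"] conjI allI impI)
      show "0 < e / K" using e K by simp
      fix \<nu> assume "\<nu> \<in> submeasures \<and> dBL \<mu> \<nu> < e / K"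
      then show "dist (LINT x|\<mu>. f x) (LINT x|\<nu>. f x) < e"
        using integral_lipschitz_dBL[OF \<mu> _ lip bnd K, of \<nu>] K
        by (simp add: dist_real_def pos_less_divide_eq mult.commute)
    qed
  qed simp
  then show ?thesis by simp
qed

lemma continuous_map_mass: "continuous_map submeasure_topology euclideanreal mass"
proof -
  have "mass = (\<lambda>\<mu>. LINT x|\<mu>. 1)" by (auto simp: mass_def)
  then show ?thesis using continuous_map_integral[of "\<lambda>_. 1" 1] by auto
qed

lemma continuous_map_pair_fst: "continuous_map pair_topology submeasure_topology fst"
  and continuous_map_pair_snd: "continuous_map pair_topology submeasure_topology snd"
  unfolding pair_topology_def
  by (auto intro: continuous_map_from_subtopology continuous_map_fst continuous_map_snd)

text \<open>For \<open>h x = x\<^sup>2\<close> this is the rate function on \<^const>\<open>mass_one_pairs\<close>. Keeping \<open>h\<close> general makes room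
  for the truncated squares, and values in \<^typ>\<open>ennreal\<close> let monotone limits in \<open>h\<close> pass inside.\<close>
definition energy :: "(real \<Rightarrow> real) \<Rightarrow> real measure \<times> real measure \<Rightarrow> ennreal"
  where "energy h p = (\<integral>\<^sup>+ x. ennreal (h x) \<partial>fst p) + (\<integral>\<^sup>+ x. ennreal (h x) \<partial>snd p)
    + ennreal ((mass (fst p) - mass (snd p))\<^sup>2 / 4)"

text \<open>For bounded Lipschitz \<open>h\<close> the energy is a continuous real function of the pair.\<close>
lemma openin_energy_bounded:
  fixes h :: "real \<Rightarrow> real"
  assumes lip: "\<And>x y. \<bar>h x - h y\<bar> \<le> K * \<bar>x - y\<bar>" and bnd: "\<And>x. h x \<le> K" and K: "0 < K"
    and nn: "\<And>x. 0 \<le> h x"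
  shows "openin pair_topology {p \<in> mass_one_pairs. c < energy h p}"
proof -
  define g where "g p = (LINT x|fst p. h x) + (LINT x|snd p. h x) + (mass (fst p) - mass (snd p))\<^sup>2 / 4"
    for p :: "real measure \<times> real measure"
  have bnd': "\<bar>h x\<bar> \<le> K" for x using bnd nn by simp
  have meas: "h \<in> borel_measurable borel" by (rule borel_measurable_lipschitz[OF lip]) (use K in simp)
  have eq: "energy h p = ennreal (g p)" if "p \<in> mass_one_pairs" for p
  proof -
    have *: "(\<integral>\<^sup>+ x. ennreal (h x) \<partial>\<mu>) = ennreal (LINT x|\<mu>. h x)" if "\<mu> \<in> submeasures" for \<mu>
    proof (rule nn_integral_eq_integral)
      interpret finite_measure \<mu> by (rule submeasuresD[OF that])
      show "integrable \<mu> h"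
        by (rule integrable_const_bound[of _ K])
           (use bnd' measurable_submeasure[OF that meas] in auto)
    qed (use nn in auto)
    have "fst p \<in> submeasures" "snd p \<in> submeasures" using that by (auto simp: mass_one_pairs_def)
    then show ?thesis
      unfolding energy_def g_def by (simp add: * nn ennreal_plus[symmetric] del: ennreal_plus)
  qed
  have int: "continuous_map submeasure_topology euclideanreal (\<lambda>\<mu>. LINT x|\<mu>. h x)"
    by (rule continuous_map_integral[OF lip bnd' K])
  have cont: "continuous_map pair_topology euclideanreal g"
  proof -
    note c = continuous_map_compose[OF continuous_map_pair_fst, unfolded comp_def]
      continuous_map_compose[OF continuous_map_pair_snd, unfolded comp_def]
    have "continuous_map pair_topology euclideanreal (\<lambda>p. (mass (fst p) - mass (snd p))\<^sup>2 * (1/4))"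
      by (intro continuous_map_real_mult_right continuous_map_real_pow continuous_map_diff
          c continuous_map_mass)
    then show ?thesis unfolding g_def
      by (intro continuous_map_add c int) simp
  qed
  have "openin pair_topology {p \<in> topspace pair_topology. g p \<in> {x. c < ennreal x}}"
  proof (rule openin_continuous_map_preimage[OF cont])
    have "open (ennreal -` {c<..})"
      by (intro open_vimage continuous_on_ennreal continuous_on_id) simp
    then show "openin euclideanreal {x. c < ennreal x}" by (simp add: vimage_def)
  qed
  also have "{p \<in> topspace pair_topology. g p \<in> {x. c < ennreal x}} = {p \<in> mass_one_pairs. c < energy h p}"
    using eq by (auto simp: topspace_pair_topology)
  finally show ?thesis .
qed

lemma energy_SUP:
  assumes inc: "\<And>x. incseq (\<lambda>n. h n x)" and sup: "\<And>x. (\<lambda>n. h n x) \<longlonglongrightarrow> H x"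
    and meas: "\<And>n. h n \<in> borel_measurable borel" and p: "p \<in> mass_one_pairs"
  shows "energy H p = (SUP n. energy (h n) p)" "incseq (\<lambda>n. energy (h n) p)"
proof -
  have m: "(\<lambda>x. ennreal (h n x)) \<in> borel_measurable \<mu>" if "\<mu> \<in> submeasures" for n \<mu>
    by (rule measurable_submeasure[OF that]) (use meas in measurable)
  have inc': "incseq (\<lambda>n x. ennreal (h n x))"
    using inc by (auto simp: incseq_def le_fun_def intro!: ennreal_leI)
  have incI: "incseq (\<lambda>n. \<integral>\<^sup>+ x. ennreal (h n x) \<partial>\<mu>)" for \<mu>
    using inc' by (auto simp: incseq_def le_fun_def intro!: nn_integral_mono)
  have pt: "(SUP n. ennreal (h n x)) = ennreal (H x)" for x
    by (rule LIMSEQ_unique[OF LIMSEQ_SUP tendsto_ennrealI[OF sup]])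
       (use inc in \<open>auto simp: incseq_def intro!: ennreal_leI\<close>)
  have conv: "(\<integral>\<^sup>+ x. ennreal (H x) \<partial>\<mu>) = (SUP n. \<integral>\<^sup>+ x. ennreal (h n x) \<partial>\<mu>)" if "\<mu> \<in> submeasures" for \<mu>
    unfolding pt[symmetric] by (rule nn_integral_monotone_convergence_SUP[OF inc' m[OF that]])
  have sub: "fst p \<in> submeasures" "snd p \<in> submeasures" using p by (auto simp: mass_one_pairs_def)
  show "incseq (\<lambda>n. energy (h n) p)"
    unfolding energy_def using incI by (auto simp: incseq_def intro!: add_mono)
  show "energy H p = (SUP n. energy (h n) p)"
    unfolding energy_def conv[OF sub(1)] conv[OF sub(2)]
    by (subst ennreal_SUP_add[symmetric, OF incI incI], subst ennreal_SUP_add_left[symmetric]) auto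
qed

text \<open>A supremum of lower semicontinuous functions is lower semicontinuous. This is applied twice: to cut off
  \<open>soft_square k\<close> at height \<open>n\<close>, and to let \<open>k\<close> tend to infinity.\<close>
lemma openin_energy_limit:
  assumes inc: "\<And>x. incseq (\<lambda>n. h n x)" and sup: "\<And>x. (\<lambda>n. h n x) \<longlonglongrightarrow> H x"
    and meas: "\<And>n. h n \<in> borel_measurable borel"
    and op: "\<And>n. openin pair_topology {p \<in> mass_one_pairs. c < energy (h n) p}"
  shows "openin pair_topology {p \<in> mass_one_pairs. c < energy H p}"
proof -
  have "{p \<in> mass_one_pairs. c < energy H p} = (\<Union>n. {p \<in> mass_one_pairs. c < energy (h n) p})"
    using energy_SUP(1)[OF inc sup meas] by (auto simp: less_SUP_iff)
  then show ?thesis using op by (auto intro: openin_Union)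
qed

text \<open>A multiple of \<open>x\<^sup>2\<close> up to \<open>k + 1\<close> and of \<open>\<bar>x\<bar>\<close> beyond. The linear growth keeps it below \<open>x\<^sup>2/2\<close> for
  \<open>\<bar>x\<bar> \<ge> 2 * (k + 1)\<close>, which is all that the potential guarantees far from its minimum, makes it Lipschitz, and
  still forces tightness. The prefactor, less than one and tending to one, leaves room for the relative
  error of the quadratic approximation near the minimum.\<close>
definition soft_square :: "nat \<Rightarrow> real \<Rightarrow> real"
  where "soft_square k x = real (k + 1) / real (k + 2) * (\<bar>x\<bar> * min \<bar>x\<bar> (real (k + 1)))"

lemma soft_square_nonneg: "0 \<le> soft_square k x"
  by (simp add: soft_square_def)

lemma soft_square_measurable[measurable]: "soft_square k \<in> borel_measurable borel"
  unfolding soft_square_def by measurable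

lemma lipschitz_abs_mult_min:
  fixes a :: real assumes a: "0 \<le> a"
  shows "\<bar>\<bar>x\<bar> * min \<bar>x\<bar> a - \<bar>y\<bar> * min \<bar>y\<bar> a\<bar> \<le> 2 * a * \<bar>x - y\<bar>"
proof -
  have *: "0 \<le> u * min u a - v * min v a \<and> u * min u a - v * min v a \<le> 2 * a * (u - v)"
    if "0 \<le> v" "v \<le> u" for u v
  proof -
    consider "u \<le> a" | "v \<le> a" "a < u" | "a < v" by linarith
    then show ?thesis
    proof cases
      case 1
      then have "(u - v) * (u + v) \<le> (u - v) * (2 * a)" using that by (intro mult_left_mono) auto
      moreover have "0 \<le> (u - v) * (u + v)" using that by simp
      ultimately show ?thesis using 1 that by (simp add: algebra_simps)
    next
      case 2
      have "(a - v) * (a + v) \<le> (a - v) * (2 * a)" using 2 that by (intro mult_left_mono) auto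
      moreover have "0 \<le> (a - v) * (a + v)" using 2 that by simp
      moreover have "0 \<le> a * (u - a)" using 2 a by simp
      ultimately show ?thesis using 2 by (simp add: algebra_simps)
    next
      case 3
      then have "0 \<le> a * (u - v)" using a that by simp
      then show ?thesis using 3 that by (simp add: algebra_simps)
    qed
  qed
  have ab: "2 * a * \<bar>\<bar>x\<bar> - \<bar>y\<bar>\<bar> \<le> 2 * a * \<bar>x - y\<bar>" using a by (intro mult_left_mono) auto
  show ?thesis
  proof (cases "\<bar>y\<bar> \<le> \<bar>x\<bar>")
    case True then show ?thesis using *[of "\<bar>y\<bar>" "\<bar>x\<bar>"] ab by simp
  next
    case False then show ?thesis using *[of "\<bar>x\<bar>" "\<bar>y\<bar>"] ab by simp
  qed
qed

lemma soft_square_lipschitz: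
  "\<bar>soft_square k x - soft_square k y\<bar> \<le> 2 * real (k + 1) * \<bar>x - y\<bar>"
proof -
  have "\<bar>soft_square k x - soft_square k y\<bar> = real (k + 1) / real (k + 2) *
     \<bar>\<bar>x\<bar> * min \<bar>x\<bar> (real (k + 1)) - \<bar>y\<bar> * min \<bar>y\<bar> (real (k + 1))\<bar>"
    unfolding soft_square_def by (simp only: right_diff_distrib[symmetric] abs_mult) simp
  also have "\<dots> \<le> 1 * (2 * real (k + 1) * \<bar>x - y\<bar>)"
    by (intro mult_mono lipschitz_abs_mult_min) auto
  finally show ?thesis by simp
qed

lemma incseq_soft_square: "incseq (\<lambda>k. soft_square k x)"
proof (rule incseq_SucI)
  fix k
  have "real (k + 1) / real (k + 2) \<le> real (Suc k + 1) / real (Suc k + 2)"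
    by (simp add: divide_simps algebra_simps)
  then show "soft_square k x \<le> soft_square (Suc k) x"
    unfolding soft_square_def by (intro mult_mono) auto
qed

lemma soft_square_tendsto: "(\<lambda>k. soft_square k x) \<longlonglongrightarrow> x\<^sup>2"
proof -
  obtain n :: nat where n: "\<bar>x\<bar> \<le> real n" using real_arch_simple by blast
  have "(\<lambda>k. real (k + 1) / real (k + 2)) \<longlonglongrightarrow> 1"
  proof -
    have "(\<lambda>k. 1 - inverse (real (Suc (Suc k)))) \<longlonglongrightarrow> 1 - 0"
      by (intro tendsto_diff tendsto_const LIMSEQ_Suc[OF LIMSEQ_inverse_real_of_nat])
    moreover have "1 - inverse (real (Suc (Suc k))) = real (k + 1) / real (k + 2)" for k
      by (simp add: field_simps)
    ultimately show ?thesis by simp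
  qed
  then have "(\<lambda>k. real (k + 1) / real (k + 2) * x\<^sup>2) \<longlonglongrightarrow> 1 * x\<^sup>2"
    by (intro tendsto_mult tendsto_const)
  moreover have "eventually (\<lambda>k. real (k + 1) / real (k + 2) * x\<^sup>2 = soft_square k x) sequentially"
    using eventually_ge_at_top[of n]
  proof eventually_elim
    case (elim k)
    then have "min \<bar>x\<bar> (real (k + 1)) = \<bar>x\<bar>" using n by auto
    then show ?case by (simp add: soft_square_def power2_eq_square)
  qed
  ultimately show ?thesis by (auto dest: Lim_transform_eventually)
qed

lemma openin_energy_soft_square:
  "openin pair_topology {p \<in> mass_one_pairs. c < energy (soft_square k) p}"
proof (rule openin_energy_limit[where h = "\<lambda>n x. min (soft_square k x) (real n)"])
  show "incseq (\<lambda>n. min (soft_square k x) (real n))" for x by (auto simp: incseq_def)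
  show "(\<lambda>n. min (soft_square k x) (real n)) \<longlonglongrightarrow> soft_square k x" for x
  proof (rule tendsto_eventually)
    obtain n :: nat where "soft_square k x \<le> real n" using real_arch_simple by blast
    then show "\<forall>\<^sub>F n in sequentially. min (soft_square k x) (real n) = soft_square k x"
      by (auto intro!: eventually_sequentiallyI[of n])
  qed
  fix n
  show "openin pair_topology {p \<in> mass_one_pairs. c < energy (\<lambda>x. min (soft_square k x) (real n)) p}"
  proof (rule openin_energy_bounded)
    let ?K = "2 * real (k + 1) + real n"
    show "\<bar>min (soft_square k x) (real n) - min (soft_square k y) (real n)\<bar> \<le> ?K * \<bar>x - y\<bar>" for x y
    proof -
      have "\<bar>min (soft_square k x) (real n) - min (soft_square k y) (real n)\<bar>
        \<le> \<bar>soft_square k x - soft_square k y\<bar>" by linarith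
      also have "\<dots> \<le> 2 * real (k + 1) * \<bar>x - y\<bar>" by (rule soft_square_lipschitz)
      also have "\<dots> \<le> ?K * \<bar>x - y\<bar>" by (intro mult_right_mono) auto
      finally show ?thesis .
    qed
  qed (auto simp: soft_square_nonneg)
qed measurable

lemma openin_energy_square:
  "openin pair_topology {p \<in> mass_one_pairs. c < energy (\<lambda>x. x\<^sup>2) p}"
  by (rule openin_energy_limit[OF incseq_soft_square soft_square_tendsto])
     (auto intro: openin_energy_soft_square)

section \<open>Compactness under a moment bound\<close>

lemma scale_measure_eq_density: "scale_measure (ennreal c) \<mu> = density \<mu> (\<lambda>_. ennreal c)"
  by (rule measure_eqI) (auto simp: emeasure_density nn_integral_cmult_indicator)

lemma integral_scale_measure:
  fixes f :: "'a \<Rightarrow> real"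
  assumes "f \<in> borel_measurable \<mu>" "0 \<le> c"
  shows "(LINT x|scale_measure (ennreal c) \<mu>. f x) = c * (LINT x|\<mu>. f x)"
  unfolding scale_measure_eq_density using assms by (subst integral_density) auto

lemma real_distribution_in_submeasures: "real_distribution \<rho> \<Longrightarrow> \<rho> \<in> submeasures"
  unfolding submeasures_def
  by (auto simp: real_distribution_def real_distribution_axioms_def prob_space_imp_subprob_space)

lemma scale_measure_in_submeasures:
  assumes "real_distribution \<rho>" "0 \<le> c" "c \<le> 1"
  shows "scale_measure (ennreal c) \<rho> \<in> submeasures" "mass (scale_measure (ennreal c) \<rho>) = c"
proof -
  interpret real_distribution \<rho> by fact
  show *: "scale_measure (ennreal c) \<rho> \<in> submeasures"
    unfolding submeasures_def using assms emeasure_space_1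
    by (auto intro!: subprob_spaceI simp: space_scale_measure)
  show "mass (scale_measure (ennreal c) \<rho>) = c"
    using assms prob_space by (simp add: mass_def space_scale_measure)
qed

lemma normalised_real_distribution:
  assumes \<mu>: "\<mu> \<in> submeasures" and m: "0 < mass \<mu>"
  shows "real_distribution (scale_measure (ennreal (1 / mass \<mu>)) \<mu>)"
    "scale_measure (ennreal (mass \<mu>)) (scale_measure (ennreal (1 / mass \<mu>)) \<mu>) = \<mu>"
proof -
  have "emeasure (scale_measure (ennreal (1 / mass \<mu>)) \<mu>) UNIV = 1"
    using m by (simp add: emeasure_UNIV_eq_mass[OF \<mu>] ennreal_mult[symmetric])
  then show "real_distribution (scale_measure (ennreal (1 / mass \<mu>)) \<mu>)"
    unfolding real_distribution_def real_distribution_axioms_def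
    using submeasuresD[OF \<mu>] by (auto intro!: prob_spaceI simp: space_scale_measure)
  show "scale_measure (ennreal (mass \<mu>)) (scale_measure (ennreal (1 / mass \<mu>)) \<mu>) = \<mu>"
    using m by (simp add: ennreal_mult[symmetric])
qed

text \<open>Skorohod's coupling replaces the measures by almost surely convergent random variables. Then the
  bounded-Lipschitz distance is at most the expectation of \<open>min 2 \<bar>Yn - Y\<bar>\<close>, uniformly in the test function, and
  the second claim is Fatou's lemma.\<close>
lemma weak_conv_uniform_BL:
  assumes \<rho>: "\<And>n. real_distribution (\<rho> n)" and \<sigma>: "real_distribution \<sigma>" and w: "weak_conv_m \<rho> \<sigma>"
  shows "(\<lambda>n. dBL (\<rho> n) \<sigma>) \<longlonglongrightarrow> 0"
    and "continuous_on UNIV h \<Longrightarrow> (\<integral>\<^sup>+ x. ennreal (h x) \<partial>\<sigma>) \<le> liminf (\<lambda>n. \<integral>\<^sup>+ x. ennreal (h x) \<partial>\<rho> n)"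
proof -
  obtain \<Omega> :: "real measure" and Yn and Y :: "real \<Rightarrow> real" where
    \<Omega>: "prob_space \<Omega>" and Yn: "\<And>n. Yn n \<in> borel_measurable \<Omega>" and dn: "\<And>n. distr \<Omega> borel (Yn n) = \<rho> n"
    and Y': "Y \<in> measurable \<Omega> lborel" and d: "distr \<Omega> borel Y = \<sigma>"
    and lim: "\<And>x. x \<in> space \<Omega> \<Longrightarrow> (\<lambda>n. Yn n x) \<longlonglongrightarrow> Y x"
    using Skorohod[OF \<rho> \<sigma> w] by metis
  note [measurable] = Yn
  have Y[measurable]: "Y \<in> borel_measurable \<Omega>" using Y' by simp
  interpret prob_space \<Omega> by fact
  define \<delta> where "\<delta> n = (LINT x|\<Omega>. min 2 \<bar>Yn n x - Y x\<bar>)" for n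
  have \<delta>: "\<delta> \<longlonglongrightarrow> 0"
  proof -
    have "\<delta> \<longlonglongrightarrow> (LINT x|\<Omega>. 0)" unfolding \<delta>_def
    proof (rule integral_dominated_convergence[where w = "\<lambda>_. 2"])
      show "AE x in \<Omega>. (\<lambda>n. min 2 \<bar>Yn n x - Y x\<bar>) \<longlonglongrightarrow> 0"
      proof (rule AE_I2)
        fix x assume "x \<in> space \<Omega>"
        then have "(\<lambda>n. min 2 \<bar>Yn n x - Y x\<bar>) \<longlonglongrightarrow> min 2 \<bar>Y x - Y x\<bar>"
          by (intro tendsto_intros lim)
        then show "(\<lambda>n. min 2 \<bar>Yn n x - Y x\<bar>) \<longlonglongrightarrow> 0" by simp
      qed
    qed auto
    then show ?thesis by simp
  qed
  have sub: "\<rho> n \<in> submeasures" "\<sigma> \<in> submeasures" for n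
    using \<rho> \<sigma> real_distribution_in_submeasures by auto
  have "dBL (\<rho> n) \<sigma> \<le> \<delta> n" for n
  proof (rule dBL_least[OF sub])
    fix f assume f: "f \<in> BL_functions"
    have fm[measurable]: "f \<in> borel_measurable borel" using f BL_functions_measurable by blast
    note b = BL_functionsD(1)[OF f] and l = BL_functionsD(2)[OF f]
    have i: "integrable \<Omega> (\<lambda>x. f (Z x))" if [measurable]: "Z \<in> borel_measurable \<Omega>" for Z
      by (rule integrable_const_bound[of _ 1]) (use b in auto)
    have i2: "integrable \<Omega> (\<lambda>x. min 2 \<bar>Yn n x - Y x\<bar>)"
      by (rule integrable_const_bound[of _ 2]) auto
    have "(LINT x|\<rho> n. f x) - (LINT x|\<sigma>. f x) = (LINT x|\<Omega>. f (Yn n x) - f (Y x))"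
      unfolding dn[symmetric] d[symmetric] by (simp add: integral_distr i)
    also have "\<bar>\<dots>\<bar> \<le> (LINT x|\<Omega>. \<bar>f (Yn n x) - f (Y x)\<bar>)" by (rule integral_abs_bound)
    also have "\<dots> \<le> \<delta> n" unfolding \<delta>_def
    proof (rule integral_mono)
      show "\<bar>f (Yn n x) - f (Y x)\<bar> \<le> min 2 \<bar>Yn n x - Y x\<bar>" for x
        using l[of "Yn n x" "Y x"] b[of "Yn n x"] b[of "Y x"] by linarith
    qed (use i i2 in auto)
    finally show "\<bar>(LINT x|\<rho> n. f x) - (LINT x|\<sigma>. f x)\<bar> \<le> \<delta> n" .
  qed
  then show "(\<lambda>n. dBL (\<rho> n) \<sigma>) \<longlonglongrightarrow> 0"
    using Metric_space.nonneg[OF Metric_space_dBL]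
    by (intro tendsto_sandwich[OF _ _ tendsto_const \<delta>]) auto
  assume h: "continuous_on UNIV h"
  have hm[measurable]: "h \<in> borel_measurable borel" using h by (rule borel_measurable_continuous_onI)
  have "(\<integral>\<^sup>+ x. ennreal (h x) \<partial>\<sigma>) = (\<integral>\<^sup>+ x. ennreal (h (Y x)) \<partial>\<Omega>)"
    unfolding d[symmetric] by (simp add: nn_integral_distr)
  also have "\<dots> = (\<integral>\<^sup>+ x. liminf (\<lambda>n. ennreal (h (Yn n x))) \<partial>\<Omega>)"
  proof (rule nn_integral_cong)
    fix x assume "x \<in> space \<Omega>"
    then have "(\<lambda>n. h (Yn n x)) \<longlonglongrightarrow> h (Y x)"
      using h lim continuous_on_tendsto_compose[OF h, of "\<lambda>n. Yn n x" "Y x"] by auto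
    then show "ennreal (h (Y x)) = liminf (\<lambda>n. ennreal (h (Yn n x)))"
      by (intro lim_imp_Liminf[symmetric] tendsto_ennrealI) auto
  qed
  also have "\<dots> \<le> liminf (\<lambda>n. \<integral>\<^sup>+ x. ennreal (h (Yn n x)) \<partial>\<Omega>)"
    by (rule nn_integral_liminf) auto
  also have "(\<lambda>n. \<integral>\<^sup>+ x. ennreal (h (Yn n x)) \<partial>\<Omega>) = (\<lambda>n. \<integral>\<^sup>+ x. ennreal (h x) \<partial>\<rho> n)"
    unfolding dn[symmetric] by (auto simp: nn_integral_distr)
  finally show "(\<integral>\<^sup>+ x. ennreal (h x) \<partial>\<sigma>) \<le> liminf (\<lambda>n. \<integral>\<^sup>+ x. ennreal (h x) \<partial>\<rho> n)" .
qed

lemma dBL_scale_measure_le: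
  assumes \<rho>: "real_distribution \<rho>" and \<sigma>: "real_distribution \<sigma>"
    and a: "0 \<le> a" "a \<le> 1" and b: "0 \<le> b" "b \<le> 1"
  shows "dBL (scale_measure (ennreal a) \<rho>) (scale_measure (ennreal b) \<sigma>) \<le> \<bar>a - b\<bar> + dBL \<rho> \<sigma>"
proof (rule dBL_least)
  fix f assume f: "f \<in> BL_functions"
  have fm: "f \<in> borel_measurable borel" using f BL_functions_measurable by blast
  have s: "\<rho> \<in> submeasures" "\<sigma> \<in> submeasures" using \<rho> \<sigma> real_distribution_in_submeasures by auto
  have m: "f \<in> borel_measurable \<rho>" "f \<in> borel_measurable \<sigma>"
    using fm \<rho> \<sigma> by (auto intro: real_distribution.measurable_finite_borel)
  have "a * (LINT x|\<rho>. f x) - b * (LINT x|\<sigma>. f x)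
    = (a - b) * (LINT x|\<rho>. f x) + b * ((LINT x|\<rho>. f x) - (LINT x|\<sigma>. f x))" by (simp add: algebra_simps)
  also have "\<bar>\<dots>\<bar> \<le> \<bar>a - b\<bar> * 1 + 1 * dBL \<rho> \<sigma>"
  proof (intro order_trans[OF abs_triangle_ineq] add_mono)
    show "\<bar>(a - b) * (LINT x|\<rho>. f x)\<bar> \<le> \<bar>a - b\<bar> * 1"
      unfolding abs_mult using BL_functions_integrable(2)[OF s(1) f] by (intro mult_left_mono) auto
    show "\<bar>b * ((LINT x|\<rho>. f x) - (LINT x|\<sigma>. f x))\<bar> \<le> 1 * dBL \<rho> \<sigma>"
      unfolding abs_mult using dBL_upper[OF s f] b by (intro mult_mono) auto
  qed
  finally show "\<bar>(LINT x|scale_measure (ennreal a) \<rho>. f x) - (LINT x|scale_measure (ennreal b) \<sigma>. f x)\<bar>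
     \<le> \<bar>a - b\<bar> + dBL \<rho> \<sigma>"
    using m a b by (simp add: integral_scale_measure)
qed (use assms in \<open>auto intro: scale_measure_in_submeasures\<close>)

text \<open>Markov's inequality, as \<open>soft_square 0 x = \<bar>x\<bar>/2\<close> for \<open>\<bar>x\<bar> \<ge> 1\<close>.\<close>
lemma tight_of_soft_square_bound:
  assumes \<rho>: "\<And>n. real_distribution (\<rho> n)"
    and bnd: "\<And>n. (\<integral>\<^sup>+ x. ennreal (soft_square 0 x) \<partial>\<rho> n) \<le> ennreal B" and B: "0 \<le> B"
  shows "tight \<rho>"
  unfolding tight_def
proof (intro conjI allI impI \<rho>)
  fix e :: real assume e: "0 < e"
  define a where "a = 1 + 2 * B / e"
  have a: "1 \<le> a" using e B by (simp add: a_def)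
  have "measure (\<rho> n) {-a<..a} > 1 - e" for n
  proof -
    interpret real_distribution "\<rho> n" by (rule \<rho>)
    have "ennreal (a / 2 * measure (\<rho> n) (-{-a<..a})) = (\<integral>\<^sup>+ x. ennreal (a / 2) * indicator (-{-a<..a}) x \<partial>\<rho> n)"
      using a by (subst ennreal_mult) (simp_all add: nn_integral_cmult_indicator emeasure_eq_measure)
    also have "\<dots> \<le> (\<integral>\<^sup>+ x. ennreal (soft_square 0 x) \<partial>\<rho> n)"
    proof (rule nn_integral_mono)
      fix x
      show "ennreal (a / 2) * indicator (-{-a<..a}) x \<le> ennreal (soft_square 0 x)"
      proof (cases "x \<in> {-a<..a}")
        case False
        then have x: "a \<le> \<bar>x\<bar>" by auto
        then have "soft_square 0 x = \<bar>x\<bar> / 2" using a by (simp add: soft_square_def)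
        then show ?thesis using False x by (auto intro!: ennreal_leI)
      qed simp
    qed
    also have "\<dots> \<le> ennreal B" by (rule bnd)
    finally have "a / 2 * measure (\<rho> n) (-{-a<..a}) \<le> B" using B by (simp add: ennreal_le_iff)
    moreover have "a / 2 * e > B" using e by (simp add: a_def field_simps)
    ultimately have "a / 2 * measure (\<rho> n) (-{-a<..a}) < a / 2 * e" by linarith
    then have "measure (\<rho> n) (-{-a<..a}) < e" using a by simp
    moreover have "measure (\<rho> n) (-{-a<..a}) = 1 - measure (\<rho> n) {-a<..a}"
      using prob_compl[of "{-a<..a}"] by (simp add: Compl_eq_Diff_UNIV)
    ultimately show ?thesis by linarith
  qed
  then show "\<exists>a b. a < b \<and> (\<forall>n. 1 - e < measure (\<rho> n) {a<..b})"
    using a by (intro exI[of _ "-a"] exI[of _ a]) auto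
qed

lemma continuous_soft_square: "continuous_on A (soft_square k)"
  unfolding soft_square_def by (intro continuous_intros)

text \<open>Prokhorov's theorem for measures of varying mass. Along a subsequence the masses converge to some \<open>m\<close>.
  If \<open>m = 0\<close> the limit is the null measure; otherwise Helly's selection theorem is applied to the normalised
  measures.\<close>
lemma compactin_soft_square_ball:
  assumes R: "0 \<le> R"
  shows "compactin submeasure_topology {\<mu> \<in> submeasures. (\<integral>\<^sup>+ x. ennreal (soft_square 0 x) \<partial>\<mu>) \<le> ennreal R}"
    (is "compactin _ ?A")
  unfolding submeasure_topology_def Metric_space.compactin_sequentially[OF Metric_space_dBL]
proof (intro conjI allI impI)
  fix \<sigma> :: "nat \<Rightarrow> real measure" assume \<sigma>: "range \<sigma> \<subseteq> ?A"
  then have sub: "\<sigma> n \<in> submeasures" and bnd: "(\<integral>\<^sup>+ x. ennreal (soft_square 0 x) \<partial>\<sigma> n) \<le> ennreal R" for n by auto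
  have "\<forall>n. mass (\<sigma> n) \<in> {0..1}" using mass_bounds[OF sub] by auto
  then obtain m r1 where m: "m \<in> {0..1}" and r1: "strict_mono r1" and lim1: "(\<lambda>n. mass (\<sigma> (r1 n))) \<longlonglongrightarrow> m"
    using seq_compactE[OF compact_imp_seq_compact[OF compact_Icc[of 0 "1::real"]], of "\<lambda>n. mass (\<sigma> n)"]
    unfolding comp_def by metis
  have *: "\<exists>l r. l \<in> ?A \<and> strict_mono r \<and> (\<lambda>n. dBL (\<sigma> (r n)) l) \<longlonglongrightarrow> 0"
  proof (cases "m = 0")
    case True
    have Z: "null_measure borel \<in> submeasures"
      unfolding submeasures_def by (auto intro!: subprob_spaceI)
    have "dBL (\<sigma> (r1 n)) (null_measure borel) \<le> mass (\<sigma> (r1 n))" for n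
      by (rule dBL_least[OF sub Z]) (simp add: abs_integral_BL_le_mass[OF sub])
    then have "(\<lambda>n. dBL (\<sigma> (r1 n)) (null_measure borel)) \<longlonglongrightarrow> 0"
      using Metric_space.nonneg[OF Metric_space_dBL] lim1 True
      by (intro tendsto_sandwich[OF _ _ tendsto_const lim1[unfolded True]]) auto
    then show ?thesis using Z r1 by (intro exI[of _ "null_measure borel"] exI[of _ r1]) auto
  next
    case False
    then have mpos: "0 < m" "m \<le> 1" using m by auto
    then have "\<forall>\<^sub>F n in sequentially. m / 2 < mass (\<sigma> (r1 n))"
      by (intro order_tendstoD(1)[OF lim1]) auto
    \<comment> \<open>normalisation multiplies the moment by at most \<open>2 / m\<close> once the masses exceed \<open>m / 2\<close>\<close>
    then obtain n0 where n0: "\<And>n. n \<ge> n0 \<Longrightarrow> m / 2 < mass (\<sigma> (r1 n))" by (auto simp: eventually_sequentially)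
    define r2 where "r2 n = r1 (n + n0)" for n
    have r2: "strict_mono r2" unfolding r2_def using r1 by (auto simp: strict_mono_def)
    have lim2: "(\<lambda>n. mass (\<sigma> (r2 n))) \<longlonglongrightarrow> m" unfolding r2_def using lim1 by (rule LIMSEQ_ignore_initial_segment)
    have mp: "m / 2 < mass (\<sigma> (r2 n))" for n unfolding r2_def by (rule n0) simp
    then have mp0: "0 < mass (\<sigma> (r2 n))" for n using mpos by (meson half_gt_zero less_trans)
    define \<rho> where "\<rho> n = scale_measure (ennreal (1 / mass (\<sigma> (r2 n)))) (\<sigma> (r2 n))" for n
    have \<rho>: "real_distribution (\<rho> n)" "scale_measure (ennreal (mass (\<sigma> (r2 n)))) (\<rho> n) = \<sigma> (r2 n)" for n
      unfolding \<rho>_def by (rule normalised_real_distribution[OF sub mp0])+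
    have int\<rho>: "(\<integral>\<^sup>+ x. ennreal (soft_square 0 x) \<partial>\<rho> n) \<le> ennreal (R / mass (\<sigma> (r2 n)))" for n
    proof -
      have "(\<integral>\<^sup>+ x. ennreal (soft_square 0 x) \<partial>\<rho> n) = ennreal (1 / mass (\<sigma> (r2 n))) * (\<integral>\<^sup>+ x. ennreal (soft_square 0 x) \<partial>\<sigma> (r2 n))"
        unfolding \<rho>_def
        by (rule nn_integral_scale_measure, rule measurable_submeasure[OF sub]) measurable
      also have "\<dots> \<le> ennreal (1 / mass (\<sigma> (r2 n))) * ennreal R" by (intro mult_left_mono bnd) auto
      also have "\<dots> = ennreal (R / mass (\<sigma> (r2 n)))" using mp0[of n] R by (simp add: ennreal_mult[symmetric])
      finally show ?thesis .
    qed
    have "tight \<rho>"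
    proof (rule tight_of_soft_square_bound[OF \<rho>(1)])
      show "(\<integral>\<^sup>+ x. ennreal (soft_square 0 x) \<partial>\<rho> n) \<le> ennreal (R / (m / 2))" for n
        using mp[of n] mpos R by (intro order_trans[OF int\<rho>] ennreal_leI divide_left_mono) auto
    qed (use mpos R in auto)
    then obtain r3 \<tau> where r3: "strict_mono r3" and \<tau>: "real_distribution \<tau>" and w: "weak_conv_m (\<lambda>n. \<rho> (r3 n)) \<tau>"
      using tight_imp_convergent_subsubsequence[of \<rho> id] by (auto simp: comp_def strict_mono_def)
    note W = weak_conv_uniform_BL[OF \<rho>(1) \<tau> w]
    have lim3: "(\<lambda>n. mass (\<sigma> (r2 (r3 n)))) \<longlonglongrightarrow> m"
      using LIMSEQ_subseq_LIMSEQ[OF lim2 r3] by (simp add: comp_def)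
    let ?l = "scale_measure (ennreal m) \<tau>"
    have l: "?l \<in> submeasures" using scale_measure_in_submeasures(1)[OF \<tau>] mpos by simp
    have ub: "dBL (\<sigma> (r2 (r3 n))) ?l \<le> \<bar>mass (\<sigma> (r2 (r3 n))) - m\<bar> + dBL (\<rho> (r3 n)) \<tau>" for n
      using dBL_scale_measure_le[OF \<rho>(1) \<tau>, of "mass (\<sigma> (r2 (r3 n)))" m "r3 n"] mpos mass_bounds[OF sub]
      by (simp add: \<rho>(2))
    have "(\<lambda>n. \<bar>mass (\<sigma> (r2 (r3 n))) - m\<bar> + dBL (\<rho> (r3 n)) \<tau>) \<longlonglongrightarrow> \<bar>m - m\<bar> + 0"
      by (intro tendsto_intros lim3 W(1))
    then have ub_lim: "(\<lambda>n. \<bar>mass (\<sigma> (r2 (r3 n))) - m\<bar> + dBL (\<rho> (r3 n)) \<tau>) \<longlonglongrightarrow> 0" by simp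
    have dist_lim: "(\<lambda>n. dBL (\<sigma> (r2 (r3 n))) ?l) \<longlonglongrightarrow> 0"
    proof (rule tendsto_sandwich[OF _ _ tendsto_const ub_lim])
      show "\<forall>\<^sub>F n in sequentially. 0 \<le> dBL (\<sigma> (r2 (r3 n))) ?l"
        by (intro always_eventually allI Metric_space.nonneg[OF Metric_space_dBL])
      show "\<forall>\<^sub>F n in sequentially. dBL (\<sigma> (r2 (r3 n))) ?l \<le> \<bar>mass (\<sigma> (r2 (r3 n))) - m\<bar> + dBL (\<rho> (r3 n)) \<tau>"
        by (intro always_eventually allI ub)
    qed
    have "?l \<in> ?A"
    proof -
      have "(\<integral>\<^sup>+ x. ennreal (soft_square 0 x) \<partial>\<tau>) \<le> liminf (\<lambda>n. \<integral>\<^sup>+ x. ennreal (soft_square 0 x) \<partial>\<rho> (r3 n))"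
        by (rule W(2)[OF continuous_soft_square])
      also have "\<dots> \<le> liminf (\<lambda>n. ennreal (R / mass (\<sigma> (r2 (r3 n)))))"
        by (intro Liminf_mono always_eventually allI int\<rho>)
      also have "\<dots> = ennreal (R / m)"
        by (intro lim_imp_Liminf tendsto_ennrealI tendsto_divide tendsto_const lim3) (use mpos in auto)
      finally have "ennreal m * (\<integral>\<^sup>+ x. ennreal (soft_square 0 x) \<partial>\<tau>) \<le> ennreal m * ennreal (R / m)"
        by (rule mult_left_mono) simp
      also have "\<dots> = ennreal R" using mpos R by (simp add: ennreal_mult[symmetric])
      finally have "ennreal m * (\<integral>\<^sup>+ x. ennreal (soft_square 0 x) \<partial>\<tau>) \<le> ennreal R" .
      moreover have "(\<lambda>x. ennreal (soft_square 0 x)) \<in> borel_measurable \<tau>"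
        by (intro measurable_compose[OF real_distribution.measurable_finite_borel[OF \<tau> soft_square_measurable]])
          measurable
      ultimately have "(\<integral>\<^sup>+ x. ennreal (soft_square 0 x) \<partial>?l) \<le> ennreal R"
        by (simp only: nn_integral_scale_measure)
      with l show ?thesis by (intro CollectI conjI)
    qed
    moreover have "strict_mono (\<lambda>n. r2 (r3 n))" using r2 r3 by (simp add: strict_mono_def)
    ultimately show ?thesis using dist_lim by (intro exI[of _ ?l] exI[of _ "\<lambda>n. r2 (r3 n)"] conjI)
  qed
  then obtain l r where l: "l \<in> ?A" "strict_mono r" and lim: "(\<lambda>n. dBL (\<sigma> (r n)) l) \<longlonglongrightarrow> 0" by blast
  have "limitin (Metric_space.mtopology submeasures dBL) (\<sigma> \<circ> r) l sequentially"
    unfolding Metric_space.limitin_metric[OF Metric_space_dBL]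
    using l sub order_tendstoD(2)[OF lim] by auto
  then show "\<exists>l r. l \<in> ?A \<and> strict_mono r \<and> limitin (Metric_space.mtopology submeasures dBL) (\<sigma> \<circ> r) l sequentially"
    using l by blast
qed auto

lemma energy_mono: "(\<And>x. h x \<le> g x) \<Longrightarrow> energy h p \<le> energy g p"
  unfolding energy_def by (intro add_mono nn_integral_mono ennreal_leI) auto

lemma closedin_energy_level:
  assumes "openin pair_topology {p \<in> mass_one_pairs. c < energy h p}"
  shows "closedin pair_topology {p \<in> mass_one_pairs. energy h p \<le> c}"
proof -
  have "topspace pair_topology - {p \<in> mass_one_pairs. c < energy h p} = {p \<in> mass_one_pairs. energy h p \<le> c}"
    by (auto simp: topspace_pair_topology)
  then show ?thesis using openin_closedin_eq[of pair_topology] assms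
    by (metis (no_types, lifting) closedin_diff closedin_topspace)
qed

text \<open>Both components lie in a compact moment ball, and total mass one is a closed condition.\<close>
lemma compactin_energy_level:
  assumes F: "closedin pair_topology F" and le: "\<And>p. p \<in> F \<Longrightarrow> energy (soft_square 0) p \<le> ennreal R" and R: "0 \<le> R"
  shows "compactin pair_topology F"
proof -
  let ?A = "{\<mu> \<in> submeasures. (\<integral>\<^sup>+ x. ennreal (soft_square 0 x) \<partial>\<mu>) \<le> ennreal R}"
  let ?X = "prod_topology submeasure_topology submeasure_topology"
  have FM: "F \<subseteq> mass_one_pairs" using closedin_subset[OF F] by (simp add: topspace_pair_topology)
  have cA: "compactin ?X (?A \<times> ?A)"
    using compactin_soft_square_ball[OF R] by (simp add: compactin_Times)
  have "F \<subseteq> ?A \<times> ?A"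
  proof
    fix p assume p: "p \<in> F"
    then have "fst p \<in> submeasures" "snd p \<in> submeasures" using FM by (auto simp: mass_one_pairs_def)
    moreover have "(\<integral>\<^sup>+ x. ennreal (soft_square 0 x) \<partial>fst p) \<le> energy (soft_square 0) p"
        "(\<integral>\<^sup>+ x. ennreal (soft_square 0 x) \<partial>snd p) \<le> energy (soft_square 0) p"
      unfolding energy_def by (simp_all add: add.assoc add_increasing add_increasing2)
    ultimately show "p \<in> ?A \<times> ?A" using le[OF p] by (cases p) (auto intro: order_trans)
  qed
  have clM: "closedin ?X mass_one_pairs"
  proof -
    have c: "continuous_map ?X euclideanreal (\<lambda>p. mass (fst p) + mass (snd p))"
      by (intro continuous_map_add continuous_map_compose[OF continuous_map_fst continuous_map_mass, unfolded comp_def]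
        continuous_map_compose[OF continuous_map_snd continuous_map_mass, unfolded comp_def])
    have "closedin ?X {p \<in> topspace ?X. mass (fst p) + mass (snd p) \<in> {1}}"
      by (rule closedin_continuous_map_preimage[OF c]) simp
    also have "{p \<in> topspace ?X. mass (fst p) + mass (snd p) \<in> {1}} = mass_one_pairs"
      by (auto simp: topspace_submeasure_topology mass_one_pairs_def)
    finally show ?thesis .
  qed
  have "closedin ?X F" using F clM unfolding pair_topology_def by (rule closedin_trans_full)
  then have "compactin ?X F" using cA \<open>F \<subseteq> ?A \<times> ?A\<close> closed_compactin by blast
  then show ?thesis using FM by (simp add: pair_topology_def compactin_subtopology)
qed

text \<open>The part of \<open>F\<close> with \<open>energy (soft_square 0) \<le> c\<close> is compact and covered by the increasing open sets
  \<open>{c < energy (soft_square k)}\<close>, hence by one of them. Outside this part the claim holds for every \<open>k\<close>.\<close>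
lemma closed_above_level_soft_square:
  assumes F: "closedin pair_topology F" and c: "\<And>p. p \<in> F \<Longrightarrow> c < energy (\<lambda>x. x\<^sup>2) p" and fin: "c < \<infinity>"
  shows "\<exists>k. \<forall>p\<in>F. c < energy (soft_square k) p"
proof -
  let ?U = "\<lambda>k. {p \<in> mass_one_pairs. c < energy (soft_square k) p}"
  let ?K = "F \<inter> {p \<in> mass_one_pairs. energy (soft_square 0) p \<le> c}"
  have FM: "F \<subseteq> mass_one_pairs" using closedin_subset[OF F] by (simp add: topspace_pair_topology)
  obtain R where R: "c = ennreal R" "0 \<le> R" using fin by (cases c) auto
  note S = energy_SUP[OF incseq_soft_square soft_square_tendsto soft_square_measurable]
  have "closedin pair_topology ?K"
    by (intro closedin_Int F closedin_energy_level openin_energy_soft_square)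
  then have comp: "compactin pair_topology ?K"
    by (rule compactin_energy_level[where R = R]) (use R in auto)
  have cov: "?K \<subseteq> \<Union>(range ?U)"
  proof
    fix p assume p: "p \<in> ?K"
    then have pF: "p \<in> F" and pM: "p \<in> mass_one_pairs" by auto
    have "c < (SUP k. energy (soft_square k) p)" unfolding S(1)[OF pM, symmetric] by (rule c[OF pF])
    then show "p \<in> \<Union>(range ?U)" using p by (auto simp: less_SUP_iff)
  qed
  have "\<forall>U\<in>range ?U. openin pair_topology U" using openin_energy_soft_square by blast
  then obtain \<F> where "finite \<F>" "\<F> \<subseteq> range ?U" "?K \<subseteq> \<Union>\<F>"
    using comp cov unfolding compactin_def by meson
  moreover from this obtain J where "finite J" "\<F> = ?U ` J"
    using finite_subset_image[of \<F> ?U UNIV] by auto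
  ultimately have J: "finite J" "?K \<subseteq> (\<Union>k\<in>J. ?U k)" by auto
  \<comment> \<open>\<open>J\<close> is empty when the compact part is\<close>
  define k where "k = Max (insert 0 J)"
  have "c < energy (soft_square k) p" if p: "p \<in> F" for p
  proof -
    have pM: "p \<in> mass_one_pairs" using p FM by auto
    have mono: "energy (soft_square j) p \<le> energy (soft_square k) p" if "j \<le> k" for j
      using S(2)[OF pM] that by (auto simp: incseq_def)
    have jk: "j \<le> k" if "j \<in> J" for j using that J(1) by (simp add: k_def)
    show ?thesis
    proof (cases "p \<in> ?K")
      case True
      then obtain j where "j \<in> J" "c < energy (soft_square j) p" using J by auto
      then show ?thesis using mono[OF jk] by (blast intro: less_le_trans)
    next
      case False
      then have "c < energy (soft_square 0) p" using p pM by auto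
      then show ?thesis using mono[of 0] by (auto intro: less_le_trans)
    qed
  qed
  then show ?thesis by blast
qed

section \<open>The rate function\<close>

lemma soft_square_le: "soft_square k x \<le> x\<^sup>2"
  using incseq_le[OF incseq_soft_square soft_square_tendsto] .

text \<open>If \<open>a + b = 1\<close> then \<open>a * b = 1/4 - (a - b)\<^sup>2/4\<close>.\<close>
lemma I_alpha_beta_eq:
  assumes p: "p \<in> mass_one_pairs"
  shows "I_alpha_beta p = enn2ereal (energy (\<lambda>x. x\<^sup>2) p) - ereal (1/4)"
proof -
  obtain \<mu> \<nu> where [simp]: "p = (\<mu>, \<nu>)" by (cases p)
  have s: "\<mu> \<in> submeasures" "\<nu> \<in> submeasures" and m: "mass \<mu> + mass \<nu> = 1"
    using p by (auto simp: mass_one_pairs_def)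
  define S where "S = (\<integral>\<^sup>+ x. ennreal (x\<^sup>2) \<partial>\<mu>) + (\<integral>\<^sup>+ x. ennreal (x\<^sup>2) \<partial>\<nu>)"
  have "(LINT x|\<mu>. (LINT y|\<nu>. 1)) = mass \<mu> * mass \<nu>"
    by (simp add: mass_def)
  moreover have "mass \<mu> * mass \<nu> = 1/4 - (mass \<mu> - mass \<nu>)\<^sup>2 / 4"
  proof -
    have "mass \<nu> = 1 - mass \<mu>" using m by simp
    then show ?thesis by (simp only:) (simp add: power2_eq_square field_simps)
  qed
  ultimately have "I_alpha_beta p = enn2ereal S - ereal (1/4 - (mass \<mu> - mass \<nu>)\<^sup>2 / 4)"
    by (simp add: I_alpha_beta_def S_def plus_ennreal.rep_eq)
  also have "\<dots> = enn2ereal (S + ennreal ((mass \<mu> - mass \<nu>)\<^sup>2 / 4)) - ereal (1/4)"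
    by (cases S) (auto simp: plus_ennreal.rep_eq)
  finally show ?thesis by (simp add: energy_def S_def)
qed

text \<open>The minimiser of the rate function: half of the mass at the bottom of each well.\<close>
definition balanced_pair :: "real measure \<times> real measure"
  where "balanced_pair = (empirical_part 2 {0} (\<lambda>_. 0), empirical_part 2 {0} (\<lambda>_. 0))"

lemma balanced_pair: "balanced_pair \<in> mass_one_pairs" "energy (\<lambda>x. x\<^sup>2) balanced_pair = 0"
  unfolding balanced_pair_def energy_def mass_one_pairs_def
  by (auto simp: empirical_part_in_submeasures mass_empirical_part nn_integral_empirical_part)

text \<open>The infimum subtracted in \<^const>\<open>I_bar\<close> is \<open>-1/4\<close>, attained at \<open>balanced_pair\<close>.\<close>
lemma I_bar_eq:
  assumes p: "p \<in> mass_one_pairs"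
  shows "I_bar p = enn2ereal (energy (\<lambda>x. x\<^sup>2) p)"
proof -
  have "(INF q\<in>mass_one_pairs. I_alpha_beta q) = ereal (- (1/4))"
  proof (rule INF_eqI)
    fix q assume q: "q \<in> mass_one_pairs"
    show "ereal (- (1/4)) \<le> I_alpha_beta q"
      unfolding I_alpha_beta_eq[OF q] using enn2ereal_nonneg[of "energy (\<lambda>x. x\<^sup>2) q"]
      by (cases "enn2ereal (energy (\<lambda>x. x\<^sup>2) q)") auto
  next
    fix y assume "\<And>q. q \<in> mass_one_pairs \<Longrightarrow> y \<le> I_alpha_beta q"
    from this[OF balanced_pair(1)] show "y \<le> ereal (- (1/4))"
      by (simp add: I_alpha_beta_eq[OF balanced_pair(1)] balanced_pair(2) zero_ennreal.rep_eq)
  qed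
  then show ?thesis
    unfolding I_bar_def I_alpha_beta_eq[OF p]
    by (cases "enn2ereal (energy (\<lambda>x. x\<^sup>2) p)") auto
qed

lemma lower_semicontinuous_I_bar: "lower_semicontinuous pair_topology I_bar"
  unfolding lower_semicontinuous_def
proof
  fix c :: ereal
  show "openin pair_topology {p \<in> topspace pair_topology. c < I_bar p}"
  proof (cases "c < 0")
    case True
    have "{p \<in> topspace pair_topology. c < I_bar p} = topspace pair_topology"
      using True by (auto simp: topspace_pair_topology I_bar_eq intro: less_le_trans[OF True])
    then show ?thesis by simp
  next
    case False
    then have "c = enn2ereal (e2ennreal c)" by (simp add: enn2ereal_e2ennreal)
    then have "{p \<in> topspace pair_topology. c < I_bar p}
       = {p \<in> mass_one_pairs. e2ennreal c < energy (\<lambda>x. x\<^sup>2) p}"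
      using I_bar_eq by (auto simp: topspace_pair_topology less_ennreal.rep_eq)
    then show ?thesis using openin_energy_square by simp
  qed
qed

lemma good_rate_function_I_bar: "good_rate_function pair_topology I_bar"
  unfolding good_rate_function_def
proof (intro allI impI)
  fix C :: real assume C: "0 \<le> C"
  have eq: "{p \<in> topspace pair_topology. I_bar p \<le> ereal C} = {p \<in> mass_one_pairs. energy (\<lambda>x. x\<^sup>2) p \<le> ennreal C}"
    using I_bar_eq C by (auto simp: topspace_pair_topology less_eq_ennreal.rep_eq enn2ereal_ennreal)
  show "compactin pair_topology {p \<in> topspace pair_topology. I_bar p \<le> ereal C}"
    unfolding eq
  proof (rule compactin_energy_level[OF closedin_energy_level[OF openin_energy_square] _ C])
    fix p assume "p \<in> {p \<in> mass_one_pairs. energy (\<lambda>x. x\<^sup>2) p \<le> ennreal C}"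
    then show "energy (soft_square 0) p \<le> ennreal C"
      using energy_mono[of "soft_square 0" "\<lambda>x. x\<^sup>2" p, OF soft_square_le] by (auto intro: order_trans)
  qed
qed

section \<open>The empirical pair\<close>

text \<open>The common form of \<open>\<alpha>\<^sub>i\<close> and \<open>-\<beta>\<^sub>i\<close>: the signed distance of \<open>\<bar>lam i\<bar>\<close> to the minimum.\<close>
definition rescaled :: "real \<Rightarrow> (nat \<Rightarrow> real) \<Rightarrow> nat \<Rightarrow> real"
  where "rescaled \<Theta> lam i = (\<bar>lam i\<bar> - sqrt 2) / \<Theta>"

definition nonneg_indices :: "nat \<Rightarrow> (nat \<Rightarrow> real) \<Rightarrow> nat set"
  where "nonneg_indices M lam = {i\<in>{..<M}. 0 \<le> lam i}"

definition empirical_pair :: "nat \<Rightarrow> nat set \<Rightarrow> (nat \<Rightarrow> real) \<Rightarrow> real measure \<times> real measure"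
  where "empirical_pair M J x = (empirical_part M J x, empirical_part M ({..<M} - J) x)"

lemma nonneg_indices_subset: "nonneg_indices m lam \<subseteq> {..<m}"
  by (auto simp: nonneg_indices_def)

lemma empirical_part_cong:
  assumes "\<And>i. i \<in> J \<Longrightarrow> x i = y i" shows "empirical_part M J x = empirical_part M J y"
proof -
  have "distr (count_space J) borel x = distr (count_space J) borel y"
    by (rule distr_cong) (use assms in auto)
  then show ?thesis by (simp add: empirical_part_def)
qed

lemma empirical_pair_cong:
  assumes "\<And>i. i < M \<Longrightarrow> x i = y i" "J \<subseteq> {..<M}" shows "empirical_pair M J x = empirical_pair M J y"
  unfolding empirical_pair_def using assms by (auto intro!: empirical_part_cong)

lemma mu_alpha_beta_eq:
  "(mu_alpha M \<Theta> lam, mu_beta M \<Theta> lam) = empirical_pair M (nonneg_indices M lam) (rescaled \<Theta> lam)"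
proof -
  have "{i\<in>{..<M}. lam i < 0} = {..<M} - nonneg_indices M lam" by (auto simp: nonneg_indices_def)
  moreover have "alpha \<Theta> lam i = rescaled \<Theta> lam i" if "0 \<le> lam i" for i
    using that by (simp add: alpha_def rescaled_def divide_inverse mult.commute)
  moreover have "- beta \<Theta> lam i = rescaled \<Theta> lam i" if "\<not> 0 \<le> lam i" for i
    using that by (simp add: beta_def rescaled_def divide_inverse ring_distribs mult.commute)
  ultimately show ?thesis
    unfolding mu_alpha_def mu_beta_def empirical_pair_def
    by (auto intro!: empirical_part_cong simp: nonneg_indices_def)
qed

lemma card_split:
  assumes "J \<subseteq> {..<M}" shows "real (card J) + real (card ({..<M} - J)) = real M"
proof -
  have "card J + card ({..<M} - J) = M"
    using assms by (metis card_Diff_subset card_lessThan card_mono finite_lessThan finite_subset le_add_diff_inverse)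
  then show ?thesis by (metis of_nat_add)
qed

lemma empirical_pair_mem:
  assumes "1 \<le> M" "J \<subseteq> {..<M}" shows "empirical_pair M J x \<in> mass_one_pairs"
  using card_split[OF assms(2)] assms
  by (auto simp: empirical_pair_def mass_one_pairs_def empirical_part_in_submeasures
        mass_empirical_part add_divide_distrib[symmetric])

text \<open>Integrals over the two parts recombine to one sum over all particles; only the mass term sees the
  assignment \<open>J\<close> of particles to wells.\<close>
lemma energy_empirical_pair:
  assumes M: "1 \<le> M" and J: "J \<subseteq> {..<M}" and h: "h \<in> borel_measurable borel" and nn: "\<And>x. 0 \<le> h x"
  shows "energy h (empirical_pair M J x)
    = ennreal ((\<Sum>i<M. h (x i)) / real M + (real (card J) - real (card ({..<M} - J)))\<^sup>2 / (4 * (real M)\<^sup>2))"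
proof -
  have fin: "finite J" using J finite_subset by blast
  have *: "(\<integral>\<^sup>+ z. ennreal (h z) \<partial>empirical_part M A x) = ennreal ((\<Sum>i\<in>A. h (x i)) / real M)" if "finite A" for A
    using that nn h by (subst nn_integral_empirical_part) (auto simp: sum_nonneg ennreal_mult[symmetric])
  have split: "(\<Sum>i<M. h (x i)) = (\<Sum>i\<in>J. h (x i)) + (\<Sum>i\<in>{..<M} - J. h (x i))"
    using sum.subset_diff[OF J, of "\<lambda>i. h (x i)"] by simp
  have "(real (card J) / real M - real (card ({..<M} - J)) / real M)\<^sup>2 / 4 =
     (real (card J) - real (card ({..<M} - J)))\<^sup>2 / (4 * (real M)\<^sup>2)"
    by (simp add: diff_divide_distrib[symmetric] power_divide)
  then show ?thesis
    using fin M J nn unfolding energy_def empirical_pair_def split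
    by (simp add: * mass_empirical_part add_divide_distrib sum_nonneg ennreal_plus)
qed

lemma continuous_map_empirical_part:
  assumes "1 \<le> M" "J \<subseteq> {..<M}"
  shows "continuous_map euclidean submeasure_topology (\<lambda>x. empirical_part M J x)"
  unfolding submeasure_topology_def Metric_space.continuous_map_to_metric[OF Metric_space_dBL]
proof (intro ballI allI impI)
  fix x :: "nat \<Rightarrow> real" and e :: real assume e: "0 < e"
  let ?U = "{y. (\<Sum>i\<in>J. \<bar>x i - y i\<bar>) / real M < e}"
  have "open ?U"
    by (intro open_Collect_less continuous_intros continuous_on_divide) (use assms in auto)
  moreover have "empirical_part M J y \<in> Metric_space.mball submeasures dBL (empirical_part M J x) e" if "y \<in> ?U" for y
    using that dBL_empirical_part_le[OF assms, of x y] empirical_part_in_submeasures[OF assms]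
    by (auto simp: Metric_space.in_mball[OF Metric_space_dBL])
  ultimately show "\<exists>U. openin euclidean U \<and> x \<in> U
      \<and> (\<forall>y\<in>U. empirical_part M J y \<in> Metric_space.mball submeasures dBL (empirical_part M J x) e)"
    using e by (intro exI[of _ ?U]) auto
qed

lemma continuous_map_empirical_pair:
  assumes "1 \<le> M" "J \<subseteq> {..<M}"
  shows "continuous_map euclidean pair_topology (\<lambda>x. empirical_pair M J x)"
  unfolding pair_topology_def
  by (rule continuous_map_into_subtopology)
     (use assms empirical_pair_mem in \<open>auto simp: empirical_pair_def intro!: continuous_map_pairedI continuous_map_empirical_part\<close>)

text \<open>The pair jumps when a particle changes sign, but on each of the finitely many sign patterns it is a
  continuous function of the rescaled positions. These are extended by zero to functions on all of \<^typ>\<open>nat\<close>,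
  whose product topology generates the product \<open>\<sigma>\<close>-algebra.\<close>
lemma measurable_empirical_pair:
  assumes M: "1 \<le> M" and S: "sets P = sets (lborel_vec M)"
  shows "(\<lambda>lam. (mu_alpha M \<Theta> lam, mu_beta M \<Theta> lam)) \<in> measurable P (borel_of pair_topology)"
  unfolding mu_alpha_beta_eq borel_of_def
proof (rule measurable_measure_of)
  note J = nonneg_indices_subset
  show "{U. openin pair_topology U} \<subseteq> Pow (topspace pair_topology)" using openin_subset by auto
  show "(\<lambda>lam. empirical_pair M (nonneg_indices M lam) (rescaled \<Theta> lam)) \<in> space P \<rightarrow> topspace pair_topology"
    using empirical_pair_mem[OF M J] by (auto simp: topspace_pair_topology)
  fix U assume "U \<in> {U. openin pair_topology U}"
  then have U: "openin pair_topology U" by simp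
  have [measurable_cong]: "sets P = sets (\<Pi>\<^sub>M i\<in>{..<M}. borel)"
    unfolding S lborel_vec_def by (rule sets_PiM_cong) auto
  define r where "r lam i = (if i < M then rescaled \<Theta> lam i else 0)" for lam i
  have comp[measurable]: "(\<lambda>lam. lam i) \<in> borel_measurable P" if "i < M" for i
  proof -
    have "i \<in> {..<M}" using that by simp
    then show ?thesis by measurable
  qed
  have r[measurable]: "r \<in> borel_measurable P"
  proof (rule measurable_coordinatewise_then_product)
    fix i show "(\<lambda>lam. r lam i) \<in> borel_measurable P"
      unfolding r_def rescaled_def by (cases "i < M") (use comp in \<open>auto\<close>)
  qed
  have "(\<lambda>lam. empirical_pair M (nonneg_indices M lam) (rescaled \<Theta> lam)) -` U \<inter> space P =
    (\<Union>J\<in>Pow {..<M}. {lam\<in>space P. nonneg_indices M lam = J} \<inter> (r -` {x. empirical_pair M J x \<in> U} \<inter> space P))"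
  proof -
    have "empirical_pair M (nonneg_indices M lam) (rescaled \<Theta> lam) = empirical_pair M (nonneg_indices M lam) (r lam)" for lam
      by (rule empirical_pair_cong[OF _ J]) (simp add: r_def)
    then show ?thesis using J by auto
  qed
  also have "\<dots> \<in> sets P"
  proof (rule sets.finite_UN, simp, rule sets.Int)
    fix A assume A: "A \<in> Pow {..<M}"
    have "{lam\<in>space P. nonneg_indices M lam = A} = {lam\<in>space P. \<forall>i\<in>{..<M}. (0 \<le> lam i) = (i \<in> A)}"
      using A by (auto simp: nonneg_indices_def)
    also have "\<dots> \<in> sets P" by measurable
    finally show "{lam\<in>space P. nonneg_indices M lam = A} \<in> sets P" .
    have "openin euclidean {x \<in> topspace euclidean. empirical_pair M A x \<in> U}"
      by (rule openin_continuous_map_preimage[OF continuous_map_empirical_pair[OF M] U]) (use A in auto)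
    then have "open {x. empirical_pair M A x \<in> U}" by simp
    then show "r -` {x. empirical_pair M A x \<in> U} \<inter> space P \<in> sets P"
      by (intro measurable_sets[OF r]) auto
  qed
  finally show "(\<lambda>lam. empirical_pair M (nonneg_indices M lam) (rescaled \<Theta> lam)) -` U \<inter> space P \<in> sets P" .
qed

section \<open>The potential well\<close>

text \<open>The potential \<open>t\<^sup>2/2 - 2 ln t\<close> above its minimum, as a function of \<open>s = t - sqrt 2\<close>.\<close>
definition well :: "real \<Rightarrow> real"
  where "well s = s\<^sup>2 / 2 + 2 * (s / sqrt 2 - ln (1 + s / sqrt 2))"

lemma potential_eq_well:
  assumes "0 < t"
  shows "t\<^sup>2 / 2 - 2 * ln t = 1 - ln 2 + well (t - sqrt 2)"
proof -
  have "1 + (t - sqrt 2) / sqrt 2 = t / sqrt 2" by (simp add: field_simps)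
  moreover have "ln (t / sqrt 2) = ln t - ln 2 / 2" using assms by (simp add: ln_div ln_sqrt)
  moreover have "(t - sqrt 2)\<^sup>2 / 2 + 2 * ((t - sqrt 2) / sqrt 2) = t\<^sup>2 / 2 - 1"
  proof -
    have s: "sqrt 2 * sqrt 2 = (2::real)" by simp
    have "2 * ((t - sqrt 2) / sqrt 2) = sqrt 2 * t - 2"
      using s by (simp add: field_simps)
    moreover have "(t - sqrt 2)\<^sup>2 / 2 = t\<^sup>2 / 2 - sqrt 2 * t + 1"
      by (simp add: power2_diff field_simps)
    ultimately show ?thesis by linarith
  qed
  moreover have "well (t - sqrt 2) = (t - sqrt 2)\<^sup>2 / 2 + 2 * ((t - sqrt 2) / sqrt 2)
      - 2 * ln (1 + (t - sqrt 2) / sqrt 2)"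
    by (simp add: well_def)
  ultimately show ?thesis by simp
qed

text \<open>Half of the quadratic term is exact; the rest is nonnegative by concavity of the logarithm.\<close>
lemma well_ge:
  assumes "- sqrt 2 < s" shows "s\<^sup>2 / 2 \<le> well s"
proof -
  have "-1 < s / sqrt 2" using assms by (simp add: field_simps)
  then have "ln (1 + s / sqrt 2) \<le> s / sqrt 2" by (intro ln_add_one_self_le_self2) auto
  then show ?thesis by (simp add: well_def)
qed

text \<open>The two halves agree to second order, since \<open>u - ln (1 + u)\<close> is asymptotic to \<open>u\<^sup>2/2\<close>.\<close>
lemma well_quadratic:
  assumes e: "0 < e"
  obtains d where "0 < d" "\<And>s. \<bar>s\<bar> \<le> d \<Longrightarrow> (1 - e) * s\<^sup>2 \<le> well s \<and> well s \<le> (1 + e) * s\<^sup>2"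
proof -
  have lim: "((\<lambda>u::real. (u - ln (1 + u)) / u\<^sup>2) \<longlongrightarrow> 1 / 2) (at 0)"
    by real_asymp
  have "\<forall>\<^sub>F u in at (0::real). \<bar>(u - ln (1 + u)) / u\<^sup>2 - 1/2\<bar> < e / 2"
    using tendstoD[OF lim, of "e / 2"] e by (simp add: dist_real_def)
  then obtain d where d: "0 < d" "\<And>u. u \<noteq> 0 \<Longrightarrow> \<bar>u\<bar> < d \<Longrightarrow> \<bar>(u - ln (1 + u)) / u\<^sup>2 - 1/2\<bar> < e / 2"
    by (auto simp: eventually_at dist_real_def)
  show ?thesis
  proof (rule that[of "d / 2"])
    show "0 < d / 2" using d by simp
    fix s assume s: "\<bar>s\<bar> \<le> d / 2"
    show "(1 - e) * s\<^sup>2 \<le> well s \<and> well s \<le> (1 + e) * s\<^sup>2"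
    proof (cases "s = 0")
      case True then show ?thesis by (simp add: well_def)
    next
      case False
      define u where "u = s / sqrt 2"
      have u0: "u \<noteq> 0" using False by (simp add: u_def)
      have "\<bar>u\<bar> \<le> \<bar>s\<bar>"
        using mult_left_mono[of 1 "sqrt 2" "\<bar>s\<bar>"] by (simp add: u_def divide_le_eq)
      then have "\<bar>u\<bar> < d" using s d by linarith
      from d(2)[OF u0 this] have "\<bar>(u - ln (1 + u)) / u\<^sup>2 - 1/2\<bar> < e / 2" .
      then have "\<bar>(u - ln (1 + u)) / u\<^sup>2 - 1/2\<bar> * u\<^sup>2 \<le> e / 2 * u\<^sup>2" by (intro mult_right_mono) auto
      moreover have "\<bar>(u - ln (1 + u)) / u\<^sup>2 - 1/2\<bar> * u\<^sup>2 = \<bar>((u - ln (1 + u)) / u\<^sup>2 - 1/2) * u\<^sup>2\<bar>"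
        by (simp add: abs_mult)
      moreover have "((u - ln (1 + u)) / u\<^sup>2 - 1/2) * u\<^sup>2 = (u - ln (1 + u)) - u\<^sup>2 / 2"
        using u0 by (simp add: field_simps)
      ultimately have "\<bar>(u - ln (1 + u)) - u\<^sup>2 / 2\<bar> \<le> e / 2 * u\<^sup>2" by simp
      moreover have "u\<^sup>2 = s\<^sup>2 / 2" by (simp add: u_def power_divide)
      ultimately have p: "\<bar>(u - ln (1 + u)) - s\<^sup>2 / 4\<bar> \<le> e * s\<^sup>2 / 4" by simp
      have w: "well s = s\<^sup>2 / 2 + 2 * (u - ln (1 + u))" by (simp add: well_def u_def)
      have z: "0 \<le> e * s\<^sup>2" using e by simp
      have "\<bar>P - A / 4\<bar> \<le> B / 4 \<Longrightarrow> W = A / 2 + 2 * P \<Longrightarrow> 0 \<le> B \<Longrightarrow> A - B \<le> W \<and> W \<le> A + B"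
        for P A B W :: real by linarith
      from this[OF p w z] show ?thesis by (simp add: ring_distribs)
    qed
  qed
qed

text \<open>The reason for truncating: for \<open>\<bar>x\<bar> \<le> 2 * K\<close> the point \<open>\<Theta> * x\<close> is in the quadratic regime, and for larger
  \<open>\<bar>x\<bar>\<close> the truncated square is below \<open>x\<^sup>2/2\<close>, where the global bound suffices.\<close>
lemma well_rescaled_ge:
  assumes e: "0 < e" "e < 1" and K: "0 < K"
  obtains T where "0 < T"
    "\<And>\<Theta> x. 0 < \<Theta> \<Longrightarrow> \<Theta> \<le> T \<Longrightarrow> - sqrt 2 < \<Theta> * x \<Longrightarrow> \<Theta>\<^sup>2 * ((1 - e) * (\<bar>x\<bar> * min \<bar>x\<bar> K)) \<le> well (\<Theta> * x)"
proof -
  obtain d where d: "0 < d" "\<And>s. \<bar>s\<bar> \<le> d \<Longrightarrow> (1 - e) * s\<^sup>2 \<le> well s \<and> well s \<le> (1 + e) * s\<^sup>2"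
    using well_quadratic[OF e(1)] by metis
  show ?thesis
  proof (rule that[of "d / (2 * K)"])
    show "0 < d / (2 * K)" using d K by simp
    fix \<Theta> x :: real assume T: "0 < \<Theta>" "\<Theta> \<le> d / (2 * K)" and gt: "- sqrt 2 < \<Theta> * x"
    have T2: "\<Theta> * (2 * K) \<le> d" using T K by (simp add: field_simps)
    show "\<Theta>\<^sup>2 * ((1 - e) * (\<bar>x\<bar> * min \<bar>x\<bar> K)) \<le> well (\<Theta> * x)"
    proof (cases "\<bar>x\<bar> \<le> 2 * K")
      case True
      then have "\<bar>\<Theta> * x\<bar> \<le> \<Theta> * (2 * K)" using T by (simp add: abs_mult)
      then have "(1 - e) * (\<Theta> * x)\<^sup>2 \<le> well (\<Theta> * x)" using d(2)[of "\<Theta> * x"] T2 by simp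
      moreover have "\<bar>x\<bar> * min \<bar>x\<bar> K \<le> \<bar>x\<bar> * \<bar>x\<bar>" by (intro mult_left_mono) auto
      then have "\<Theta>\<^sup>2 * ((1 - e) * (\<bar>x\<bar> * min \<bar>x\<bar> K)) \<le> \<Theta>\<^sup>2 * ((1 - e) * (\<bar>x\<bar> * \<bar>x\<bar>))"
        using e by (intro mult_left_mono) auto
      moreover have "\<Theta>\<^sup>2 * ((1 - e) * (\<bar>x\<bar> * \<bar>x\<bar>)) = (1 - e) * (\<Theta> * x)\<^sup>2"
        by (simp add: power2_eq_square)
      ultimately show ?thesis by linarith
    next
      case False
      then have "2 * min \<bar>x\<bar> K \<le> \<bar>x\<bar>" by linarith
      then have "\<bar>x\<bar> * (2 * min \<bar>x\<bar> K) \<le> \<bar>x\<bar> * \<bar>x\<bar>" by (intro mult_left_mono) auto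
      then have "\<bar>x\<bar> * min \<bar>x\<bar> K \<le> x\<^sup>2 / 2" by (simp add: power2_eq_square)
      moreover have "(1 - e) * (\<bar>x\<bar> * min \<bar>x\<bar> K) \<le> 1 * (\<bar>x\<bar> * min \<bar>x\<bar> K)"
        using e K by (intro mult_right_mono) auto
      ultimately have "\<Theta>\<^sup>2 * ((1 - e) * (\<bar>x\<bar> * min \<bar>x\<bar> K)) \<le> \<Theta>\<^sup>2 * (x\<^sup>2 / 2)"
        by (intro mult_left_mono) auto
      also have "\<dots> = (\<Theta> * x)\<^sup>2 / 2" by (simp add: power_mult_distrib)
      also have "\<dots> \<le> well (\<Theta> * x)" by (rule well_ge[OF gt])
      finally show ?thesis .
    qed
  qed
qed

section \<open>Upper bound on the weight\<close>

lemma sum_pairs_symmetric: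
  fixes F :: "nat \<Rightarrow> nat \<Rightarrow> real"
  assumes sym: "\<And>i j. F i j = F j i"
  shows "(\<Sum>j<M. \<Sum>i<j. F i j) = ((\<Sum>j<M. \<Sum>i<M. F i j) - (\<Sum>i<M. F i i)) / 2"
proof (induction M)
  case (Suc M)
  have "(\<Sum>j<Suc M. \<Sum>i<Suc M. F i j) = (\<Sum>j<M. \<Sum>i<M. F i j) + (\<Sum>j<M. F M j) + (\<Sum>i<M. F i M) + F M M"
    by (simp add: sum.distrib)
  moreover have "(\<Sum>j<M. F M j) = (\<Sum>i<M. F i M)" using sym by (intro sum.cong) auto
  ultimately show ?case using Suc by (simp add: field_simps)
qed simp

text \<open>With the indicators \<open>a\<close>, \<open>b\<close> of the two parts, the indicator of a same-part pair is
  \<open>a i * a j + b i * b j\<close>, so the sum over all ordered pairs factors into squares.\<close>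
lemma sum_same_part:
  assumes J: "J \<subseteq> {..<M}"
  shows "(\<Sum>j<M. \<Sum>i<j. of_bool (i \<in> J \<longleftrightarrow> j \<in> J) :: real)
    = ((real (card J))\<^sup>2 + (real (card ({..<M} - J)))\<^sup>2 - real M) / 2"
proof -
  let ?a = "\<lambda>i. of_bool (i \<in> J) :: real" and ?b = "\<lambda>i. of_bool (i \<notin> J) :: real"
  have a: "(\<Sum>i<M. ?a i) = real (card J)"
    using J by (simp add: sum_of_bool_eq Int_absorb1 Int_absorb2)
  have b: "(\<Sum>i<M. ?b i) = real (card ({..<M} - J))"
    by (simp add: sum_of_bool_eq Diff_eq Compl_eq)
  have "(\<Sum>j<M. \<Sum>i<M. of_bool (i \<in> J \<longleftrightarrow> j \<in> J) :: real) = (\<Sum>j<M. \<Sum>i<M. ?a j * ?a i + ?b j * ?b i)"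
    by (intro sum.cong) (auto simp: of_bool_def)
  also have "\<dots> = (\<Sum>j<M. ?a j) * (\<Sum>i<M. ?a i) + (\<Sum>j<M. ?b j) * (\<Sum>i<M. ?b i)"
    by (simp only: sum.distrib sum_product)
  finally have "(\<Sum>j<M. \<Sum>i<M. of_bool (i \<in> J \<longleftrightarrow> j \<in> J) :: real) = (real (card J))\<^sup>2 + (real (card ({..<M} - J)))\<^sup>2"
    unfolding a b by (simp add: power2_eq_square)
  then show ?thesis
    by (subst sum_pairs_symmetric) (auto simp: eq_commute)
qed

lemma abs_lam_eq: "\<Theta> \<noteq> 0 \<Longrightarrow> \<bar>lam i\<bar> = sqrt 2 + \<Theta> * rescaled \<Theta> lam i"
  by (simp add: rescaled_def)

lemma sqrt2_bounds: "1 < sqrt 2" "sqrt 2 < (3/2::real)"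
proof -
  show "1 < sqrt 2" by simp
  show "sqrt 2 < (3/2::real)" by (rule real_less_lsqrt) (simp_all add: power2_eq_square)
qed

text \<open>The gap of two particles in the same well carries a factor \<open>\<Theta>\<close>; beyond this, \<open>t \<le> exp t\<close> turns distances into terms
  linear in \<open>\<bar>x\<bar>\<close>. Working with exponentials instead of logarithms covers coinciding particles.\<close>
lemma pair_factor_le:
  assumes \<Theta>: "0 < \<Theta>" "\<Theta> \<le> 1"
  shows "\<bar>lam i - lam j\<bar> ^ 2 \<le> exp (2 * ln \<Theta> * of_bool (0 \<le> lam i \<longleftrightarrow> 0 \<le> lam j)
     + 2 * (3 + \<bar>rescaled \<Theta> lam i\<bar> + \<bar>rescaled \<Theta> lam j\<bar>))"
proof -
  let ?x = "rescaled \<Theta> lam i" and ?y = "rescaled \<Theta> lam j"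
  have ai: "\<bar>lam i\<bar> = sqrt 2 + \<Theta> * ?x" and aj: "\<bar>lam j\<bar> = sqrt 2 + \<Theta> * ?y"
    using abs_lam_eq \<Theta> by auto
  have e: "3 + \<bar>?x\<bar> + \<bar>?y\<bar> \<le> exp (3 + \<bar>?x\<bar> + \<bar>?y\<bar>)" using exp_ge_add_one_self[of "3 + \<bar>?x\<bar> + \<bar>?y\<bar>"] by linarith
  have "\<bar>lam i - lam j\<bar> \<le> exp (ln \<Theta> * of_bool (0 \<le> lam i \<longleftrightarrow> 0 \<le> lam j) + (3 + \<bar>?x\<bar> + \<bar>?y\<bar>))"
  proof (cases "0 \<le> lam i \<longleftrightarrow> 0 \<le> lam j")
    case True
    then have "\<bar>lam i - lam j\<bar> = \<bar>\<bar>lam i\<bar> - \<bar>lam j\<bar>\<bar>" by auto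
    also have "\<dots> = \<Theta> * \<bar>?x - ?y\<bar>" unfolding ai aj using \<Theta> by (simp add: right_diff_distrib[symmetric] abs_mult)
    also have "\<dots> \<le> \<Theta> * (3 + \<bar>?x\<bar> + \<bar>?y\<bar>)" using \<Theta> by (intro mult_left_mono) auto
    also have "\<dots> \<le> \<Theta> * exp (3 + \<bar>?x\<bar> + \<bar>?y\<bar>)" using \<Theta> e by (intro mult_left_mono) auto
    finally show ?thesis using True \<Theta> by (simp add: exp_add)
  next
    case False
    have "\<bar>lam i - lam j\<bar> \<le> \<bar>lam i\<bar> + \<bar>lam j\<bar>" by linarith
    also have "\<dots> \<le> 3 + \<Theta> * \<bar>?x\<bar> + \<Theta> * \<bar>?y\<bar>" unfolding ai aj
      using sqrt2_bounds(2) \<Theta> mult_left_mono[OF abs_ge_self[of ?x], of \<Theta>] mult_left_mono[OF abs_ge_self[of ?y], of \<Theta>] by linarith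
    also have "\<dots> \<le> 3 + \<bar>?x\<bar> + \<bar>?y\<bar>"
      using \<Theta> by (intro add_mono mult_left_le_one_le) auto
    finally show ?thesis using False e by simp
  qed
  then have "\<bar>lam i - lam j\<bar> ^ 2 \<le> (exp (ln \<Theta> * of_bool (0 \<le> lam i \<longleftrightarrow> 0 \<le> lam j) + (3 + \<bar>?x\<bar> + \<bar>?y\<bar>)))\<^sup>2"
    by (intro power_mono) auto
  also have "\<dots> = exp (2 * ln \<Theta> * of_bool (0 \<le> lam i \<longleftrightarrow> 0 \<le> lam j) + 2 * (3 + \<bar>?x\<bar> + \<bar>?y\<bar>))"
    by (simp add: exp_double[symmetric] algebra_simps)
  finally show ?thesis .
qed

text \<open>The term \<open>M * \<Sum>x\<^sup>2\<close> is smaller than the confining energy \<open>M * L * \<Sum>x\<^sup>2\<close> by the factor \<open>L\<close>.\<close>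
lemma vandermonde_le:
  assumes \<Theta>: "0 < \<Theta>" "\<Theta> \<le> 1"
    and J_def: "J = nonneg_indices M lam"
  shows "(\<Prod>j<M. \<Prod>i<j. \<bar>lam i - lam j\<bar> ^ 2) \<le>
    exp (ln \<Theta> * ((real (card J))\<^sup>2 + (real (card ({..<M} - J)))\<^sup>2 - real M)
      + 4 * (real M)\<^sup>2 + real M * (\<Sum>i<M. (rescaled \<Theta> lam i)\<^sup>2))"
proof -
  let ?x = "rescaled \<Theta> lam"
  have J: "J \<subseteq> {..<M}" by (auto simp: J_def nonneg_indices_def)
  have s: "(0 \<le> lam i \<longleftrightarrow> 0 \<le> lam j) \<longleftrightarrow> (i \<in> J \<longleftrightarrow> j \<in> J)" if "j < M" "i < j" for i j
    using that by (auto simp: J_def nonneg_indices_def)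
  have "(\<Prod>j<M. \<Prod>i<j. \<bar>lam i - lam j\<bar> ^ 2) \<le> (\<Prod>j<M. \<Prod>i<j. exp (2 * ln \<Theta> * of_bool (0 \<le> lam i \<longleftrightarrow> 0 \<le> lam j)
     + 2 * (3 + \<bar>?x i\<bar> + \<bar>?x j\<bar>)))"
    by (intro prod_mono conjI prod_nonneg ballI pair_factor_le \<Theta>) auto
  also have "\<dots> = exp (\<Sum>j<M. \<Sum>i<j. 2 * ln \<Theta> * of_bool (0 \<le> lam i \<longleftrightarrow> 0 \<le> lam j) + 2 * (3 + \<bar>?x i\<bar> + \<bar>?x j\<bar>))"
    by (simp add: exp_sum)
  also have "(\<Sum>j<M. \<Sum>i<j. 2 * ln \<Theta> * of_bool (0 \<le> lam i \<longleftrightarrow> 0 \<le> lam j) + 2 * (3 + \<bar>?x i\<bar> + \<bar>?x j\<bar>))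
    = (\<Sum>j<M. \<Sum>i<j. 2 * ln \<Theta> * of_bool (i \<in> J \<longleftrightarrow> j \<in> J) + 2 * (3 + \<bar>?x i\<bar> + \<bar>?x j\<bar>))"
    using s by (intro sum.cong refl arg_cong2[of _ _ _ _ "(+)"] arg_cong[of _ _ "\<lambda>b. 2 * ln \<Theta> * of_bool b"]) auto
  also have "\<dots> = 2 * ln \<Theta> * (\<Sum>j<M. \<Sum>i<j. of_bool (i \<in> J \<longleftrightarrow> j \<in> J)) + 2 * (\<Sum>j<M. \<Sum>i<j. 3 + \<bar>?x i\<bar> + \<bar>?x j\<bar>)"
    by (simp only: sum.distrib sum_distrib_left[symmetric])
  also have "(\<Sum>j<M. \<Sum>i<j. of_bool (i \<in> J \<longleftrightarrow> j \<in> J)) = ((real (card J))\<^sup>2 + (real (card ({..<M} - J)))\<^sup>2 - real M) / 2"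
    by (rule sum_same_part[OF J])
  also have "2 * (\<Sum>j<M. \<Sum>i<j. 3 + \<bar>?x i\<bar> + \<bar>?x j\<bar>) \<le> 4 * (real M)\<^sup>2 + real M * (\<Sum>i<M. (?x i)\<^sup>2)"
  proof -
    have "(\<Sum>j<M. \<Sum>i<j. 3 + \<bar>?x i\<bar> + \<bar>?x j\<bar>) = ((\<Sum>j<M. \<Sum>i<M. 3 + \<bar>?x i\<bar> + \<bar>?x j\<bar>) - (\<Sum>i<M. 3 + \<bar>?x i\<bar> + \<bar>?x i\<bar>)) / 2"
      by (rule sum_pairs_symmetric) auto
    also have "(\<Sum>j<M. \<Sum>i<M. 3 + \<bar>?x i\<bar> + \<bar>?x j\<bar>) = 3 * (real M)\<^sup>2 + 2 * real M * (\<Sum>i<M. \<bar>?x i\<bar>)"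
      by (simp add: sum.distrib sum_distrib_left[symmetric] sum_distrib_right[symmetric] power2_eq_square algebra_simps)
    finally have "2 * (\<Sum>j<M. \<Sum>i<j. 3 + \<bar>?x i\<bar> + \<bar>?x j\<bar>)
      = 3 * (real M)\<^sup>2 + 2 * real M * (\<Sum>i<M. \<bar>?x i\<bar>) - (\<Sum>i<M. 3 + \<bar>?x i\<bar> + \<bar>?x i\<bar>)"
      by simp
    moreover have "(\<Sum>i<M. 3 + \<bar>?x i\<bar> + \<bar>?x i\<bar>) \<ge> 0" by (intro sum_nonneg) auto
    ultimately have *: "2 * (\<Sum>j<M. \<Sum>i<j. 3 + \<bar>?x i\<bar> + \<bar>?x j\<bar>) \<le> 3 * (real M)\<^sup>2 + real M * (2 * (\<Sum>i<M. \<bar>?x i\<bar>))"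
      by simp
    have "2 * \<bar>t\<bar> \<le> 1 + t\<^sup>2" for t :: real
      using zero_le_power2[of "\<bar>t\<bar> - 1"] by (simp add: power2_eq_square algebra_simps)
    then have "(\<Sum>i<M. 2 * \<bar>?x i\<bar>) \<le> (\<Sum>i<M. 1 + (?x i)\<^sup>2)" by (intro sum_mono)
    then have "2 * (\<Sum>i<M. \<bar>?x i\<bar>) \<le> real M + (\<Sum>i<M. (?x i)\<^sup>2)" by (simp add: sum.distrib sum_distrib_left)
    then have "real M * (2 * (\<Sum>i<M. \<bar>?x i\<bar>)) \<le> real M * (real M + (\<Sum>i<M. (?x i)\<^sup>2))" by (intro mult_left_mono) auto
    then show ?thesis using * by (simp add: power2_eq_square algebra_simps)
  qed
  finally show ?thesis by (simp add: add.assoc)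
qed

text \<open>The weight consists of \<open>N - M\<close> copies of the potential and a factor \<open>exp (- M * t\<^sup>2/2)\<close>, bounded by one. At
  \<open>lam i = 0\<close>, where the potential is infinite, \<open>M < N\<close> makes the left side vanish.\<close>
lemma particle_weight_le:
  assumes MN: "M < N" and \<Theta>: "0 < \<Theta>"
    and W: "\<And>x. - sqrt 2 < \<Theta> * x \<Longrightarrow> B x \<le> well (\<Theta> * x)"
  shows "lam i ^ (2 * (N - M)) * exp (- (real N * (lam i)\<^sup>2 / 2))
    \<le> exp (- real N * (1 - ln 2) + real M - real (N - M) * B (rescaled \<Theta> lam i))"
proof (cases "lam i = 0")
  case True
  then have "lam i ^ (2 * (N - M)) * exp (- (real N * (lam i)\<^sup>2 / 2)) = 0" using MN by simp
  then show ?thesis by (simp only: exp_ge_zero)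
next
  case False
  then have t: "0 < \<bar>lam i\<bar>" by simp
  define n where "n = N - M"
  have N: "real N = real n + real M" using MN by (simp add: n_def)
  have a: "\<bar>lam i\<bar> = sqrt 2 + \<Theta> * rescaled \<Theta> lam i" using abs_lam_eq \<Theta> by auto
  have "B (rescaled \<Theta> lam i) \<le> well (\<bar>lam i\<bar> - sqrt 2)"
    using W[of "rescaled \<Theta> lam i"] t unfolding a by simp
  then have pot: "1 - ln 2 + B (rescaled \<Theta> lam i) \<le> \<bar>lam i\<bar>\<^sup>2 / 2 - 2 * ln \<bar>lam i\<bar>"
    using potential_eq_well[OF t] by linarith
  have "lam i ^ (2 * n) = \<bar>lam i\<bar> ^ (2 * n)" by (simp add: power_mult)
  also have "\<dots> = exp (2 * real n * ln \<bar>lam i\<bar>)"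
    using t exp_of_nat_mult[of "2 * n" "ln \<bar>lam i\<bar>"] by simp
  finally have "lam i ^ (2 * n) * exp (- (real N * (lam i)\<^sup>2 / 2)) =
     exp (2 * real n * ln \<bar>lam i\<bar> + - (real N * (lam i)\<^sup>2 / 2))"
    by (simp only: exp_add)
  also have "\<dots> = exp (- real n * (\<bar>lam i\<bar>\<^sup>2 / 2 - 2 * ln \<bar>lam i\<bar>) - real M * (lam i)\<^sup>2 / 2)"
    by (intro arg_cong[of _ _ exp]) (simp add: N algebra_simps add_divide_distrib)
  also have "\<dots> \<le> exp (- real N * (1 - ln 2) + real M - real n * B (rescaled \<Theta> lam i))"
  proof -
    have "real n * (1 - ln 2 + B (rescaled \<Theta> lam i)) \<le> real n * (\<bar>lam i\<bar>\<^sup>2 / 2 - 2 * ln \<bar>lam i\<bar>)"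
      using pot by (intro mult_left_mono) auto
    moreover have "0 \<le> real M * ln 2" by simp
    moreover have "0 \<le> real M * (lam i)\<^sup>2 / 2" by simp
    ultimately show ?thesis
      by (simp only: N exp_le_cancel_iff ring_distribs mult_minus_left minus_add_distrib)
  qed
  finally show ?thesis by (simp add: n_def)
qed

lemma one_minus_cube_ge:
  fixes e :: real assumes "0 \<le> e" "e \<le> 1" shows "1 - 3 * e \<le> (1 - e) ^ 3"
proof -
  have "(1 - e) ^ 3 - (1 - 3 * e) = e\<^sup>2 * (3 - e)" by (simp add: power3_eq_cube power2_eq_square algebra_simps)
  moreover have "0 \<le> e\<^sup>2 * (3 - e)" using assms by simp
  ultimately show ?thesis by linarith
qed

text \<open>The real value of the truncated energy of the empirical pair.\<close>
definition soft_energy :: "nat \<Rightarrow> nat \<Rightarrow> real \<Rightarrow> (nat \<Rightarrow> real) \<Rightarrow> real"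
  where "soft_energy k M \<Theta> lam = (\<Sum>i<M. soft_square k (rescaled \<Theta> lam i)) / real M
    + (real (card (nonneg_indices M lam)) - real (card ({..<M} - nonneg_indices M lam)))\<^sup>2 / (4 * (real M)\<^sup>2)"

text \<open>The pointwise upper bound. A fraction \<open>e\<close> of the potential is estimated by the global bound \<open>s\<^sup>2/2\<close> and the rest
  by the truncated square. The fraction pays for the \<open>M * \<Sum>x\<^sup>2\<close> of the interaction and leaves the Gaussian
  factor. The losses \<open>(1 - e)^3\<close>, from this splitting, the quadratic approximation and \<open>N - M\<close> in place of \<open>N\<close>,
  are covered by the prefactor \<open>(k + 1)/(k + 2) = 1 - 3 * e\<close> of \<open>soft_square k\<close>, which fixes \<open>e\<close>.\<close>
lemma Q_weight_upper:
  fixes k M N :: nat and \<Theta> L \<epsilon> e :: real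
  assumes e: "e = 1 / (3 * real (k + 2))" and M: "1 \<le> M" "M < N" and \<Theta>: "0 < \<Theta>" "\<Theta> \<le> 1"
    and L: "L = - 2 * ln \<Theta>" "0 < L" and scale: "real N * \<Theta>\<^sup>2 = real M * L"
    and wl: "\<And>x. - sqrt 2 < \<Theta> * x \<Longrightarrow> \<Theta>\<^sup>2 * ((1 - e) * (\<bar>x\<bar> * min \<bar>x\<bar> (real (k + 1)))) \<le> well (\<Theta> * x)"
    and MN: "real M \<le> e * real N" and Le: "8 / e \<le> L" and err: "1 / (2 * real M) + 5 / L \<le> \<epsilon>"
  shows "Q_weight M N lam \<le> exp (- real N * real M * (1 - ln 2) - (real M)\<^sup>2 * L / 4)
     * exp (- (real M)\<^sup>2 * L * (soft_energy k M \<Theta> lam - \<epsilon>))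
     * (\<Prod>i<M. exp (- (e / 8 * real N) * (\<bar>lam i\<bar> - sqrt 2)\<^sup>2))"
proof -
  let ?x = "rescaled \<Theta> lam"
  define q where "q x = \<bar>x\<bar> * min \<bar>x\<bar> (real (k + 1))" for x :: real
  define J where "J = nonneg_indices M lam"
  define a where "a = real (card J)"
  define b where "b = real (card ({..<M} - J))"
  have ab: "a + b = real M" unfolding a_def b_def by (rule card_split) (auto simp: J_def nonneg_indices_def)
  have e01: "0 < e" "e \<le> 1/6" unfolding e by (simp_all add: divide_simps)
  have q0: "0 \<le> q x" for x by (simp add: q_def)
  define B where "B x = \<Theta>\<^sup>2 * ((1 - e)\<^sup>2 * q x + e * x\<^sup>2 / 2)" for x
  have BW: "B x \<le> well (\<Theta> * x)" if "- sqrt 2 < \<Theta> * x" for x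
  proof -
    have "(1 - e) * (\<Theta>\<^sup>2 * ((1 - e) * q x)) + e * ((\<Theta> * x)\<^sup>2 / 2) \<le> (1 - e) * well (\<Theta> * x) + e * well (\<Theta> * x)"
      using wl[OF that] well_ge[OF that] e01 by (intro add_mono mult_left_mono) (auto simp: q_def)
    also have "\<dots> = well (\<Theta> * x)" by (simp add: algebra_simps)
    finally show ?thesis by (simp add: B_def power2_eq_square algebra_simps)
  qed
  have nB: "(1 - e) * real M * L * ((1 - e)\<^sup>2 * q x + e * x\<^sup>2 / 2) \<le> real (N - M) * B x" for x
  proof -
    have "(1 - e) * real N \<le> real (N - M)" using MN M by (simp add: algebra_simps of_nat_diff)
    then have "(1 - e) * real N * (\<Theta>\<^sup>2 * ((1 - e)\<^sup>2 * q x + e * x\<^sup>2 / 2)) \<le> real (N - M) * B x"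
      unfolding B_def using e01 q0 by (intro mult_right_mono) auto
    moreover have "(1 - e) * real N * (\<Theta>\<^sup>2 * ((1 - e)\<^sup>2 * q x + e * x\<^sup>2 / 2))
       = (1 - e) * (real N * \<Theta>\<^sup>2) * ((1 - e)\<^sup>2 * q x + e * x\<^sup>2 / 2)" by (simp only: mult_ac)
    ultimately show ?thesis unfolding scale by (simp only: mult_ac)
  qed
  let ?P = "\<lambda>i. - real N * (1 - ln 2) + real M - real (N - M) * B (?x i)" and ?g = "\<lambda>i. - (e / 8 * real N) * (\<bar>lam i\<bar> - sqrt 2)\<^sup>2"
    and ?V = "ln \<Theta> * (a\<^sup>2 + b\<^sup>2 - real M) + 4 * (real M)\<^sup>2 + real M * (\<Sum>i<M. (?x i)\<^sup>2)"
  have "Q_weight M N lam = (\<Prod>i<M. lam i ^ (2 * (N - M)) * exp (- (real N * (lam i)\<^sup>2 / 2)))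
     * (\<Prod>j<M. \<Prod>i<j. \<bar>lam i - lam j\<bar> ^ 2)"
    by (simp add: Q_weight_def prod.distrib)
  also have "\<dots> \<le> (\<Prod>i<M. exp (?P i))
     * exp (?V)"
    unfolding a_def b_def
    by (intro mult_mono prod_mono conjI particle_weight_le[OF M(2) \<Theta>(1) BW] vandermonde_le[OF \<Theta> J_def]
        prod_nonneg ballI) auto
  also have "\<dots> = exp ((\<Sum>i<M. ?P i)
     + (?V))"
    by (simp add: exp_sum exp_add)
  also have "\<dots> \<le> exp ((- real N * real M * (1 - ln 2) - (real M)\<^sup>2 * L / 4)
     + (- (real M)\<^sup>2 * L * (soft_energy k M \<Theta> lam - \<epsilon>))
     + (\<Sum>i<M. ?g i))"
  proof (rule exp_le_cancel_iff[THEN iffD2])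
    define Q where "Q = (\<Sum>i<M. q (?x i))"
    define X where "X = (\<Sum>i<M. (?x i)\<^sup>2)"
    have Q0: "0 \<le> Q" and X0: "0 \<le> X" unfolding Q_def X_def by (auto intro!: sum_nonneg q0)
    have ML0: "0 \<le> real M * L" using L(2) by simp
    have 1: "(\<Sum>i<M. real (N - M) * B (?x i)) \<ge> (1 - e) * real M * L * ((1 - e)\<^sup>2 * Q + e * X / 2)"
    proof -
      have "(1 - e) * real M * L * ((1 - e)\<^sup>2 * Q + e * X / 2)
        = (\<Sum>i<M. (1 - e) * real M * L * ((1 - e)\<^sup>2 * q (?x i) + e * (?x i)\<^sup>2 / 2))"
        unfolding Q_def X_def by (simp only: sum_distrib_left[symmetric] sum.distrib sum_divide_distrib[symmetric])
      also have "\<dots> \<le> (\<Sum>i<M. real (N - M) * B (?x i))" by (intro sum_mono nB)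
      finally show ?thesis .
    qed
    have 2: "(\<Sum>i<M. ?g i) = - (e / 8) * (real M * L) * X"
    proof -
      have "- (e / 8 * real N) * (\<bar>lam i\<bar> - sqrt 2)\<^sup>2 = - (e / 8) * (real M * L) * (?x i)\<^sup>2" for i
        using abs_lam_eq[of \<Theta> lam i] \<Theta> by (simp add: scale[symmetric] power_mult_distrib)
      then show ?thesis unfolding X_def by (simp only: sum_distrib_left)
    qed
    define c where "c = real (k + 1) / real (k + 2)"
    have c: "c \<le> (1 - e) ^ 3"
    proof -
      have "c = 1 - 3 * e" unfolding c_def e by (simp add: field_simps)
      then show ?thesis using one_minus_cube_ge[of e] e01 by simp
    qed
    have 3: "(real M)\<^sup>2 * L * soft_energy k M \<Theta> lam = real M * L * (c * Q) + L * (a - b)\<^sup>2 / 4"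
    proof -
      have "soft_energy k M \<Theta> lam = c * Q / real M + (a - b)\<^sup>2 / (4 * (real M)\<^sup>2)"
        unfolding soft_energy_def Q_def soft_square_def q_def[symmetric] c_def[symmetric]
        by (simp add: sum_distrib_left a_def b_def J_def)
      then have "(real M)\<^sup>2 * soft_energy k M \<Theta> lam = real M * (c * Q) + (a - b)\<^sup>2 / 4"
        using M by (simp add: distrib_left power2_eq_square)
      then have "L * ((real M)\<^sup>2 * soft_energy k M \<Theta> lam) = L * (real M * (c * Q) + (a - b)\<^sup>2 / 4)" by simp
      then show ?thesis by (simp add: algebra_simps)
    qed
    have 4: "real M * L * (c * Q) \<le> real M * L * ((1 - e) ^ 3 * Q)"
      by (intro mult_left_mono mult_right_mono c Q0 ML0)
    have 5: "real M * X \<le> (e / 8) * (real M * L) * X"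
    proof -
      have "1 \<le> e / 8 * L" using Le e01 by (simp add: field_simps)
      then have "real M * X * 1 \<le> real M * X * (e / 8 * L)" using X0 by (intro mult_left_mono) auto
      then show ?thesis by (simp add: mult_ac)
    qed
    have 6: "e / 4 * (real M * L * X) \<le> (1 - e) * (e / 2) * (real M * L * X)"
    proof (rule mult_right_mono)
      have "1/2 * (e / 2) \<le> (1 - e) * (e / 2)" using e01 by (intro mult_right_mono) auto
      then show "e / 4 \<le> (1 - e) * (e / 2)" by simp
    qed (use ML0 X0 in simp)
    have 7: "real M * L / 2 + 5 * (real M)\<^sup>2 \<le> (real M)\<^sup>2 * L * \<epsilon>"
    proof -
      have "(real M)\<^sup>2 * L * (1 / (2 * real M) + 5 / L) \<le> (real M)\<^sup>2 * L * \<epsilon>"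
        using L(2) err by (intro mult_left_mono) auto
      moreover have "(real M)\<^sup>2 * L * (1 / (2 * real M) + 5 / L) = real M * L / 2 + 5 * (real M)\<^sup>2"
        using M L(2) by (simp add: field_simps power2_eq_square)
      ultimately show ?thesis by simp
    qed
    have 8: "a\<^sup>2 + b\<^sup>2 = (real M)\<^sup>2 / 2 + (a - b)\<^sup>2 / 2"
      unfolding ab[symmetric] by (simp add: power2_eq_square field_simps)
    have 9: "ln \<Theta> * (a\<^sup>2 + b\<^sup>2 - real M) = - (real M)\<^sup>2 * L / 4 - L * (a - b)\<^sup>2 / 4 + real M * L / 2"
    proof -
      have l: "ln \<Theta> = - (L / 2)" using L by simp
      show ?thesis unfolding 8 l by (simp add: algebra_simps)
    qed
    have 10: "(1 - e) * real M * L * ((1 - e)\<^sup>2 * Q + e * X / 2)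
       = real M * L * ((1 - e) ^ 3 * Q) + (1 - e) * (e / 2) * (real M * L * X)"
      by (simp add: power3_eq_cube power2_eq_square field_simps)
    have 11: "(\<Sum>i<M. ?P i)
       = - real N * real M * (1 - ln 2) + (real M)\<^sup>2 - (\<Sum>i<M. real (N - M) * B (?x i))"
      by (simp add: sum_subtractf sum.distrib power2_eq_square algebra_simps)
    have 12: "- (real M)\<^sup>2 * L * (soft_energy k M \<Theta> lam - \<epsilon>)
       = (real M)\<^sup>2 * L * \<epsilon> - (real M * L * (c * Q) + L * (a - b)\<^sup>2 / 4)"
      unfolding 3[symmetric] by (simp add: algebra_simps)
    show "(\<Sum>i<M. ?P i)
     + (?V)
     \<le> (- real N * real M * (1 - ln 2) - (real M)\<^sup>2 * L / 4)
     + (- (real M)\<^sup>2 * L * (soft_energy k M \<Theta> lam - \<epsilon>))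
     + (\<Sum>i<M. ?g i)"
    proof -
      have "e / 4 * (real M * L * X) = 2 * ((e / 8) * (real M * L) * X)" by simp
      then have "real M * X - (1 - e) * (e / 2) * (real M * L * X) \<le> - (e / 8) * (real M * L) * X"
        using 5 6 by linarith
      then show ?thesis unfolding 11 9 12 2 X_def[symmetric] using 1[unfolded 10] 4 7 by linarith
    qed
  qed
  finally show ?thesis by (simp only: exp_add exp_sum[OF finite_lessThan])
qed

section \<open>The integrated upper bound\<close>

interpretation lborel_product: product_sigma_finite "\<lambda>i::nat. lborel :: real measure"
  by unfold_locales

lemma measurable_lborel_vec_component:
  assumes "i < M" shows "(\<lambda>lam. lam i) \<in> borel_measurable (lborel_vec M)"
proof -
  have i: "i \<in> {..<M}" using assms by simp
  show ?thesis using measurable_component_singleton[OF i, of "\<lambda>_. lborel"] unfolding lborel_vec_def by simp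
qed

lemma Q_weight_measurable[measurable]: "Q_weight M N \<in> borel_measurable (lborel_vec M)"
proof -
  show ?thesis
    unfolding Q_weight_def
    by (intro measurable_lborel_vec_component borel_measurable_times borel_measurable_prod borel_measurable_power borel_measurable_abs borel_measurable_diff
       borel_measurable_exp measurable_compose[OF _ borel_measurable_exp] borel_measurable_uminus borel_measurable_divide) auto
qed

lemma nn_integral_lborel_vec_prod:
  assumes [measurable]: "f \<in> borel_measurable lborel"
  shows "(\<integral>\<^sup>+ lam. (\<Prod>i<M. f (lam i)) \<partial>lborel_vec M) = (\<integral>\<^sup>+ t. f t \<partial>lborel) ^ M"
  unfolding lborel_vec_def by (subst lborel_product.product_nn_integral_prod) auto

lemma nn_integral_gaussian:
  assumes a: "0 < a"
  shows "(\<integral>\<^sup>+ t. ennreal (exp (- a * (t - c)\<^sup>2)) \<partial>lborel) = ennreal (sqrt (pi / a))"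
proof -
  define s where "s = sqrt (1 / (2 * a))"
  have s: "0 < s" "s\<^sup>2 = 1 / (2 * a)" using a by (auto simp: s_def)
  interpret prob_space "density lborel (normal_density c s)" by (rule prob_space_normal_density[OF s(1)])
  have one: "(\<integral>\<^sup>+ t. ennreal (normal_density c s t) \<partial>lborel) = 1"
    using emeasure_space_1 by (simp add: emeasure_density)
  have nd: "exp (- a * (t - c)\<^sup>2) = sqrt (pi / a) * normal_density c s t" for t
  proof -
    have "normal_density c s t = 1 / sqrt (pi / a) * exp (- a * (t - c)\<^sup>2)"
      unfolding normal_density_def s(2) using a by (simp add: field_simps)
    moreover have "sqrt (pi / a) \<noteq> 0" using a by simp
    ultimately show ?thesis by (simp add: field_simps)
  qed
  have "(\<integral>\<^sup>+ t. ennreal (exp (- a * (t - c)\<^sup>2)) \<partial>lborel) = (\<integral>\<^sup>+ t. ennreal (sqrt (pi / a)) * ennreal (normal_density c s t) \<partial>lborel)"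
    unfolding nd using a by (intro nn_integral_cong ennreal_mult) auto
  also have "\<dots> = ennreal (sqrt (pi / a))" by (simp add: nn_integral_cmult one)
  finally show ?thesis .
qed

text \<open>One Gaussian for each well.\<close>
lemma nn_integral_two_bump:
  assumes a: "0 < a"
  shows "(\<integral>\<^sup>+ t. ennreal (exp (- a * (\<bar>t\<bar> - sqrt 2)\<^sup>2)) \<partial>lborel) \<le> ennreal (2 * sqrt (pi / a))"
proof -
  have "(\<integral>\<^sup>+ t. ennreal (exp (- a * (\<bar>t\<bar> - sqrt 2)\<^sup>2)) \<partial>lborel)
    \<le> (\<integral>\<^sup>+ t. ennreal (exp (- a * (t - sqrt 2)\<^sup>2)) + ennreal (exp (- a * (t - (- sqrt 2))\<^sup>2)) \<partial>lborel)"
  proof (rule nn_integral_mono)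
    fix t :: real
    have "(\<bar>t\<bar> - sqrt 2)\<^sup>2 = (t - sqrt 2)\<^sup>2 \<or> (\<bar>t\<bar> - sqrt 2)\<^sup>2 = (t - (- sqrt 2))\<^sup>2"
      by (cases "0 \<le> t") (auto simp: power2_commute[of "- t"] algebra_simps power2_eq_square)
    then show "ennreal (exp (- a * (\<bar>t\<bar> - sqrt 2)\<^sup>2)) \<le> ennreal (exp (- a * (t - sqrt 2)\<^sup>2)) + ennreal (exp (- a * (t - (- sqrt 2))\<^sup>2))"
      by (elim disjE) (simp_all only: add_increasing add_increasing2 order_refl zero_le)
  qed
  also have "\<dots> = ennreal (sqrt (pi / a)) + ennreal (sqrt (pi / a))"
    by (subst nn_integral_add) (simp_all only: nn_integral_gaussian[OF a], auto)
  also have "\<dots> = ennreal (2 * sqrt (pi / a))" using a by (simp add: ennreal_plus[symmetric] del: ennreal_plus)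
  finally show ?thesis .
qed

text \<open>The Gaussian factors have variance of order \<open>1/N\<close>, so each one-dimensional integral is at most one when
  \<open>N\<close> is large: entropy only helps here.\<close>
lemma Q_weight_integral_upper:
  fixes k M N :: nat and \<Theta> L \<epsilon> e c :: real
  assumes e: "e = 1 / (3 * real (k + 2))" and M: "1 \<le> M" "M < N" and \<Theta>: "0 < \<Theta>" "\<Theta> \<le> 1"
    and L: "L = - 2 * ln \<Theta>" "0 < L" and scale: "real N * \<Theta>\<^sup>2 = real M * L"
    and wl: "\<And>x. - sqrt 2 < \<Theta> * x \<Longrightarrow> \<Theta>\<^sup>2 * ((1 - e) * (\<bar>x\<bar> * min \<bar>x\<bar> (real (k + 1)))) \<le> well (\<Theta> * x)"
    and MN: "real M \<le> e * real N" and Le: "8 / e \<le> L" and err: "1 / (2 * real M) + 5 / L \<le> \<epsilon>"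
    and Ne: "32 * pi / e \<le> real N"
    and c: "\<And>lam. lam \<in> S \<Longrightarrow> c \<le> soft_energy k M \<Theta> lam"
  shows "(\<integral>\<^sup>+ lam. ennreal (Q_weight M N lam) * indicator S lam \<partial>lborel_vec M)
    \<le> ennreal (exp (- real N * real M * (1 - ln 2) - (real M)\<^sup>2 * L / 4) * exp (- (real M)\<^sup>2 * L * (c - \<epsilon>)))"
proof -
  let ?A = "exp (- real N * real M * (1 - ln 2) - (real M)\<^sup>2 * L / 4) * exp (- (real M)\<^sup>2 * L * (c - \<epsilon>))"
  let ?g = "\<lambda>t. exp (- (e / 8 * real N) * (\<bar>t\<bar> - sqrt 2)\<^sup>2)"
  have e0: "0 < e" using e by simp
  have N0: "0 < e / 8 * real N" using e0 M by simp
  have "(\<integral>\<^sup>+ lam. ennreal (Q_weight M N lam) * indicator S lam \<partial>lborel_vec M)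
    \<le> (\<integral>\<^sup>+ lam. ennreal ?A * (\<Prod>i<M. ennreal (?g (lam i))) \<partial>lborel_vec M)"
  proof (rule nn_integral_mono)
    fix lam :: "nat \<Rightarrow> real"
    show "ennreal (Q_weight M N lam) * indicator S lam \<le> ennreal ?A * (\<Prod>i<M. ennreal (?g (lam i)))"
    proof (cases "lam \<in> S")
      case True
      have "Q_weight M N lam \<le> exp (- real N * real M * (1 - ln 2) - (real M)\<^sup>2 * L / 4)
         * exp (- (real M)\<^sup>2 * L * (soft_energy k M \<Theta> lam - \<epsilon>)) * (\<Prod>i<M. ?g (lam i))"
        by (rule Q_weight_upper[OF e M \<Theta> L scale wl MN Le err])
      also have "\<dots> \<le> ?A * (\<Prod>i<M. ?g (lam i))"
      proof (intro mult_right_mono mult_left_mono prod_nonneg)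
        have "(real M)\<^sup>2 * L * (c - \<epsilon>) \<le> (real M)\<^sup>2 * L * (soft_energy k M \<Theta> lam - \<epsilon>)"
          using c[OF True] L(2) by (intro mult_left_mono) auto
        then show "exp (- (real M)\<^sup>2 * L * (soft_energy k M \<Theta> lam - \<epsilon>)) \<le> exp (- (real M)\<^sup>2 * L * (c - \<epsilon>))"
          by simp
      qed auto
      finally show ?thesis using True
        by (simp add: prod_ennreal ennreal_mult[symmetric] prod_nonneg ennreal_leI del: exp_le_cancel_iff)
    qed simp
  qed
  also have "\<dots> = ennreal ?A * (\<integral>\<^sup>+ lam. (\<Prod>i<M. ennreal (?g (lam i))) \<partial>lborel_vec M)"
  proof (rule nn_integral_cmult)
    show "(\<lambda>lam. \<Prod>i<M. ennreal (?g (lam i))) \<in> borel_measurable (lborel_vec M)"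
      by (intro borel_measurable_prod_ennreal
          measurable_compose[OF measurable_lborel_vec_component, where g = "\<lambda>t. ennreal (?g t)"]) auto
  qed
  also have "(\<integral>\<^sup>+ lam. (\<Prod>i<M. ennreal (?g (lam i))) \<partial>lborel_vec M) = (\<integral>\<^sup>+ t. ennreal (?g t) \<partial>lborel) ^ M"
    by (rule nn_integral_lborel_vec_prod) measurable
  also have "\<dots> \<le> 1"
  proof (rule power_le_one)
    have "(\<integral>\<^sup>+ t. ennreal (?g t) \<partial>lborel) \<le> ennreal (2 * sqrt (pi / (e / 8 * real N)))"
      by (rule nn_integral_two_bump[OF N0])
    also have "\<dots> \<le> ennreal 1"
    proof (rule ennreal_leI)
      have "pi / (e / 8 * real N) \<le> (1/2)\<^sup>2" using Ne e0 M by (simp add: field_simps power2_eq_square)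
      then have "sqrt (pi / (e / 8 * real N)) \<le> 1/2" by (intro real_le_lsqrt) auto
      then show "2 * sqrt (pi / (e / 8 * real N)) \<le> 1" by simp
    qed
    finally show "(\<integral>\<^sup>+ t. ennreal (?g t) \<partial>lborel) \<le> 1" by simp
  qed simp
  finally show ?thesis by (simp add: mult_left_mono)
qed

section \<open>Quantile configurations\<close>

lemma lborel_set_integrable_bounded:
  fixes g :: "real \<Rightarrow> real"
  assumes "g \<in> borel_measurable borel" "\<And>u. \<bar>g u\<bar> \<le> B"
  shows "set_integrable lborel {a..<b} g"
proof -
  have "emeasure lborel {a..<b} < \<infinity>" by (cases "a \<le> b") auto
  then show ?thesis
    unfolding set_integrable_def
    by (intro integrableI_bounded_set_indicator[where B = B]) (use assms in auto)
qed

text \<open>For monotone \<open>T\<close> the errors on the subintervals telescope. The bound depends on \<open>h\<close> only through its Lipschitz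
  constant, which is what makes it uniform over the bounded-Lipschitz test functions.\<close>
lemma riemann_sum_mono:
  fixes T h :: "real \<Rightarrow> real"
  assumes T: "mono T" and bT: "\<And>u. \<bar>T u\<bar> \<le> R" and h: "\<And>a b. \<bar>h a - h b\<bar> \<le> K * \<bar>a - b\<bar>" and K: "0 \<le> K"
    and k: "1 \<le> k" and j: "j \<le> k"
  shows "\<bar>(LINT u:{0..<real j / real k}|lborel. h (T u)) - (\<Sum>i<j. h (T (real i / real k))) / real k\<bar>
    \<le> K * (T (real j / real k) - T 0) / real k"
  using j
proof (induction j)
  case 0
  then show ?case by (simp add: set_lebesgue_integral_def)
next
  case (Suc j)
  let ?a = "real j / real k" and ?b = "real (Suc j) / real k"
  have ab: "0 \<le> ?a" "?a \<le> ?b" "?b - ?a = 1 / real k" using k by (auto simp: field_simps)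
  have hm: "h \<in> borel_measurable borel" by (rule borel_measurable_lipschitz[OF h K])
  have gm: "(\<lambda>u. h (T u)) \<in> borel_measurable borel"
    by (rule measurable_compose[OF borel_measurable_mono[OF T] hm])
  have gb: "\<bar>h (T u)\<bar> \<le> \<bar>h 0\<bar> + K * R" for u
  proof -
    have "\<bar>h (T u) - h 0\<bar> \<le> K * \<bar>T u - 0\<bar>" by (rule h)
    also have "\<dots> \<le> K * R" using bT[of u] K by (intro mult_left_mono) auto
    finally show ?thesis by linarith
  qed
  note int = lborel_set_integrable_bounded[OF gm gb]
  have split: "(LINT u:{0..<?b}|lborel. h (T u)) = (LINT u:{0..<?a}|lborel. h (T u)) + (LINT u:{?a..<?b}|lborel. h (T u))"
  proof -
    have "{0..<?b} = {0..<?a} \<union> {?a..<?b}" by (rule ivl_disj_un_two(3)[OF ab(1,2), symmetric])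
    then show ?thesis using set_integral_Un[OF _ int int, of 0 ?a ?a ?b] by auto
  qed
  have const: "(LINT u:{?a..<?b}|lborel. c) = c / real k" for c :: real
    unfolding set_lebesgue_integral_def using ab by simp
  have ic: "set_integrable lborel {?a..<?b} (\<lambda>_. c)" for c :: real
    by (rule lborel_set_integrable_bounded[of _ "\<bar>c\<bar>"]) auto
  have "\<bar>(LINT u:{?a..<?b}|lborel. h (T u)) - h (T ?a) / real k\<bar> \<le> K * (T ?b - T ?a) / real k"
  proof -
    have "(LINT u:{?a..<?b}|lborel. h (T u)) - h (T ?a) / real k = (LINT u:{?a..<?b}|lborel. h (T u) - h (T ?a))"
      by (subst set_integral_diff(2)[OF int ic]) (simp only: const)
    also have "\<bar>\<dots>\<bar> \<le> (LINT u:{?a..<?b}|lborel. \<bar>h (T u) - h (T ?a)\<bar>)"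
      using set_integral_norm_bound[OF set_integral_diff(1)[OF int ic]] by simp
    also have "\<dots> \<le> (LINT u:{?a..<?b}|lborel. K * (T ?b - T ?a))"
    proof (rule set_integral_mono[OF set_integrable_abs[OF set_integral_diff(1)[OF int ic]] ic])
      fix u assume u: "u \<in> {?a..<?b}"
      have "\<bar>h (T u) - h (T ?a)\<bar> \<le> K * \<bar>T u - T ?a\<bar>" by (rule h)
      also have "\<dots> \<le> K * (T ?b - T ?a)"
        using u monoD[OF T, of ?a u] monoD[OF T, of u ?b] K by (intro mult_left_mono) auto
      finally show "\<bar>h (T u) - h (T ?a)\<bar> \<le> K * (T ?b - T ?a)" .
    qed
    also have "\<dots> = K * (T ?b - T ?a) / real k" by (rule const)
    finally show ?thesis .
  qed
  moreover have "\<bar>(LINT u:{0..<?a}|lborel. h (T u)) - (\<Sum>i<j. h (T (real i / real k))) / real k\<bar>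
    \<le> K * (T ?a - T 0) / real k" using Suc by simp
  moreover have "K * (T ?b - T 0) / real k = K * (T ?b - T ?a) / real k + K * (T ?a - T 0) / real k"
    by (simp add: add_divide_distrib[symmetric] distrib_left[symmetric])
  ultimately show ?case unfolding split by (simp add: add_divide_distrib)
qed

definition clamp :: "real \<Rightarrow> real \<Rightarrow> real" where "clamp R z = max (- R) (min R z)"

text \<open>The quantile transform carries Lebesgue measure on the unit interval to \<open>\<rho>\<close>. The quantile function is
  clamped to \<open>{-R..R}\<close> and extended by the constants \<open>-R\<close> and \<open>R\<close>, so that it is monotone on the whole line.\<close>
lemma quantile_average:
  assumes \<rho>: "real_distribution \<rho>" and R: "0 \<le> R" and k: "1 \<le> k"
  shows "\<exists>y :: nat \<Rightarrow> real. mono y \<and> (\<forall>i. \<bar>y i\<bar> \<le> R) \<and>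
    (\<forall>h K. 0 \<le> K \<longrightarrow> (\<forall>a b. \<bar>h a - h b\<bar> \<le> K * \<bar>a - b\<bar>) \<longrightarrow>
      \<bar>(LINT x|\<rho>. h (clamp R x)) - (\<Sum>i<k. h (y i)) / real k\<bar> \<le> 2 * R * K / real k)"
proof -
  interpret cdf_distribution \<rho> unfolding cdf_distribution_def by fact
  define T where "T u = (if u \<le> 0 then - R else if 1 \<le> u then R else clamp R (I u))" for u :: real
  have cl: "- R \<le> clamp R z" "clamp R z \<le> R" for z using R by (auto simp: clamp_def)
  have clm: "clamp R a \<le> clamp R b" if "a \<le> b" for a b using that by (auto simp: clamp_def)
  have T: "mono T"
  proof (rule monoI)
    fix u v :: real assume "u \<le> v"
    then show "T u \<le> T v"
      using cl R clm mono_onD[OF mono_I, of u v] by (auto simp: T_def)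
  qed
  have bT: "\<bar>T u\<bar> \<le> R" for u using cl[of "I u"] R by (auto simp: T_def abs_le_iff)
  have avg: "\<bar>(LINT x|\<rho>. h (clamp R x)) - (\<Sum>i<k. h (T (real i / real k))) / real k\<bar> \<le> 2 * R * K / real k"
    if K: "0 \<le> K" and h: "\<And>a b. \<bar>h a - h b\<bar> \<le> K * \<bar>a - b\<bar>" for h K
  proof -
    have hm: "h \<in> borel_measurable borel" by (rule borel_measurable_lipschitz[OF h K])
    have cm: "(\<lambda>x. h (clamp R x)) \<in> borel_measurable borel"
      unfolding clamp_def by (rule measurable_compose[OF _ hm]) measurable
    have tm: "(\<lambda>u. h (T u)) \<in> borel_measurable borel"
      by (rule measurable_compose[OF borel_measurable_mono[OF T] hm])
    let ?\<Omega> = "restrict_space lborel {0<..<1::real}"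
    have "(LINT x|\<rho>. h (clamp R x)) = (LINT x|distr ?\<Omega> borel I. h (clamp R x))" by (simp add: distr_I_eq_M)
    also have "\<dots> = (LINT u|?\<Omega>. h (clamp R (I u)))"
      by (rule integral_distr[OF _ cm]) (use measurable_CI in \<open>simp cong: measurable_cong_sets restrict_space_sets_cong\<close>)
    also have "\<dots> = (LINT u:{0<..<1}|lborel. h (clamp R (I u)))"
      by (subst integral_restrict_space) (auto simp: set_lebesgue_integral_def)
    also have "\<dots> = (LINT u:{0<..<1}|lborel. h (T u))"
      by (rule set_lebesgue_integral_cong) (auto simp: T_def)
    also have "\<dots> = (LINT u:{0..<1}|lborel. h (T u))"
      unfolding set_lebesgue_integral_def
    proof (rule integral_cong_AE)
      show "AE u in lborel. indicat_real {0<..<1} u *\<^sub>R h (T u) = indicat_real {0..<1} u *\<^sub>R h (T u)"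
        using AE_lborel_singleton[of "0::real"] by eventually_elim (auto simp: indicator_def)
    qed (use tm in auto)
    finally have "(LINT x|\<rho>. h (clamp R x)) = (LINT u:{0..<real k / real k}|lborel. h (T u))" using k by simp
    then have "\<bar>(LINT x|\<rho>. h (clamp R x)) - (\<Sum>i<k. h (T (real i / real k))) / real k\<bar>
      \<le> K * (T (real k / real k) - T 0) / real k"
      using riemann_sum_mono[OF T bT h K k order_refl] by simp
    also have "\<dots> = 2 * R * K / real k" using k by (simp add: T_def)
    finally show ?thesis .
  qed
  have "mono (\<lambda>i. T (real i / real k))"
    by (intro monoI monoD[OF T] divide_right_mono) auto
  then show ?thesis using bT avg by (intro exI[of _ "\<lambda>i. T (real i / real k)"]) auto
qed

text \<open>The first \<open>k\<close> of \<open>M\<close> particles, at the positions \<open>y\<close>, represent the submeasure \<open>\<mu>\<close> up to \<open>\<epsilon>\<close>. Monotonicity is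
  what later turns a drift of the positions into a separation.\<close>
definition approximates :: "real measure \<Rightarrow> real \<Rightarrow> real \<Rightarrow> nat \<Rightarrow> nat \<Rightarrow> (nat \<Rightarrow> real) \<Rightarrow> bool"
  where "approximates \<mu> \<epsilon> R M k y \<longleftrightarrow> mono y \<and> (\<forall>i. \<bar>y i\<bar> \<le> R) \<and>
    (\<forall>f\<in>BL_functions. \<bar>(\<Sum>i<k. f (y i)) / real M - (LINT x|\<mu>. f x)\<bar> \<le> \<epsilon>) \<and>
    (\<Sum>i<k. (y i)\<^sup>2) / real M \<le> (LINT x|\<mu>. x\<^sup>2) + \<epsilon>"

text \<open>The number \<open>k\<close> of particles is within one of \<open>mass \<mu> * M\<close>. The measure is normalised and its quantiles are
  used; clamping them at \<open>R\<close> changes averages little by Chebyshev's inequality and decreases the second moment.\<close>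
lemma quantile_points:
  assumes \<mu>: "\<mu> \<in> submeasures" and int: "integrable \<mu> (\<lambda>x. x\<^sup>2)" and \<epsilon>: "0 < \<epsilon>"
  shows "\<exists>R\<ge>0. \<exists>M0. \<forall>M\<ge>M0. \<forall>k. \<bar>real k - mass \<mu> * real M\<bar> \<le> 1 \<longrightarrow>
    (\<exists>y. approximates \<mu> \<epsilon> R M k y)"
proof (cases "mass \<mu> = 0")
  case True
  have bd: "\<bar>LINT x|\<mu>. f x\<bar> \<le> 0" if "f \<in> BL_functions" for f
    using abs_integral_BL_le_mass[OF \<mu> that] True by simp
  obtain M0 :: nat where M0: "1 / \<epsilon> \<le> real M0" using real_arch_simple by blast
  show ?thesis
  proof (intro exI[of _ "0::real"] exI[of _ "Suc M0"] conjI allI impI)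
    fix M k :: nat assume M: "Suc M0 \<le> M" and k: "\<bar>real k - mass \<mu> * real M\<bar> \<le> 1"
    have "1 / \<epsilon> \<le> real M" using M M0 by linarith
    then have Me: "1 / real M \<le> \<epsilon>" using \<epsilon> M by (simp add: field_simps)
    have k1: "real k \<le> 1" using k True by simp
    have fb: "\<bar>(\<Sum>i<k. f 0) / real M - (LINT x|\<mu>. f x)\<bar> \<le> \<epsilon>" if f: "f \<in> BL_functions" for f
    proof -
      have "\<bar>real k * f 0\<bar> \<le> 1 * 1"
        unfolding abs_mult using BL_functionsD(1)[OF f] k1 by (intro mult_mono) auto
      then have "\<bar>(\<Sum>i<k. f 0) / real M\<bar> \<le> 1 / real M" by (simp add: divide_right_mono)
      then show ?thesis using bd[OF f] Me by linarith
    qed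
    have "0 \<le> (LINT x|\<mu>. x\<^sup>2)" by (rule integral_nonneg_AE) auto
    then show "\<exists>y. approximates \<mu> \<epsilon> 0 M k y"
      unfolding approximates_def using fb \<epsilon> by (intro exI[of _ "\<lambda>_. 0"]) (auto intro: monoI)
  qed simp
next
  case False
  define m where "m = mass \<mu>"
  have m: "0 < m" "m \<le> 1" using False mass_bounds[OF \<mu>] by (auto simp: m_def)
  define S where "S = (LINT x|\<mu>. x\<^sup>2)"
  have S0: "0 \<le> S" unfolding S_def by (rule integral_nonneg_AE) auto
  define \<rho> where "\<rho> = scale_measure (ennreal (1 / m)) \<mu>"
  have \<rho>: "real_distribution \<rho>" unfolding \<rho>_def m_def by (rule normalised_real_distribution) (use \<mu> m in \<open>auto simp: m_def\<close>)
  have int\<rho>: "(LINT x|\<mu>. f x) = m * (LINT x|\<rho>. f x)" if "f \<in> borel_measurable borel" for f :: "real \<Rightarrow> real"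
    unfolding \<rho>_def using m measurable_submeasure[OF \<mu> that] by (subst integral_scale_measure) auto
  interpret finite_measure \<mu> by (rule submeasuresD[OF \<mu>])
  \<comment> \<open>makes the Chebyshev error \<open>2 * S / R\<^sup>2\<close> at most \<open>\<epsilon> / 2\<close>\<close>
  define R where "R = sqrt (1 + 4 * S / \<epsilon>)"
  have R2: "R\<^sup>2 = 1 + 4 * S / \<epsilon>" using S0 \<epsilon> by (simp add: R_def)
  have R1: "1 \<le> R" unfolding R_def using S0 \<epsilon> by simp
  have SR: "2 * S / R\<^sup>2 \<le> \<epsilon> / 2"
  proof -
    have "2 * S \<le> \<epsilon> / 2 * R\<^sup>2" unfolding R2 using \<epsilon> by (simp add: field_simps)
    then show ?thesis using R1 by (simp add: pos_divide_le_eq)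
  qed
  obtain M0 :: nat where M0: "2 / m + 2 * (9 * R\<^sup>2 + 4 * R + 1) / \<epsilon> \<le> real M0" using real_arch_simple by blast
  show ?thesis
  proof (intro exI[of _ R] exI[of _ "Suc M0"] conjI allI impI)
    show "0 \<le> R" using R1 by simp
    fix M k :: nat assume M: "Suc M0 \<le> M" and k: "\<bar>real k - mass \<mu> * real M\<bar> \<le> 1"
    have "0 \<le> 2 * (9 * R\<^sup>2 + 4 * R + 1) / \<epsilon>" "0 \<le> 2 / m" using R1 \<epsilon> m by auto
    then have M1: "2 / m \<le> real M" "2 * (9 * R\<^sup>2 + 4 * R + 1) / \<epsilon> \<le> real M" and Mpos: "0 < real M" using M0 M by linarith+
    have km: "\<bar>real k / real M - m\<bar> \<le> 1 / real M"
    proof -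
      have "real k / real M - m = (real k - m * real M) / real M" using Mpos by (simp add: field_simps)
      then show ?thesis using k Mpos by (simp add: m_def divide_right_mono)
    qed
    have kl: "m * real M / 2 \<le> real k"
    proof -
      have "2 \<le> m * real M" using M1(1) m by (simp add: field_simps)
      then show ?thesis using k by (simp add: m_def abs_le_iff)
    qed
    then have kpos: "0 < real k" using m Mpos by (meson half_gt_zero less_le_trans mult_pos_pos)
    then have k1: "1 \<le> k" by simp
    have mk: "m / real k \<le> 2 / real M" using kl kpos Mpos by (simp add: field_simps)
    obtain y where y: "mono y" "\<And>i. \<bar>y i\<bar> \<le> R"
      and avg: "\<And>h K. 0 \<le> K \<Longrightarrow> (\<And>a b. \<bar>h a - h b\<bar> \<le> K * \<bar>a - b\<bar>) \<Longrightarrow>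
      \<bar>(LINT x|\<rho>. h (clamp R x)) - (\<Sum>i<k. h (y i)) / real k\<bar> \<le> 2 * R * K / real k"
      using quantile_average[OF \<rho> \<open>0 \<le> R\<close> k1] by metis
    \<comment> \<open>Riemann sum error with \<open>m / k \<le> 2 / M\<close>, plus the error from \<open>k / M\<close> in place of \<open>m\<close>\<close>
    have avgM: "\<bar>(LINT x|\<mu>. h (clamp R x)) - (\<Sum>i<k. h (y i)) / real M\<bar> \<le> (4 * R * K + B) / real M"
      if K: "0 \<le> K" and h: "\<And>a b. \<bar>h a - h b\<bar> \<le> K * \<bar>a - b\<bar>" and B: "\<And>i. \<bar>h (y i)\<bar> \<le> B" for h K B
    proof -
      have hm: "h \<in> borel_measurable borel" by (rule borel_measurable_lipschitz[OF h K])
      have cm: "(\<lambda>x. h (clamp R x)) \<in> borel_measurable borel"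
        unfolding clamp_def by (rule measurable_compose[OF _ hm]) measurable
      define A where "A = (\<Sum>i<k. h (y i)) / real k"
      have A: "(\<Sum>i<k. h (y i)) / real M = real k / real M * A" using kpos by (simp add: A_def)
      have Ab: "\<bar>A\<bar> \<le> B"
      proof -
        have "\<bar>\<Sum>i<k. h (y i)\<bar> \<le> (\<Sum>i<k. B)" by (intro order_trans[OF sum_abs] sum_mono B)
        then show ?thesis using kpos by (simp add: A_def divide_le_eq mult.commute)
      qed
      have "\<bar>m * (LINT x|\<rho>. h (clamp R x)) - m * A\<bar> \<le> 4 * R * K / real M"
      proof -
        have "\<bar>m * (LINT x|\<rho>. h (clamp R x)) - m * A\<bar> = m * \<bar>(LINT x|\<rho>. h (clamp R x)) - A\<bar>"
          using m by (simp add: right_diff_distrib[symmetric] abs_mult)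
        also have "\<dots> \<le> m * (2 * R * K / real k)" using avg[OF K h] m by (intro mult_left_mono) (auto simp: A_def)
        also have "\<dots> = (2 * R * K) * (m / real k)" by simp
        also have "\<dots> \<le> (2 * R * K) * (2 / real M)" using mk R1 K by (intro mult_left_mono) auto
        finally show ?thesis by simp
      qed
      moreover have "\<bar>m * A - real k / real M * A\<bar> \<le> B / real M"
      proof -
        have "\<bar>m * A - real k / real M * A\<bar> = \<bar>real k / real M - m\<bar> * \<bar>A\<bar>"
          unfolding left_diff_distrib[symmetric] abs_mult by (simp only: abs_minus_commute)
        also have "\<dots> \<le> 1 / real M * B" using km Ab by (intro mult_mono) auto
        finally show ?thesis by simp
      qed
      ultimately show ?thesis unfolding A int\<rho>[OF cm] by (simp add: add_divide_distrib)
    qed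
    have f: "\<bar>(\<Sum>i<k. f (y i)) / real M - (LINT x|\<mu>. f x)\<bar> \<le> \<epsilon>" if f: "f \<in> BL_functions" for f
    proof -
      have fm: "f \<in> borel_measurable borel" using f BL_functions_measurable by blast
      note b = BL_functionsD(1)[OF f] and l = BL_functionsD(2)[OF f]
      have cm: "(\<lambda>x. f (clamp R x)) \<in> borel_measurable borel"
        unfolding clamp_def by (rule measurable_compose[OF _ fm]) measurable
      have ic: "integrable \<mu> (\<lambda>x. f (clamp R x))"
        by (rule integrable_const_bound[of _ 1])
           (use b measurable_submeasure[OF \<mu> cm] in auto)
      have "\<bar>(LINT x|\<mu>. f (clamp R x)) - (LINT x|\<mu>. f x)\<bar> = \<bar>LINT x|\<mu>. f (clamp R x) - f x\<bar>"
        using ic BL_functions_integrable(1)[OF \<mu> f] by simp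
      also have "\<dots> \<le> (LINT x|\<mu>. \<bar>f (clamp R x) - f x\<bar>)" by (rule integral_abs_bound)
      also have "\<dots> \<le> (LINT x|\<mu>. (2 / R\<^sup>2) * x\<^sup>2)"
      proof (rule integral_mono)
        fix x
        show "\<bar>f (clamp R x) - f x\<bar> \<le> 2 / R\<^sup>2 * x\<^sup>2"
        proof (cases "\<bar>x\<bar> \<le> R")
          case True
          then have "clamp R x = x" by (auto simp: clamp_def)
          then show ?thesis by simp
        next
          case False
          then have "R\<^sup>2 \<le> x\<^sup>2" using R1 by (metis abs_le_square_iff abs_of_nonneg \<open>0 \<le> R\<close> linear)
          then have "2 \<le> 2 / R\<^sup>2 * x\<^sup>2" using R1 by (simp add: field_simps)
          then show ?thesis using b[of "clamp R x"] b[of x] by linarith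
        qed
      qed (use ic BL_functions_integrable(1)[OF \<mu> f] int in auto)
      also have "\<dots> = 2 * S / R\<^sup>2" by (simp add: S_def)
      also have "\<dots> \<le> \<epsilon> / 2" by (rule SR)
      finally have 1: "\<bar>(LINT x|\<mu>. f (clamp R x)) - (LINT x|\<mu>. f x)\<bar> \<le> \<epsilon> / 2" .
      have "\<bar>(LINT x|\<mu>. f (clamp R x)) - (\<Sum>i<k. f (y i)) / real M\<bar> \<le> (4 * R * 1 + 1) / real M"
        by (rule avgM) (use l b in auto)
      also have "\<dots> \<le> \<epsilon> / 2"
      proof -
        have "2 * (4 * R + 1) / \<epsilon> \<le> 2 * (9 * R\<^sup>2 + 4 * R + 1) / \<epsilon>" using \<epsilon> by (intro divide_right_mono) auto
        then have "2 * (4 * R + 1) / \<epsilon> \<le> real M" using M1(2) by linarith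
        then show ?thesis using \<epsilon> Mpos by (simp add: field_simps)
      qed
      finally show ?thesis using 1 by linarith
    qed
    have sq: "(\<Sum>i<k. (y i)\<^sup>2) / real M \<le> (LINT x|\<mu>. x\<^sup>2) + \<epsilon>"
    proof -
      define h where "h z = (clamp R z)\<^sup>2" for z
      have cb: "\<bar>clamp R z\<bar> \<le> R" for z using R1 by (auto simp: clamp_def abs_le_iff)
      have cl: "\<bar>clamp R a - clamp R b\<bar> \<le> \<bar>a - b\<bar>" for a b unfolding clamp_def by linarith
      have h: "\<bar>h a - h b\<bar> \<le> 2 * R * \<bar>a - b\<bar>" for a b
      proof -
        have "\<bar>h a - h b\<bar> = \<bar>clamp R a - clamp R b\<bar> * \<bar>clamp R a + clamp R b\<bar>"
          by (simp add: h_def abs_mult[symmetric] power2_eq_square algebra_simps)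
        also have "\<dots> \<le> \<bar>a - b\<bar> * (2 * R)" using cl cb[of a] cb[of b] by (intro mult_mono) auto
        finally show ?thesis by (simp add: mult_ac)
      qed
      have hy: "h (y i) = (y i)\<^sup>2" for i
      proof -
        have "clamp R (y i) = y i" using y(2)[of i] by (auto simp: clamp_def abs_le_iff)
        then show ?thesis by (simp add: h_def)
      qed
      have hb: "\<bar>h z\<bar> \<le> R\<^sup>2" for z using power_mono[OF cb, of z 2] by (simp add: h_def)
      have "\<bar>(LINT x|\<mu>. h (clamp R x)) - (\<Sum>i<k. h (y i)) / real M\<bar> \<le> (4 * R * (2 * R) + R\<^sup>2) / real M"
        by (rule avgM) (use h hb R1 in auto)
      moreover have "(4 * R * (2 * R) + R\<^sup>2) / real M \<le> \<epsilon>"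
      proof -
        have "(9 * R\<^sup>2) / \<epsilon> \<le> 2 * (9 * R\<^sup>2 + 4 * R + 1) / \<epsilon>" using \<epsilon> R1 by (intro divide_right_mono) auto
        then have "(9 * R\<^sup>2) / \<epsilon> \<le> real M" using M1(2) by linarith
        then show ?thesis using \<epsilon> Mpos by (simp add: field_simps power2_eq_square)
      qed
      moreover have "(LINT x|\<mu>. h (clamp R x)) \<le> (LINT x|\<mu>. x\<^sup>2)"
      proof (rule integral_mono)
        have "(\<lambda>x. h (clamp R x)) \<in> borel_measurable borel" unfolding h_def clamp_def by measurable
        then show "integrable \<mu> (\<lambda>x. h (clamp R x))"
          using hb by (intro integrable_const_bound[of _ "R\<^sup>2"] measurable_submeasure[OF \<mu>]) auto
        have "\<bar>clamp R (clamp R x)\<bar> \<le> \<bar>x\<bar>" for x using R1 by (auto simp: clamp_def)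
        then show "h (clamp R x) \<le> x\<^sup>2" for x unfolding h_def using abs_le_square_iff by blast
      qed (rule int)
      ultimately show ?thesis unfolding hy by linarith
    qed
    show "\<exists>y. approximates \<mu> \<epsilon> R M k y"
      unfolding approximates_def using y f sq by blast
  qed
qed

section \<open>Lower bound on the weight\<close>

text \<open>One term of the exponential series; with \<open>x = M\<close> it replaces Stirling's formula.\<close>
lemma power_div_fact_le_exp:
  fixes x :: real assumes "0 \<le> x" shows "x ^ n / fact n \<le> exp x"
proof -
  have s: "(\<lambda>n. x ^ n /\<^sub>R fact n) sums exp x" by (rule exp_converges)
  have "(\<Sum>n\<in>{n}. x ^ n /\<^sub>R fact n) \<le> (\<Sum>n. x ^ n /\<^sub>R fact n)"
    by (rule sum_le_suminf[OF sums_summable[OF s]]) (use assms in auto)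
  then show ?thesis using sums_unique[OF s] by (simp add: divide_inverse mult.commute)
qed

text \<open>Row \<open>j\<close> of the product is \<open>(r/2)^j * fact j / M^j\<close>, and \<open>fact j / M^j \<ge> exp (- M)\<close>. Bounding every gap by
  \<open>1/M\<close> alone would lose \<open>M\<^sup>2 * ln M\<close>, which need not be small compared with \<open>M\<^sup>2 * L\<close>.\<close>
lemma equispaced_vandermonde_ge:
  fixes r :: real
  assumes M: "1 \<le> M" and r: "0 < r" "r \<le> 1"
  shows "exp (- 2 * (real M)\<^sup>2 * (1 + ln (2 / r))) \<le> (\<Prod>j<M. \<Prod>i<j. (r * real (j - i) / (2 * real M))\<^sup>2)"
proof -
  have row: "exp (- real M * (1 + ln (2 / r))) \<le> (\<Prod>i<j. r * real (j - i) / (2 * real M))" if j: "j < M" for j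
  proof -
    have fac: "(\<Prod>i<j. real (j - i)) = fact j"
      using prod.nat_diff_reindex[of "\<lambda>i. real (Suc i)" j] by (simp add: fact_prod_Suc atLeast0LessThan)
    have "(\<Prod>i<j. r * real (j - i) / (2 * real M)) = (\<Prod>i<j. (r / (2 * real M)) * real (j - i))"
      by simp
    also have "\<dots> = (r / (2 * real M)) ^ j * fact j" by (simp only: prod.distrib fac) simp
    also have "\<dots> = (r / 2) ^ j * (fact j / real M ^ j)" by (simp add: power_divide power_mult_distrib)
    finally have eq: "(\<Prod>i<j. r * real (j - i) / (2 * real M)) = (r / 2) ^ j * (fact j / real M ^ j)" .
    have "real M ^ j / fact j \<le> exp (real M)" by (rule power_div_fact_le_exp) simp
    then have f: "exp (- real M) \<le> fact j / real M ^ j"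
      using M by (simp add: exp_minus field_simps)
    have "exp (- real M * ln (2 / r)) = (r / 2) ^ M"
    proof -
      have "- real M * ln (2 / r) = real M * ln (r / 2)" using r by (simp add: ln_div right_diff_distrib)
      then show ?thesis using r by (simp add: exp_of_nat_mult)
    qed
    also have "\<dots> \<le> (r / 2) ^ j" using r j by (intro power_decreasing) auto
    finally have g: "exp (- real M * ln (2 / r)) \<le> (r / 2) ^ j" .
    have "exp (- real M * (1 + ln (2 / r))) = exp (- real M * ln (2 / r)) * exp (- real M)"
      by (simp add: exp_add[symmetric] algebra_simps)
    also have "\<dots> \<le> (r / 2) ^ j * (fact j / real M ^ j)" using r by (intro mult_mono f g) auto
    finally show ?thesis unfolding eq .
  qed
  have "exp (- 2 * (real M)\<^sup>2 * (1 + ln (2 / r))) = (\<Prod>j<M. (exp (- real M * (1 + ln (2 / r))))\<^sup>2)"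
  proof -
    have "(\<Prod>j<M. (exp X)\<^sup>2) = exp (real M * (2 * X))" for X :: real
      by (simp only: exp_of_nat_mult exp_double prod_constant card_lessThan)
    moreover have "real M * (2 * (- real M * (1 + ln (2 / r)))) = - 2 * (real M)\<^sup>2 * (1 + ln (2 / r))"
      by (simp only: power2_eq_square mult_minus_right mult_minus_left mult_ac)
    ultimately show ?thesis by (simp only:)
  qed
  also have "\<dots> \<le> (\<Prod>j<M. (\<Prod>i<j. r * real (j - i) / (2 * real M))\<^sup>2)"
    by (intro prod_mono conjI power_mono row) auto
  finally show ?thesis by (simp add: prod_power_distrib)
qed

text \<open>On a separated configuration in the quadratic regime all estimates of the upper bound can be reversed. Gaps
  between particles in the same well are compared with the equispaced ones; particles in different wells are at
  distance at least one, while the compared equispaced gap is at most one.\<close>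
lemma Q_weight_lower:
  fixes \<Theta> L e r R :: real
  assumes M: "1 \<le> M" "M \<le> N" and \<Theta>: "0 < \<Theta>" "\<Theta> \<le> 1" and L: "L = - 2 * ln \<Theta>"
    and scale: "real N * \<Theta>\<^sup>2 = real M * L"
    and wl: "\<And>s. \<bar>s\<bar> \<le> d \<Longrightarrow> well s \<le> (1 + e) * s\<^sup>2"
    and Rd: "\<Theta> * R \<le> d" "\<Theta> * R \<le> 1/2" and r: "0 < r" "r \<le> 1"
    and xR: "\<And>i. i < M \<Longrightarrow> \<bar>rescaled \<Theta> lam i\<bar> \<le> R"
    and sep: "\<And>i j. i < j \<Longrightarrow> j < M \<Longrightarrow> (0 \<le> lam i \<longleftrightarrow> 0 \<le> lam j) \<Longrightarrow>
       r * real (j - i) / (2 * real M) \<le> \<bar>rescaled \<Theta> lam i - rescaled \<Theta> lam j\<bar>"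
    and J: "J = nonneg_indices M lam"
  shows "exp (- real N * real M * (1 - ln 2) - (1 + e) * real M * L * (\<Sum>i<M. (rescaled \<Theta> lam i)\<^sup>2)
      - L * ((real (card J))\<^sup>2 + (real (card ({..<M} - J)))\<^sup>2) / 2 - 2 * (real M)\<^sup>2 * (2 + ln (2 / r)))
    \<le> Q_weight M N lam"
proof -
  let ?x = "rescaled \<Theta> lam"
  let ?X = "(1 + e) * real M * L * (\<Sum>i<M. (?x i)\<^sup>2)" and ?E = "- real N * real M * (1 - ln 2)"
  let ?P = "\<lambda>i. - real N * (1 - ln 2) - (1 + e) * real M * L * (?x i)\<^sup>2 - 2 * real M"
    and ?W = "\<lambda>i. lam i ^ (2 * (N - M)) * exp (- (real N * (lam i)\<^sup>2 / 2))"
  have t: "\<bar>lam i\<bar> = sqrt 2 + \<Theta> * ?x i" for i using abs_lam_eq \<Theta> by auto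
  have tx: "\<bar>\<Theta> * ?x i\<bar> \<le> \<Theta> * R" if "i < M" for i
    unfolding abs_mult using \<Theta> xR[OF that] by (intro mult_mono) auto
  have tb: "1/2 \<le> \<bar>lam i\<bar>" "\<bar>lam i\<bar> \<le> 2" if "i < M" for i
    unfolding t using tx[OF that] Rd(2) sqrt2_bounds by (linarith, linarith)
  have particle: "exp (?P i)
     \<le> ?W i" if i: "i < M" for i
  proof -
    have pos: "0 < \<bar>lam i\<bar>" using tb[OF i] by linarith
    have "ln \<bar>lam i\<bar> \<le> \<bar>lam i\<bar> - 1" by (rule ln_le_minus_one[OF pos])
    then have l1: "ln \<bar>lam i\<bar> \<le> 1" using tb[OF i] by linarith
    have "\<bar>lam i\<bar> - sqrt 2 = \<Theta> * ?x i" using t[of i] by simp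
    then have "\<bar>lam i\<bar>\<^sup>2 / 2 - 2 * ln \<bar>lam i\<bar> \<le> 1 - ln 2 + (1 + e) * (\<Theta> * ?x i)\<^sup>2"
      using potential_eq_well[OF pos] wl[of "\<Theta> * ?x i"] tx[OF i] Rd(1) by simp
    then have "real N * (\<bar>lam i\<bar>\<^sup>2 / 2 - 2 * ln \<bar>lam i\<bar>) \<le> real N * (1 - ln 2 + (1 + e) * (\<Theta> * ?x i)\<^sup>2)"
      by (intro mult_left_mono) auto
    also have "\<dots> = real N * (1 - ln 2) + (1 + e) * (real N * \<Theta>\<^sup>2) * (?x i)\<^sup>2"
      by (simp add: power_mult_distrib algebra_simps)
    finally have a: "real N * (\<bar>lam i\<bar>\<^sup>2 / 2 - 2 * ln \<bar>lam i\<bar>) \<le> real N * (1 - ln 2) + (1 + e) * real M * L * (?x i)\<^sup>2"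
      unfolding scale by (simp only: mult.assoc)
    have b: "2 * real M * ln \<bar>lam i\<bar> \<le> 2 * real M" using l1 M mult_left_mono[OF l1, of "2 * real M"] by simp
    have "lam i ^ (2 * (N - M)) = \<bar>lam i\<bar> ^ (2 * (N - M))" by (simp add: power_mult)
    also have "\<dots> = exp (2 * real (N - M) * ln \<bar>lam i\<bar>)"
      using pos exp_of_nat_mult[of "2 * (N - M)" "ln \<bar>lam i\<bar>"] by simp
    finally have "?W i =
       exp (2 * real (N - M) * ln \<bar>lam i\<bar> + - (real N * (lam i)\<^sup>2 / 2))" by (simp only: exp_add)
    also have "2 * real (N - M) * ln \<bar>lam i\<bar> + - (real N * (lam i)\<^sup>2 / 2)
      = - (real N * (\<bar>lam i\<bar>\<^sup>2 / 2 - 2 * ln \<bar>lam i\<bar>)) - 2 * real M * ln \<bar>lam i\<bar>"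
      using M by (simp add: of_nat_diff algebra_simps)
    finally have eq: "?W i =
       exp (- (real N * (\<bar>lam i\<bar>\<^sup>2 / 2 - 2 * ln \<bar>lam i\<bar>)) - 2 * real M * ln \<bar>lam i\<bar>)" .
    show ?thesis unfolding eq exp_le_cancel_iff using a b by linarith
  qed
  have pair: "exp (2 * ln \<Theta> * of_bool (i \<in> J \<longleftrightarrow> j \<in> J)) * (r * real (j - i) / (2 * real M))\<^sup>2 \<le> \<bar>lam i - lam j\<bar> ^ 2"
    if ij: "i < j" "j < M" for i j
  proof -
    have s: "(i \<in> J \<longleftrightarrow> j \<in> J) \<longleftrightarrow> (0 \<le> lam i \<longleftrightarrow> 0 \<le> lam j)" using ij by (auto simp: J nonneg_indices_def)
    have g0: "0 \<le> r * real (j - i) / (2 * real M)" using r by simp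
    have g1: "r * real (j - i) / (2 * real M) \<le> 1"
    proof -
      have "r * real (j - i) \<le> 1 * real M" using r ij by (intro mult_mono) auto
      then show ?thesis using M by (simp add: divide_le_eq)
    qed
    have "exp (ln \<Theta> * of_bool (i \<in> J \<longleftrightarrow> j \<in> J)) * (r * real (j - i) / (2 * real M)) \<le> \<bar>lam i - lam j\<bar>"
    proof (cases "0 \<le> lam i \<longleftrightarrow> 0 \<le> lam j")
      case True
      then have "\<bar>lam i - lam j\<bar> = \<bar>\<bar>lam i\<bar> - \<bar>lam j\<bar>\<bar>" by auto
      also have "\<dots> = \<Theta> * \<bar>?x i - ?x j\<bar>" unfolding t using \<Theta> by (simp add: right_diff_distrib[symmetric] abs_mult)
      also have "\<dots> \<ge> \<Theta> * (r * real (j - i) / (2 * real M))" using sep[OF ij True] \<Theta> by (intro mult_left_mono) auto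
      finally show ?thesis unfolding s using True \<Theta> by simp
    next
      case False
      then have "\<bar>lam i - lam j\<bar> = \<bar>lam i\<bar> + \<bar>lam j\<bar>" by auto
      also have "\<dots> \<ge> 1" using tb(1)[of i] tb(1)[of j] ij by linarith
      finally have "1 \<le> \<bar>lam i - lam j\<bar>" .
      then show ?thesis unfolding s using False g1 by simp
    qed
    then have "(exp (ln \<Theta> * of_bool (i \<in> J \<longleftrightarrow> j \<in> J)) * (r * real (j - i) / (2 * real M)))\<^sup>2 \<le> \<bar>lam i - lam j\<bar>\<^sup>2"
      by (intro power_mono mult_nonneg_nonneg g0) auto
    moreover have "(exp (ln \<Theta> * of_bool (i \<in> J \<longleftrightarrow> j \<in> J)))\<^sup>2 = exp (2 * ln \<Theta> * of_bool (i \<in> J \<longleftrightarrow> j \<in> J))"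
      by (simp add: exp_double[symmetric] mult_ac)
    ultimately show ?thesis by (simp only: power_mult_distrib)
  qed
  define a where "a = real (card J)"
  define b where "b = real (card ({..<M} - J))"
  have JM: "J \<subseteq> {..<M}" unfolding J by (rule nonneg_indices_subset)
  have lnT: "ln \<Theta> = - (L / 2)" using L by simp
  have lnT0: "ln \<Theta> \<le> 0" using \<Theta> by simp
  have vand: "exp (- L * (a\<^sup>2 + b\<^sup>2) / 2 - 2 * (real M)\<^sup>2 * (1 + ln (2 / r))) \<le> (\<Prod>j<M. \<Prod>i<j. \<bar>lam i - lam j\<bar> ^ 2)"
  proof -
    have "- L * (a\<^sup>2 + b\<^sup>2) / 2 = ln \<Theta> * (a\<^sup>2 + b\<^sup>2)" unfolding lnT by simp
    also have "\<dots> \<le> ln \<Theta> * (a\<^sup>2 + b\<^sup>2 - real M)" using lnT0 by (intro mult_left_mono_neg) auto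
    also have "\<dots> = 2 * ln \<Theta> * (\<Sum>j<M. \<Sum>i<j. of_bool (i \<in> J \<longleftrightarrow> j \<in> J))"
      unfolding sum_same_part[OF JM] a_def b_def by simp
    finally have "exp (- L * (a\<^sup>2 + b\<^sup>2) / 2) \<le> exp (2 * ln \<Theta> * (\<Sum>j<M. \<Sum>i<j. of_bool (i \<in> J \<longleftrightarrow> j \<in> J)))" by simp
    also have "\<dots> = (\<Prod>j<M. \<Prod>i<j. exp (2 * ln \<Theta> * of_bool (i \<in> J \<longleftrightarrow> j \<in> J)))"
      by (simp only: sum_distrib_left exp_sum[OF finite_lessThan])
    finally have 1: "exp (- L * (a\<^sup>2 + b\<^sup>2) / 2) \<le> (\<Prod>j<M. \<Prod>i<j. exp (2 * ln \<Theta> * of_bool (i \<in> J \<longleftrightarrow> j \<in> J)))" .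
    have "exp (- L * (a\<^sup>2 + b\<^sup>2) / 2 - 2 * (real M)\<^sup>2 * (1 + ln (2 / r)))
      = exp (- L * (a\<^sup>2 + b\<^sup>2) / 2) * exp (- 2 * (real M)\<^sup>2 * (1 + ln (2 / r)))"
      by (simp add: exp_add[symmetric])
    also have "\<dots> \<le> (\<Prod>j<M. \<Prod>i<j. exp (2 * ln \<Theta> * of_bool (i \<in> J \<longleftrightarrow> j \<in> J))) * (\<Prod>j<M. \<Prod>i<j. (r * real (j - i) / (2 * real M))\<^sup>2)"
      by (intro mult_mono 1 equispaced_vandermonde_ge[OF M(1) r] prod_nonneg) auto
    also have "\<dots> = (\<Prod>j<M. \<Prod>i<j. exp (2 * ln \<Theta> * of_bool (i \<in> J \<longleftrightarrow> j \<in> J)) * (r * real (j - i) / (2 * real M))\<^sup>2)"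
      by (simp only: prod.distrib)
    also have "\<dots> \<le> (\<Prod>j<M. \<Prod>i<j. \<bar>lam i - lam j\<bar> ^ 2)"
      by (intro prod_mono conjI prod_nonneg ballI pair) auto
    finally show ?thesis .
  qed
  have "exp (?E - ?X
      - L * (a\<^sup>2 + b\<^sup>2) / 2 - 2 * (real M)\<^sup>2 * (2 + ln (2 / r)))
    = exp ((\<Sum>i<M. ?P i)
      + (- L * (a\<^sup>2 + b\<^sup>2) / 2 - 2 * (real M)\<^sup>2 * (1 + ln (2 / r))))"
  proof (intro arg_cong[of _ _ exp])
    have "(\<Sum>i<M. ?P i)
      = real M * (- real N * (1 - ln 2)) - ?X - real M * (2 * real M)"
      unfolding sum_subtractf unfolding sum_distrib_left[symmetric] sum_constant card_lessThan by simp
    also have "\<dots> = ?E - ?X - 2 * (real M)\<^sup>2"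
      by (simp add: power2_eq_square right_diff_distrib)
    finally have S: "(\<Sum>i<M. ?P i)
      = ?E - ?X - 2 * (real M)\<^sup>2" .
    have "2 * (real M)\<^sup>2 * (2 + ln (2 / r)) = 2 * (real M)\<^sup>2 + 2 * (real M)\<^sup>2 * (1 + ln (2 / r))"
      by (simp add: distrib_left)
    then show "?E - ?X
        - L * (a\<^sup>2 + b\<^sup>2) / 2 - 2 * (real M)\<^sup>2 * (2 + ln (2 / r))
      = (\<Sum>i<M. ?P i)
        + (- L * (a\<^sup>2 + b\<^sup>2) / 2 - 2 * (real M)\<^sup>2 * (1 + ln (2 / r)))"
      unfolding S by linarith
  qed
  also have "\<dots> = (\<Prod>i<M. exp (?P i))
     * exp (- L * (a\<^sup>2 + b\<^sup>2) / 2 - 2 * (real M)\<^sup>2 * (1 + ln (2 / r)))"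
    by (simp only: exp_add exp_sum[OF finite_lessThan])
  also have "\<dots> \<le> (\<Prod>i<M. ?W i) * (\<Prod>j<M. \<Prod>i<j. \<bar>lam i - lam j\<bar> ^ 2)"
  proof (rule mult_mono[OF prod_mono vand])
    show "0 \<le> exp (?P i) \<and>
      exp (?P i)
        \<le> ?W i" if "i \<in> {..<M}" for i
      using particle[of i] that by auto
  qed (auto intro!: prod_nonneg simp: power_mult)
  also have "\<dots> = Q_weight M N lam" by (simp add: Q_weight_def prod.distrib)
  finally show ?thesis unfolding a_def b_def .
qed

section \<open>Integrating over boxes\<close>

lemma nn_integral_box_ge:
  assumes w: "0 \<le> w" and c: "\<And>lam. (\<forall>i<M. a i \<le> lam i \<and> lam i \<le> a i + w) \<Longrightarrow> lam \<in> space (lborel_vec M) \<Longrightarrow> ennreal c \<le> f lam"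
    and c0: "0 \<le> c"
  shows "ennreal (c * w ^ M) \<le> (\<integral>\<^sup>+ lam. f lam \<partial>lborel_vec M)"
proof -
  let ?B = "\<Pi>\<^sub>E i\<in>{..<M}. {a i..a i + w}"
  have B: "?B \<in> sets (lborel_vec M)" unfolding lborel_vec_def by (intro sets_PiM_I_finite) auto
  have "emeasure (lborel_vec M) ?B = (\<Prod>i<M. emeasure lborel {a i..a i + w})"
    unfolding lborel_vec_def by (rule lborel_product.emeasure_PiM) auto
  also have "\<dots> = ennreal (w ^ M)" using w by (simp add: ennreal_power)
  finally have "ennreal (c * w ^ M) = ennreal c * emeasure (lborel_vec M) ?B" using w c0 by (simp add: ennreal_mult)
  also have "\<dots> = (\<integral>\<^sup>+ lam. ennreal c * indicator ?B lam \<partial>lborel_vec M)"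
    by (rule nn_integral_cmult_indicator[OF B, symmetric])
  also have "\<dots> \<le> (\<integral>\<^sup>+ lam. f lam \<partial>lborel_vec M)"
  proof (rule nn_integral_mono)
    fix lam assume s: "lam \<in> space (lborel_vec M)"
    show "ennreal c * indicator ?B lam \<le> f lam"
    proof (cases "lam \<in> ?B")
      case True
      then have "\<forall>i<M. a i \<le> lam i \<and> lam i \<le> a i + w" by (auto simp: PiE_def Pi_def)
      then show ?thesis using c[OF _ s] True by simp
    qed simp
  qed
  finally show ?thesis .
qed

text \<open>On the box \<open>2 i + 1 \<le> lam i \<le> 2 i + 2\<close> all particles and all gaps are at least one.\<close>
lemma nn_integral_Q_weight_pos:
  shows "0 < (\<integral>\<^sup>+ lam. ennreal (Q_weight M N lam) \<partial>lborel_vec M)"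
proof -
  let ?c = "\<Prod>i<M. exp (- (real N * (2 * real M + 2)\<^sup>2 / 2))"
  have "ennreal (?c * 1 ^ M) \<le> (\<integral>\<^sup>+ lam. ennreal (Q_weight M N lam) \<partial>lborel_vec M)"
  proof (rule nn_integral_box_ge[where a = "\<lambda>i. 2 * real i + 1"])
    fix lam :: "nat \<Rightarrow> real"
    assume l: "\<forall>i<M. 2 * real i + 1 \<le> lam i \<and> lam i \<le> 2 * real i + 1 + 1"
    have 1: "1 \<le> (\<Prod>i<M. lam i ^ (2 * (N - M)))" using l by (intro prod_ge_1 one_le_power) force
    have 2: "1 \<le> (\<Prod>j<M. \<Prod>i<j. \<bar>lam i - lam j\<bar> ^ 2)"
    proof (intro prod_ge_1 one_le_power)
      fix i j assume ij: "j \<in> {..<M}" "i \<in> {..<j}"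
      then have "real i + 1 \<le> real j" by simp
      moreover have "lam i \<le> 2 * real i + 2" using l[rule_format, of i] ij by simp
      moreover have "2 * real j + 1 \<le> lam j" using l[rule_format, of j] ij by simp
      ultimately show "1 \<le> \<bar>lam i - lam j\<bar>" by linarith
    qed
    have 3: "?c \<le> (\<Prod>i<M. exp (- (real N * (lam i)\<^sup>2 / 2)))"
    proof (intro prod_mono conjI)
      fix i assume i: "i \<in> {..<M}"
      then have "0 \<le> lam i" "lam i \<le> 2 * real M + 2" using l[rule_format, of i] by simp_all
      then have "(lam i)\<^sup>2 \<le> (2 * real M + 2)\<^sup>2" by (intro power_mono) auto
      then show "exp (- (real N * (2 * real M + 2)\<^sup>2 / 2)) \<le> exp (- (real N * (lam i)\<^sup>2 / 2))"
        by (simp add: mult_left_mono)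
    qed auto
    have "1 * 1 * ?c \<le> Q_weight M N lam" unfolding Q_weight_def
      using 1 2 3 by (intro mult_mono) (auto intro!: prod_nonneg mult_nonneg_nonneg simp: power_mult)
    then show "ennreal ?c \<le> ennreal (Q_weight M N lam)" by (intro ennreal_leI) simp
  qed (auto intro!: prod_nonneg)
  moreover have "0 < ennreal (?c * 1 ^ M)" by (simp add: prod_pos)
  ultimately show ?thesis by (rule less_le_trans[rotated])
qed

text \<open>Polynomial growth against a Gaussian, valid for every \<open>N \<ge> 1\<close> rather than only in the limit.\<close>
lemma nn_integral_Q_weight_finite:
  assumes "1 \<le> N"
  shows "(\<integral>\<^sup>+ lam. ennreal (Q_weight M N lam) \<partial>lborel_vec M) < \<infinity>"
proof -
  define p where "p = 2 * (N - M) + 4 * M"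
  define C where "C = fact p * exp (2::real)"
  have C0: "0 \<le> C" by (simp add: C_def)
  let ?g = "\<lambda>t :: real. C * exp (- (1/4) * (t - 0)\<^sup>2)"
  have one: "(1 + \<bar>t\<bar>) ^ p * exp (- (real N * t\<^sup>2 / 2)) \<le> ?g t" for t
  proof -
    have "(1 + \<bar>t\<bar>) ^ p \<le> fact p * exp (1 + \<bar>t\<bar>)"
      using power_div_fact_le_exp[of "1 + \<bar>t\<bar>" p] by (simp add: divide_le_eq mult.commute)
    moreover have "1 * t\<^sup>2 \<le> real N * t\<^sup>2" using assms by (intro mult_right_mono) auto
    then have "exp (- (real N * t\<^sup>2 / 2)) \<le> exp (- (t\<^sup>2 / 2))" by simp
    ultimately have "(1 + \<bar>t\<bar>) ^ p * exp (- (real N * t\<^sup>2 / 2)) \<le> (fact p * exp (1 + \<bar>t\<bar>)) * exp (- (t\<^sup>2 / 2))"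
      by (intro mult_mono) auto
    also have "\<dots> = fact p * exp (1 + \<bar>t\<bar> + - (t\<^sup>2 / 2))" by (simp only: exp_add mult.assoc)
    also have "\<dots> \<le> fact p * exp (2 + (- (1/4) * (t - 0)\<^sup>2))"
    proof (intro mult_left_mono exp_le_cancel_iff[THEN iffD2])
      have "0 \<le> (\<bar>t\<bar> / 2 - 1)\<^sup>2" by simp
      also have "(\<bar>t\<bar> / 2 - 1)\<^sup>2 = t\<^sup>2 / 4 - \<bar>t\<bar> + 1" by (simp add: power2_eq_square field_simps)
      finally show "1 + \<bar>t\<bar> + - (t\<^sup>2 / 2) \<le> 2 + (- (1/4) * (t - 0)\<^sup>2)" by simp
    qed simp
    finally show ?thesis by (simp only: exp_add C_def mult.assoc)
  qed
  have "Q_weight M N lam \<le> (\<Prod>i<M. ?g (lam i))" for lam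
  proof -
    let ?u = "\<lambda>i. 1 + \<bar>lam i\<bar>"
    have v: "(\<Prod>j<M. \<Prod>i<j. \<bar>lam i - lam j\<bar> ^ 2) \<le> (\<Prod>i<M. ?u i ^ (4 * M))"
    proof -
      have "(\<Prod>j<M. \<Prod>i<j. \<bar>lam i - lam j\<bar> ^ 2) \<le> (\<Prod>j<M. \<Prod>i<M. (?u i * ?u j)\<^sup>2)"
      proof (intro prod_mono conjI prod_nonneg ballI)
        fix j assume j: "j \<in> {..<M}"
        have u1: "1 \<le> ?u i * ?u j" for i using mult_mono[of 1 "?u i" 1 "?u j"] by simp
        have "(\<Prod>i<j. \<bar>lam i - lam j\<bar> ^ 2) \<le> (\<Prod>i<j. (?u i * ?u j)\<^sup>2)"
        proof (intro prod_mono conjI power_mono)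
          fix i
          have "\<bar>lam i - lam j\<bar> \<le> \<bar>lam i\<bar> + \<bar>lam j\<bar>" by linarith
          moreover have "0 \<le> \<bar>lam i\<bar> * \<bar>lam j\<bar>" by simp
          moreover have "?u i * ?u j = 1 + \<bar>lam i\<bar> + \<bar>lam j\<bar> + \<bar>lam i\<bar> * \<bar>lam j\<bar>" by (simp add: algebra_simps)
          ultimately show "\<bar>lam i - lam j\<bar> \<le> ?u i * ?u j" by linarith
        qed auto
        also have "\<dots> \<le> (\<Prod>i<M. (?u i * ?u j)\<^sup>2)"
          using j u1 by (intro prod_mono2) (auto intro!: one_le_power)
        finally show "(\<Prod>i<j. \<bar>lam i - lam j\<bar> ^ 2) \<le> (\<Prod>i<M. (?u i * ?u j)\<^sup>2)" .
      qed auto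
      also have "\<dots> = (\<Prod>j<M. (\<Prod>i<M. ?u i)\<^sup>2 * (?u j)\<^sup>2 ^ M)"
        by (simp add: power_mult_distrib prod.distrib prod_power_distrib)
      also have "\<dots> = (\<Prod>i<M. ?u i)\<^sup>2 ^ M * (\<Prod>j<M. ?u j)\<^sup>2 ^ M"
        by (simp add: prod.distrib prod_power_distrib)
      also have "\<dots> = (\<Prod>i<M. ?u i ^ (4 * M))"
        by (simp add: prod_power_distrib[symmetric] power_mult[symmetric] power_add[symmetric])
      finally show ?thesis .
    qed
    have "Q_weight M N lam \<le> (\<Prod>i<M. ?u i ^ (2 * (N - M))) * (\<Prod>i<M. ?u i ^ (4 * M)) * (\<Prod>i<M. exp (- (real N * (lam i)\<^sup>2 / 2)))"
      unfolding Q_weight_def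
    proof (intro mult_mono v prod_mono conjI)
      fix i show "lam i ^ (2 * (N - M)) \<le> ?u i ^ (2 * (N - M))"
        using power_mono[of "\<bar>lam i\<bar>" "?u i" "2 * (N - M)"] by (simp add: power_mult)
    qed (auto intro!: prod_nonneg mult_nonneg_nonneg simp: power_mult)
    also have "\<dots> = (\<Prod>i<M. ?u i ^ p * exp (- (real N * (lam i)\<^sup>2 / 2)))"
      by (simp add: prod.distrib power_add p_def)
    also have "\<dots> \<le> (\<Prod>i<M. ?g (lam i))" by (intro prod_mono conjI one) auto
    finally show ?thesis .
  qed
  then have "(\<integral>\<^sup>+ lam. ennreal (Q_weight M N lam) \<partial>lborel_vec M) \<le> (\<integral>\<^sup>+ lam. (\<Prod>i<M. ennreal (?g (lam i))) \<partial>lborel_vec M)"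
    using C0 by (intro nn_integral_mono) (simp add: prod_ennreal ennreal_leI)
  also have "\<dots> = (\<integral>\<^sup>+ t. ennreal (?g t) \<partial>lborel) ^ M" by (rule nn_integral_lborel_vec_prod) measurable
  also have "(\<integral>\<^sup>+ t. ennreal (?g t) \<partial>lborel) = ennreal C * (\<integral>\<^sup>+ t. ennreal (exp (- (1/4) * (t - 0)\<^sup>2)) \<partial>lborel)"
    using C0 by (subst nn_integral_cmult[symmetric]) (auto simp: ennreal_mult)
  also have "\<dots> = ennreal C * ennreal (sqrt (pi / (1/4)))" by (subst nn_integral_gaussian) auto
  also have "\<dots> ^ M < \<infinity>" by (simp add: ennreal_mult[symmetric] C0 ennreal_power)
  finally show ?thesis .
qed

text \<open>The density is integrated over the box in which the particle \<open>i\<close> has rescaled position between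
  \<open>y i + r * i / M\<close> and \<open>y i + r * i / M + r / (2 * M)\<close>; the first \<open>k\<close> particles are in the right well. The drift
  exceeds the width of the box by a factor of two, so that consecutive particles in one well stay apart, while
  no particle is further than \<open>2 * r\<close> from \<open>y i\<close>. The volume of the box contributes \<open>\<Theta>^M\<close>, that is
  \<open>exp (- M * L / 2)\<close>, and terms of order \<open>M * ln M\<close>.\<close>
lemma Q_weight_integral_lower:
  fixes y :: "nat \<Rightarrow> real" and \<Theta> L e r R :: real
  assumes M: "1 \<le> M" "M \<le> N" and k: "k \<le> M" and \<Theta>: "0 < \<Theta>" "\<Theta> \<le> 1" and L: "L = - 2 * ln \<Theta>"
    and scale: "real N * \<Theta>\<^sup>2 = real M * L" and e: "0 \<le> e"
    and wl: "\<And>s. \<bar>s\<bar> \<le> d \<Longrightarrow> well s \<le> (1 + e) * s\<^sup>2"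
    and Rd: "\<Theta> * (R + 2) \<le> d" "\<Theta> * (R + 2) \<le> 1/2" and r: "0 < r" "r \<le> 1"
    and yR: "\<And>i. \<bar>y i\<bar> \<le> R"
    and mono: "\<And>i j. i \<le> j \<Longrightarrow> (i < k \<longleftrightarrow> j < k) \<Longrightarrow> y i \<le> y j"
    and S: "\<And>lam. lam \<in> space (lborel_vec M) \<Longrightarrow> nonneg_indices M lam = {..<k} \<Longrightarrow>
       (\<And>i. i < M \<Longrightarrow> \<bar>rescaled \<Theta> lam i - y i\<bar> \<le> 2 * r) \<Longrightarrow> lam \<in> S"
  shows "ennreal (exp (- real N * real M * (1 - ln 2)
      - ((1 + e) * real M * L * ((\<Sum>i<M. (y i)\<^sup>2) + real M * (4 * r * R + 4 * r\<^sup>2))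
        + L * ((real k)\<^sup>2 + (real (M - k))\<^sup>2) / 2 + real M * L / 2 + (real M)\<^sup>2 * (5 + 3 * ln (2 / r)))))
    \<le> (\<integral>\<^sup>+ lam. ennreal (Q_weight M N lam) * indicator S lam \<partial>lborel_vec M)"
proof -
  let ?E = "- real N * real M * (1 - ln 2)" and ?Y = "(1 + e) * real M * L * ((\<Sum>i<M. (y i)\<^sup>2) + real M * (4 * r * R + 4 * r\<^sup>2))"
    and ?K = "L * ((real k)\<^sup>2 + (real (M - k))\<^sup>2) / 2" and ?KJ = "L * ((real (card {..<k}))\<^sup>2 + (real (card ({..<M} - {..<k})))\<^sup>2) / 2"
  define w where "w = r / (2 * real M)"
  define b where "b i = y i + r * real i / real M" for i
  \<comment> \<open>left end of the interval for \<open>lam i\<close>; in the left well the orientation is reversed\<close>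
  define a where "a i = (if i < k then sqrt 2 + \<Theta> * b i else - (sqrt 2 + \<Theta> * (b i + w)))" for i
  have w: "0 < w" "w \<le> r / 2"
    unfolding w_def using r M by (auto simp: field_simps mult_left_le)
  have L0: "0 \<le> L" using L \<Theta> by simp
  have lr: "0 \<le> ln (2 / r)" using r by simp
  let ?c = "exp (?E - ?Y - ?K - 2 * (real M)\<^sup>2 * (2 + ln (2 / r)))"
  have "ennreal (?c * (\<Theta> * w) ^ M) \<le> (\<integral>\<^sup>+ lam. ennreal (Q_weight M N lam) * indicator S lam \<partial>lborel_vec M)"
  proof (rule nn_integral_box_ge[where a = a])
    fix lam assume box: "\<forall>i<M. a i \<le> lam i \<and> lam i \<le> a i + \<Theta> * w" and sp: "lam \<in> space (lborel_vec M)"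
    let ?x = "rescaled \<Theta> lam"
    have bb: "0 \<le> b i - y i" "b i - y i \<le> r" if "i < M" for i
    proof -
      have "r * real i \<le> r * real M" using r that by (intro mult_left_mono) auto
      then show "0 \<le> b i - y i" "b i - y i \<le> r" using r M by (auto simp: b_def divide_le_eq)
    qed
    have key: "(0 \<le> lam i \<longleftrightarrow> i < k) \<and> b i \<le> ?x i \<and> ?x i \<le> b i + w" if i: "i < M" for i
    proof -
      have "- (R + 2) \<le> b i" "b i + w \<le> R + 2" using bb[OF i] yR[of i] w r by (auto simp: abs_le_iff)
      then have "\<Theta> * (- (R + 2)) \<le> \<Theta> * b i" "\<Theta> * b i \<le> \<Theta> * (b i + w)" using \<Theta> w by (auto intro!: mult_left_mono)
      moreover have "\<Theta> * (- (R + 2)) = - (\<Theta> * (R + 2))" by (simp only: mult_minus_right)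
      ultimately have low: "1/2 \<le> sqrt 2 + \<Theta> * b i" "1/2 \<le> sqrt 2 + \<Theta> * (b i + w)"
        using Rd(2) sqrt2_bounds(1) by linarith+
      have bx: "a i \<le> lam i" "lam i \<le> a i + \<Theta> * w" using box i by auto
      have wd: "\<Theta> * (b i + w) = \<Theta> * b i + \<Theta> * w" by (rule distrib_left)
      have "(0 \<le> lam i \<longleftrightarrow> i < k) \<and> sqrt 2 + \<Theta> * b i \<le> \<bar>lam i\<bar> \<and> \<bar>lam i\<bar> \<le> sqrt 2 + \<Theta> * (b i + w)"
      proof (cases "i < k")
        case True
        then have "a i = sqrt 2 + \<Theta> * b i" by (simp add: a_def)
        then have "sqrt 2 + \<Theta> * b i \<le> lam i" "lam i \<le> sqrt 2 + \<Theta> * (b i + w)" using bx wd by linarith+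
        moreover have "0 \<le> lam i" using calculation low by linarith
        ultimately show ?thesis using True by simp
      next
        case False
        then have "a i = - (sqrt 2 + \<Theta> * (b i + w))" by (simp add: a_def)
        then have "sqrt 2 + \<Theta> * b i \<le> - lam i" "- lam i \<le> sqrt 2 + \<Theta> * (b i + w)" using bx wd by linarith+
        moreover have "lam i < 0" using calculation low by linarith
        ultimately show ?thesis using False by simp
      qed
      then have sgn: "0 \<le> lam i \<longleftrightarrow> i < k"
        and "sqrt 2 + \<Theta> * b i \<le> \<bar>lam i\<bar> \<and> \<bar>lam i\<bar> \<le> sqrt 2 + \<Theta> * (b i + w)" by blast+
      then have "\<Theta> * b i \<le> \<Theta> * ?x i" "\<Theta> * ?x i \<le> \<Theta> * (b i + w)"
        using abs_lam_eq[of \<Theta> lam i] \<Theta> by auto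
      then show ?thesis using sgn \<Theta> by simp
    qed
    have near: "\<bar>?x i - y i\<bar> \<le> 2 * r" if i: "i < M" for i
      using key[OF i] bb[OF i] w r by (auto simp: abs_le_iff)
    have J: "nonneg_indices M lam = {..<k}" using key k by (auto simp: nonneg_indices_def)
    have inS: "lam \<in> S" by (rule S[OF sp J near])
    have "exp (?E - (1 + e) * real M * L * (\<Sum>i<M. (?x i)\<^sup>2)
      - ?KJ - 2 * (real M)\<^sup>2 * (2 + ln (2 / r)))
      \<le> Q_weight M N lam"
    proof (rule Q_weight_lower[OF M \<Theta> L scale wl Rd r _ _ J[symmetric]])
      show "\<bar>?x i\<bar> \<le> R + 2" if "i < M" for i using near[OF that] yR[of i] r by (auto simp: abs_le_iff)
      fix i j assume ij: "i < j" "j < M" and same: "0 \<le> lam i \<longleftrightarrow> 0 \<le> lam j"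
      have "i < k \<longleftrightarrow> j < k" using key[of i] key[of j] same ij by auto
      then have "y i \<le> y j" using mono[of i j] ij by auto
      moreover have "r * real j / real M - r * real i / real M = 2 * (r * real (j - i) / (2 * real M))"
        using ij M by (simp add: of_nat_diff field_simps)
      moreover have "w \<le> r * real (j - i) / (2 * real M)"
      proof -
        have "r * 1 \<le> r * real (j - i)" using ij r by (intro mult_left_mono) auto
        then show ?thesis unfolding w_def by (intro divide_right_mono) auto
      qed
      moreover have "b j \<le> ?x j" "?x i \<le> b i + w" using key[of i] key[of j] ij by auto
      ultimately show "r * real (j - i) / (2 * real M) \<le> \<bar>?x i - ?x j\<bar>" unfolding b_def by linarith
    qed
    moreover have "?c \<le> exp (?E - (1 + e) * real M * L * (\<Sum>i<M. (?x i)\<^sup>2)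
      - ?KJ - 2 * (real M)\<^sup>2 * (2 + ln (2 / r)))"
    proof -
      have "(?x i)\<^sup>2 \<le> (y i)\<^sup>2 + (4 * r * R + 4 * r\<^sup>2)" if "i < M" for i
      proof -
        have "(?x i)\<^sup>2 \<le> (\<bar>y i\<bar> + 2 * r)\<^sup>2"
          using near[OF that] by (intro power2_le_iff_abs_le[THEN iffD2]) (use r in \<open>auto simp: abs_le_iff\<close>)
        also have "\<dots> = (y i)\<^sup>2 + 4 * r * \<bar>y i\<bar> + 4 * r\<^sup>2" by (simp add: power2_eq_square algebra_simps)
        also have "\<dots> \<le> (y i)\<^sup>2 + 4 * r * R + 4 * r\<^sup>2" using yR[of i] r by (intro add_mono mult_left_mono) auto
        finally show ?thesis by simp
      qed
      then have "(\<Sum>i<M. (?x i)\<^sup>2) \<le> (\<Sum>i<M. (y i)\<^sup>2 + (4 * r * R + 4 * r\<^sup>2))" by (intro sum_mono) auto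
      also have "\<dots> = (\<Sum>i<M. (y i)\<^sup>2) + real M * (4 * r * R + 4 * r\<^sup>2)" by (simp add: sum.distrib)
      finally have "(1 + e) * real M * L * (\<Sum>i<M. (?x i)\<^sup>2)
        \<le> ?Y"
        using e L0 by (intro mult_left_mono) auto
      moreover have "card ({..<M} - {..<k}) = M - k" using k by (subst card_Diff_subset) auto
      ultimately show ?thesis by simp
    qed
    ultimately have "?c \<le> Q_weight M N lam" by (rule order_trans[rotated])
    then show "ennreal ?c \<le> ennreal (Q_weight M N lam) * indicator S lam"
      using inS by (simp only: indicator_simps mult_1_right ennreal_leI)
  qed (use \<Theta> w in auto)
  moreover have "exp (?E - (?Y + ?K + real M * L / 2 + (real M)\<^sup>2 * (5 + 3 * ln (2 / r)))) \<le> ?c * (\<Theta> * w) ^ M"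
  proof -
    have lw: "ln (\<Theta> * w) = - L / 2 - ln (2 / r) - ln (real M)"
    proof -
      have "ln (\<Theta> * w) = ln \<Theta> + ln w" using \<Theta> w by (intro ln_mult_pos) auto
      moreover have "ln w = ln r - ln (2 * real M)" unfolding w_def using r M by (intro ln_divide_pos) auto
      moreover have "ln (2 * real M) = ln 2 + ln (real M)" using M by (intro ln_mult_pos) auto
      moreover have "ln (2 / r) = ln 2 - ln r" using r by (intro ln_divide_pos) auto
      ultimately show ?thesis using L by simp
    qed
    have vol: "(\<Theta> * w) ^ M = exp (real M * (- L / 2 - ln (2 / r) - ln (real M)))"
      unfolding lw[symmetric] exp_of_nat_mult using \<Theta> w by (subst exp_ln) auto
    have M1: "real M \<le> (real M)\<^sup>2" using M by (simp add: power2_eq_square)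
    have "ln (real M) \<le> real M - 1" using M by (intro ln_le_minus_one) simp
    then have "real M * ln (real M) \<le> real M * real M" by (intro mult_left_mono) auto
    moreover have "real M * ln (2 / r) \<le> (real M)\<^sup>2 * ln (2 / r)" using M1 lr by (rule mult_right_mono)
    ultimately have "- real M * L / 2 - (real M)\<^sup>2 * (1 + ln (2 / r)) \<le> real M * (- L / 2 - ln (2 / r) - ln (real M))"
      by (simp add: algebra_simps power2_eq_square)
    moreover have "(real M)\<^sup>2 * (5 + 3 * ln (2 / r)) = (real M)\<^sup>2 * (1 + ln (2 / r)) + 2 * (real M)\<^sup>2 * (2 + ln (2 / r))"
      by (simp add: algebra_simps)
    ultimately show ?thesis unfolding vol exp_add[symmetric] exp_le_cancel_iff by linarith
  qed
  ultimately show ?thesis using order_trans[OF ennreal_leI] by blast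
qed

lemma pair_topology_neighbourhood:
  assumes G: "openin pair_topology G" and p: "p \<in> G"
  obtains \<delta> where "0 < \<delta>"
    "\<And>q. q \<in> mass_one_pairs \<Longrightarrow> dBL (fst p) (fst q) < \<delta> \<Longrightarrow> dBL (snd p) (snd q) < \<delta> \<Longrightarrow> q \<in> G"
proof -
  obtain T where T: "openin (prod_topology submeasure_topology submeasure_topology) T" "G = T \<inter> mass_one_pairs"
    using G unfolding pair_topology_def openin_subtopology by blast
  have "(fst p, snd p) \<in> T" using p T by simp
  then obtain U V where UV: "openin submeasure_topology U" "openin submeasure_topology V" "fst p \<in> U" "snd p \<in> V" "U \<times> V \<subseteq> T"
    using T(1) unfolding openin_prod_topology_alt by meson
  have ball: "\<exists>d>0. \<forall>\<nu>\<in>submeasures. dBL \<mu> \<nu> < d \<longrightarrow> \<nu> \<in> W" if W: "openin submeasure_topology W" "\<mu> \<in> W" for \<mu> W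
  proof -
    have "\<mu> \<in> submeasures" using openin_subset[OF W(1)] W(2) by (auto simp: topspace_submeasure_topology)
    moreover obtain d where "0 < d" "Metric_space.mball submeasures dBL \<mu> d \<subseteq> W"
      using W unfolding submeasure_topology_def Metric_space.openin_mtopology[OF Metric_space_dBL] by meson
    ultimately show ?thesis
      by (intro exI[of _ d]) (auto simp: Metric_space.in_mball[OF Metric_space_dBL] subset_iff)
  qed
  obtain d1 d2 where d: "0 < d1" "0 < d2" "\<And>\<nu>. \<nu> \<in> submeasures \<Longrightarrow> dBL (fst p) \<nu> < d1 \<Longrightarrow> \<nu> \<in> U"
    "\<And>\<nu>. \<nu> \<in> submeasures \<Longrightarrow> dBL (snd p) \<nu> < d2 \<Longrightarrow> \<nu> \<in> V"
    using ball[OF UV(1,3)] ball[OF UV(2,4)] by blast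
  show ?thesis
  proof (rule that[of "min d1 d2"])
    fix q assume q: "q \<in> mass_one_pairs" "dBL (fst p) (fst q) < min d1 d2" "dBL (snd p) (snd q) < min d1 d2"
    then have "fst q \<in> U" "snd q \<in> V" using d by (auto simp: mass_one_pairs_def)
    then show "q \<in> G" using UV(5) T(2) q(1) by (cases q) auto
  qed (use d in simp)
qed

lemma energy_square_finite:
  assumes p: "p \<in> mass_one_pairs" and fin: "energy (\<lambda>x. x\<^sup>2) p < \<infinity>"
  shows "integrable (fst p) (\<lambda>x. x\<^sup>2)" "integrable (snd p) (\<lambda>x. x\<^sup>2)"
    "energy (\<lambda>x. x\<^sup>2) p = ennreal ((LINT x|fst p. x\<^sup>2) + (LINT x|snd p. x\<^sup>2) + (mass (fst p) - mass (snd p))\<^sup>2 / 4)"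
proof -
  have sub: "fst p \<in> submeasures" "snd p \<in> submeasures" using p by (auto simp: mass_one_pairs_def)
  have f: "(\<integral>\<^sup>+ x. ennreal (x\<^sup>2) \<partial>fst p) < \<infinity>" "(\<integral>\<^sup>+ x. ennreal (x\<^sup>2) \<partial>snd p) < \<infinity>"
    using fin unfolding energy_def by (auto simp: less_top[symmetric])
  have i: "integrable \<mu> (\<lambda>x::real. x\<^sup>2)" if "\<mu> \<in> submeasures" "(\<integral>\<^sup>+ x. ennreal (x\<^sup>2) \<partial>\<mu>) < \<infinity>" for \<mu>
  proof (rule integrableI_nonneg)
    show "(\<lambda>x::real. x\<^sup>2) \<in> borel_measurable \<mu>" by (rule measurable_submeasure[OF that(1)]) measurable
  qed (use that in auto)
  show 1: "integrable (fst p) (\<lambda>x. x\<^sup>2)" and 2: "integrable (snd p) (\<lambda>x. x\<^sup>2)" using i sub f by auto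
  show "energy (\<lambda>x. x\<^sup>2) p = ennreal ((LINT x|fst p. x\<^sup>2) + (LINT x|snd p. x\<^sup>2) + (mass (fst p) - mass (snd p))\<^sup>2 / 4)"
    unfolding energy_def using nn_integral_eq_integral[OF 1] nn_integral_eq_integral[OF 2]
    by (simp add: integral_nonneg_AE ennreal_plus[symmetric] del: ennreal_plus)
qed

lemma borel_of_open: "openin X U \<Longrightarrow> U \<in> sets (borel_of X)"
  unfolding borel_of_def using openin_subset[of X] by (subst sets_measure_of) auto

lemma space_borel_of: "space (borel_of X) = topspace X"
  unfolding borel_of_def using openin_subset[of X] by (subst space_measure_of) auto

lemma borel_of_closed: "closedin X F \<Longrightarrow> F \<in> sets (borel_of X)"
  using sets.compl_sets[OF borel_of_open[of X "topspace X - F"]]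
  by (simp add: space_borel_of closedin_def Diff_Diff_Int inf_absorb2)

lemma sets_Q_law: "sets (Q_law m N) = sets (lborel_vec m)"
  by (simp add: Q_law_def)

text \<open>The exponent of \<open>Q_weight_integral_lower\<close>, with \<open>Y\<close> for the sum of the squared positions, \<open>Q\<close> for the perturbation
  of the squares and \<open>q\<close> for the constant in the \<open>n\<^sup>2\<close> error. Here \<open>m\<close> and \<open>1 - m\<close> are the target masses, and rounding
  the particle numbers changes \<open>k\<^sup>2 + (n - k)\<^sup>2\<close> by at most \<open>3 * n\<close>.\<close>
lemma lower_exponent_bound:
  fixes n k :: nat and L Y Q q S t e \<epsilon> m :: real
  assumes n: "1 \<le> n" "8 / \<epsilon> \<le> real n" and k: "k \<le> n" "real k \<le> m * real n" "m * real n - 1 \<le> real k"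
    and m: "0 \<le> m" "m \<le> 1" and L: "0 < L" "4 * q / \<epsilon> \<le> L" and Y: "Y \<le> real n * (S + 2 * t)" and Q: "Q \<le> t"
    and e: "0 < e" "e \<le> 1" "e * S \<le> \<epsilon> / 4" and t: "0 < t" "t \<le> \<epsilon> / 24" and \<epsilon>: "0 < \<epsilon>"
  shows "(1 + e) * real n * L * (Y + real n * Q) + L * ((real k)\<^sup>2 + (real (n - k))\<^sup>2) / 2 + real n * L / 2 + (real n)\<^sup>2 * q
    \<le> (real n)\<^sup>2 * L / 4 + (real n)\<^sup>2 * L * (S + (m - (1 - m))\<^sup>2 / 4 + \<epsilon>)"
proof -
  define \<Lambda> where "\<Lambda> = (real n)\<^sup>2 * L"
  define D where "D = (m - (1 - m))\<^sup>2 / 4"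
  have \<Lambda>0: "0 \<le> \<Lambda>" using L by (simp add: \<Lambda>_def)
  have l: "real (n - k) = real n - real k" using k by (simp add: of_nat_diff)
  have "Y + real n * Q \<le> real n * (S + 2 * t) + real n * t" by (intro add_mono Y mult_left_mono Q) simp
  then have "(1 + e) * real n * L * (Y + real n * Q) \<le> (1 + e) * real n * L * (real n * (S + 2 * t) + real n * t)"
    using e L by (intro mult_left_mono) auto
  also have "\<dots> = \<Lambda> * ((1 + e) * (S + 3 * t))" by (simp add: \<Lambda>_def power2_eq_square algebra_simps)
  also have "\<dots> \<le> \<Lambda> * (S + \<epsilon> / 2)"
  proof (intro mult_left_mono \<Lambda>0)
    have "(1 + e) * (3 * t) \<le> 2 * (3 * t)" using e t by (intro mult_right_mono) auto
    moreover have "(1 + e) * (S + 3 * t) = S + e * S + (1 + e) * (3 * t)" by (simp add: algebra_simps)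
    ultimately show "(1 + e) * (S + 3 * t) \<le> S + \<epsilon> / 2" using e(3) t(2) by linarith
  qed
  finally have sq: "(1 + e) * real n * L * (Y + real n * Q) \<le> \<Lambda> * (S + \<epsilon> / 2)" .
  have kl: "L * ((real k)\<^sup>2 + (real (n - k))\<^sup>2) / 2 \<le> \<Lambda> / 4 + \<Lambda> * D + 3 * (real n * L / 2)"
  proof -
    have "(real k)\<^sup>2 \<le> (m * real n)\<^sup>2" using k(2) by (intro power_mono) auto
    moreover have "real (n - k) \<le> (1 - m) * real n + 1" unfolding l using k(3) by (simp add: algebra_simps)
    then have "(real (n - k))\<^sup>2 \<le> ((1 - m) * real n + 1)\<^sup>2" by (rule power_mono) simp
    moreover have "((1 - m) * real n + 1)\<^sup>2 \<le> ((1 - m) * real n)\<^sup>2 + 3 * real n"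
    proof -
      have "(1 - m) * real n \<le> 1 * real n" using m by (intro mult_right_mono) auto
      moreover have "1 \<le> real n" using n by simp
      moreover have "(x + 1)\<^sup>2 \<le> x\<^sup>2 + 3 * z" if "x \<le> 1 * z" "1 \<le> z" for x z :: real
      proof -
        have "(x + 1)\<^sup>2 = x\<^sup>2 + 2 * x + 1" by (simp add: power2_eq_square algebra_simps)
        then show ?thesis using that by linarith
      qed
      ultimately show ?thesis by blast
    qed
    moreover have "(m * real n)\<^sup>2 + ((1 - m) * real n)\<^sup>2 = (real n)\<^sup>2 * (1/2 + 2 * D)"
      unfolding D_def by (simp add: power2_eq_square field_simps)
    ultimately have "(real k)\<^sup>2 + (real (n - k))\<^sup>2 \<le> (real n)\<^sup>2 * (1/2 + 2 * D) + 3 * real n" by linarith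
    then have "L * ((real k)\<^sup>2 + (real (n - k))\<^sup>2) \<le> L * ((real n)\<^sup>2 * (1/2 + 2 * D) + 3 * real n)"
      using L by (intro mult_left_mono) auto
    moreover have "L * ((real n)\<^sup>2 * (1/2 + 2 * D) + 3 * real n) = 2 * (\<Lambda> / 4 + \<Lambda> * D + 3 * (real n * L / 2))"
      by (simp add: \<Lambda>_def algebra_simps)
    moreover have "a / 2 \<le> b" if "a \<le> s" "s = 2 * b" for a b s :: real using that by simp
    ultimately show ?thesis by blast
  qed
  have er: "4 * (real n * L / 2) + (real n)\<^sup>2 * q \<le> \<Lambda> * \<epsilon> / 2"
  proof -
    have "8 \<le> \<epsilon> * real n" using n \<epsilon> by (simp add: divide_le_eq mult.commute)
    then have "8 * (real n * L) \<le> \<epsilon> * real n * (real n * L)" using L by (intro mult_right_mono) auto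
    moreover have "4 * q \<le> \<epsilon> * L" using L \<epsilon> by (simp add: divide_le_eq mult.commute)
    then have "(real n)\<^sup>2 * (4 * q) \<le> (real n)\<^sup>2 * (\<epsilon> * L)" by (intro mult_left_mono) auto
    moreover have "(real n)\<^sup>2 * (4 * q) = 4 * ((real n)\<^sup>2 * q)" by simp
    moreover have "\<epsilon> * real n * (real n * L) = \<Lambda> * \<epsilon>" "(real n)\<^sup>2 * (\<epsilon> * L) = \<Lambda> * \<epsilon>"
      by (simp_all add: \<Lambda>_def power2_eq_square)
    moreover have "4 * (p / 2) + u \<le> Z / 2" if "8 * p \<le> A" "V \<le> B" "V = 4 * u" "A = Z" "B = Z" for p u A B V Z :: real
      using that by linarith
    ultimately show ?thesis by blast
  qed
  have "\<Lambda> * (S + \<epsilon> / 2) + \<Lambda> * D + \<Lambda> * \<epsilon> / 2 = \<Lambda> * (S + D + \<epsilon>)" by (simp add: algebra_simps)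
  moreover have "x + y + p + u \<le> g + z" if "x \<le> x'" "y \<le> g + d + 3 * p" "4 * p + u \<le> v" "x' + d + v = z"
    for x y p u g z x' d v :: real using that by linarith
  ultimately show ?thesis unfolding \<Lambda>_def[symmetric] D_def[symmetric] using sq kl er by blast
qed

section \<open>The large deviation principle\<close>

locale critical_scaling =
  fixes M :: "nat \<Rightarrow> nat" and \<Theta> :: "nat \<Rightarrow> real"
  assumes M_bounds: "\<And>N. N \<ge> 1 \<Longrightarrow> 1 \<le> M N \<and> M N \<le> N"
    and M_at_top: "filterlim M at_top sequentially"
    and M_over_N: "(\<lambda>N. real (M N) / real N) \<longlonglongrightarrow> 0"
    and \<Theta>_pos: "\<And>N. N \<ge> 1 \<Longrightarrow> \<Theta> N > 0"
    and \<Theta>_tendsto: "\<Theta> \<longlonglongrightarrow> 0"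
    and balance: "\<And>N. N \<ge> 1 \<Longrightarrow>
      (real (M N))\<^sup>2 * ln (\<Theta> N powi (-2)) = real N * real (M N) * (\<Theta> N)\<^sup>2"
begin

definition L :: "nat \<Rightarrow> real" where "L N = - 2 * ln (\<Theta> N)"

definition speed :: "nat \<Rightarrow> real" where "speed N = (real (M N))\<^sup>2 * L N"

text \<open>The density at its peak, up to factors negligible at the given speed: every particle at a minimum of the
  potential, and two equal groups of particles paying \<open>\<Theta>\<^sup>2\<close> for each pair within a group.\<close>
definition normaliser :: "nat \<Rightarrow> real"
  where "normaliser N = exp (- real N * real (M N) * (1 - ln 2) - (real (M N))\<^sup>2 * L N / 4)"

definition pair :: "nat \<Rightarrow> (nat \<Rightarrow> real) \<Rightarrow> real measure \<times> real measure"
  where "pair N lam = (mu_alpha (M N) (\<Theta> N) lam, mu_beta (M N) (\<Theta> N) lam)"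

definition weight :: "nat \<Rightarrow> (real measure \<times> real measure) set \<Rightarrow> ennreal"
  where "weight N A = (\<integral>\<^sup>+ lam. ennreal (Q_weight (M N) N lam) * indicator {lam. pair N lam \<in> A} lam \<partial>lborel_vec (M N))"

lemma ln_powi: "N \<ge> 1 \<Longrightarrow> ln (\<Theta> N powi (-2)) = L N"
  using \<Theta>_pos[of N] by (simp add: L_def power_int_minus ln_inverse ln_realpow)

lemma scale:
  assumes "N \<ge> 1" shows "real N * (\<Theta> N)\<^sup>2 = real (M N) * L N"
proof -
  have "real (M N) * (real N * (\<Theta> N)\<^sup>2) = real (M N) * (real (M N) * L N)"
    using balance[OF assms, symmetric] unfolding ln_powi[OF assms] by (simp only: power2_eq_square mult_ac)
  then show ?thesis using M_bounds[OF assms] by simp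
qed

lemma L_pos: assumes "N \<ge> 1" shows "0 < L N"
proof -
  have "0 < real N * (\<Theta> N)\<^sup>2" using assms \<Theta>_pos[OF assms] by simp
  then show ?thesis unfolding scale[OF assms] using M_bounds[OF assms] by (simp add: zero_less_mult_iff)
qed

lemma \<Theta>_le_1: assumes "N \<ge> 1" shows "\<Theta> N \<le> 1"
  using L_pos[OF assms] \<Theta>_pos[OF assms] by (simp add: L_def)

lemma speed_pos: assumes "N \<ge> 1" shows "0 < speed N"
  using L_pos[OF assms] M_bounds[OF assms] by (simp add: speed_def)

lemma eventually_\<Theta>_le: "0 < T \<Longrightarrow> \<forall>\<^sub>F N in sequentially. \<Theta> N \<le> T"
  by (rule eventually_mono[OF order_tendstoD(2)[OF \<Theta>_tendsto]]) auto

lemma eventually_L_ge: "\<forall>\<^sub>F N in sequentially. x \<le> L N"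
proof -
  have "\<forall>\<^sub>F N in sequentially. \<Theta> N \<le> exp (- x / 2)" by (rule eventually_\<Theta>_le) simp
  then show ?thesis using eventually_ge_at_top[of 1]
  proof eventually_elim
    case (elim N)
    then have "ln (\<Theta> N) \<le> - x / 2" using \<Theta>_pos[of N] ln_le_cancel_iff[of "\<Theta> N" "exp (- x / 2)"] by simp
    then show ?case by (simp add: L_def)
  qed
qed

lemma eventually_M_ge: "\<forall>\<^sub>F N in sequentially. x \<le> real (M N)"
proof -
  obtain n :: nat where n: "x \<le> real n" using real_arch_simple by blast
  have "\<forall>\<^sub>F N in sequentially. n \<le> M N" using M_at_top by (simp add: filterlim_at_top)
  then show ?thesis using n by (auto elim!: eventually_mono)
qed

lemma eventually_M_le: assumes "0 < e" shows "\<forall>\<^sub>F N in sequentially. real (M N) \<le> e * real N"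
  using order_tendstoD(2)[OF M_over_N assms] eventually_ge_at_top[of 1]
  by eventually_elim (simp add: field_simps)

lemma eventually_N_ge: "\<forall>\<^sub>F N in sequentially. x \<le> real N"
  using filterlim_real_sequentially by (simp add: filterlim_at_top)

lemma speed_at_top: "filterlim speed at_top sequentially"
  unfolding filterlim_at_top
proof
  fix x
  show "\<forall>\<^sub>F N in sequentially. x \<le> speed N"
    using eventually_L_ge[of x] eventually_ge_at_top[of 1]
  proof eventually_elim
    case (elim N)
    have "1 * L N \<le> (real (M N))\<^sup>2 * L N"
      using M_bounds[of N] L_pos[of N] elim by (intro mult_right_mono) auto
    then show ?case using elim by (simp add: speed_def)
  qed
qed

lemma pair_eq: "pair N lam = empirical_pair (M N) (nonneg_indices (M N) lam) (rescaled (\<Theta> N) lam)"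
  unfolding pair_def by (rule mu_alpha_beta_eq)

lemma pair_mem: "N \<ge> 1 \<Longrightarrow> pair N lam \<in> mass_one_pairs"
  unfolding pair_eq using M_bounds by (intro empirical_pair_mem nonneg_indices_subset) auto

lemma energy_soft_square_pair:
  assumes "N \<ge> 1" shows "energy (soft_square k) (pair N lam) = ennreal (soft_energy k (M N) (\<Theta> N) lam)"
  unfolding pair_eq soft_energy_def using M_bounds[OF assms]
  by (intro energy_empirical_pair nonneg_indices_subset soft_square_measurable soft_square_nonneg) auto

text \<open>All the largeness conditions of \<open>Q_weight_integral_upper\<close> hold eventually, for fixed \<open>k\<close> and \<open>\<epsilon>\<close>.\<close>
lemma weight_upper:
  assumes c: "\<And>p. p \<in> F \<Longrightarrow> ennreal c \<le> energy (soft_square k) p" and \<epsilon>: "0 < \<epsilon>"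
  shows "\<forall>\<^sub>F N in sequentially. weight N F \<le> ennreal (normaliser N * exp (- speed N * (c - \<epsilon>)))"
proof -
  define e where "e = 1 / (3 * real (k + 2))"
  have e: "0 < e" "e < 1" unfolding e_def by (simp_all add: divide_simps)
  obtain T where T: "0 < T" and wl: "\<And>\<Theta> x. 0 < \<Theta> \<Longrightarrow> \<Theta> \<le> T \<Longrightarrow> - sqrt 2 < \<Theta> * x \<Longrightarrow>
      \<Theta>\<^sup>2 * ((1 - e) * (\<bar>x\<bar> * min \<bar>x\<bar> (real (k + 1)))) \<le> well (\<Theta> * x)"
    using well_rescaled_ge[OF e, of "real (k + 1)"] by (metis of_nat_0_less_iff add_gr_0 zero_less_one)
  show ?thesis
    using eventually_ge_at_top[of 1] eventually_\<Theta>_le[OF T] eventually_M_le[OF e(1)] eventually_L_ge[of "8 / e + 10 / \<epsilon>"] eventually_M_ge[of "1 / \<epsilon>"] eventually_N_ge[of "32 * pi / e"]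
  proof eventually_elim
    case (elim N)
    note N = elim(1)
    have MN: "M N < N"
    proof -
      have "e * real N < 1 * real N" using e N by (intro mult_strict_right_mono) auto
      then show ?thesis using elim(3) by simp
    qed
    have pos: "0 \<le> 8 / e" "0 \<le> 10 / \<epsilon>" using e \<epsilon> by auto
    have err: "1 / (2 * real (M N)) + 5 / L N \<le> \<epsilon>"
    proof -
      have "10 / \<epsilon> \<le> L N" using elim(4) pos by linarith
      then have "5 / L N \<le> \<epsilon> / 2" using \<epsilon> L_pos[OF N] by (simp add: field_simps)
      moreover have "1 / (2 * real (M N)) \<le> \<epsilon> / 2" using elim(5) \<epsilon> M_bounds[OF N] by (simp add: field_simps)
      ultimately show ?thesis by linarith
    qed
    have "(\<integral>\<^sup>+ lam. ennreal (Q_weight (M N) N lam) * indicator {lam. pair N lam \<in> F} lam \<partial>lborel_vec (M N))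
      \<le> ennreal (exp (- real N * real (M N) * (1 - ln 2) - (real (M N))\<^sup>2 * L N / 4) * exp (- (real (M N))\<^sup>2 * L N * (c - \<epsilon>)))"
    proof (rule Q_weight_integral_upper[OF e_def _ MN \<Theta>_pos[OF N] \<Theta>_le_1[OF N] L_def L_pos[OF N] scale[OF N] wl elim(3) _ err elim(6)])
      show "1 \<le> M N" using M_bounds[OF N] by simp
      show "0 < \<Theta> N" "\<Theta> N \<le> T" using \<Theta>_pos[OF N] elim(2) by auto
      show "8 / e \<le> L N" using elim(4) pos by linarith
      fix lam assume "lam \<in> {lam. pair N lam \<in> F}"
      then have "ennreal c \<le> energy (soft_square k) (pair N lam)" by (intro c) simp
      then have "ennreal c \<le> ennreal (soft_energy k (M N) (\<Theta> N) lam)" unfolding energy_soft_square_pair[OF N] .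
      moreover have "0 \<le> soft_energy k (M N) (\<Theta> N) lam"
        unfolding soft_energy_def by (intro add_nonneg_nonneg divide_nonneg_nonneg sum_nonneg soft_square_nonneg) auto
      ultimately show "c \<le> soft_energy k (M N) (\<Theta> N) lam" by (simp add: ennreal_le_iff)
    qed auto
    then show ?case by (simp add: weight_def normaliser_def speed_def)
  qed
qed

text \<open>A neighbourhood of \<open>p\<close> inside \<open>G\<close> contains the empirical pairs of all configurations close enough to the
  quantile points of the two components of \<open>p\<close>.\<close>
lemma weight_lower:
  assumes G: "openin pair_topology G" and p: "p \<in> G" and E: "energy (\<lambda>x. x\<^sup>2) p = ennreal c" and c: "0 \<le> c"
    and \<epsilon>: "0 < \<epsilon>"
  shows "\<forall>\<^sub>F N in sequentially. ennreal (normaliser N * exp (- speed N * (c + \<epsilon>))) \<le> weight N G"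
proof -
  have pM: "p \<in> mass_one_pairs" using openin_subset[OF G] p by (auto simp: topspace_pair_topology)
  define \<mu> where "\<mu> = fst p"
  define \<nu> where "\<nu> = snd p"
  define S where "S = (LINT x|\<mu>. x\<^sup>2) + (LINT x|\<nu>. x\<^sup>2)"
  define m where "m = mass \<mu>"
  define D where "D = (m - mass \<nu>)\<^sup>2 / 4"
  have sub: "\<mu> \<in> submeasures" "\<nu> \<in> submeasures" and m\<nu>: "mass \<nu> = 1 - m"
    using pM by (auto simp: mass_one_pairs_def \<mu>_def \<nu>_def m_def)
  have m01: "0 \<le> m" "m \<le> 1" using mass_bounds[OF sub(1)] by (auto simp: m_def)
  have "energy (\<lambda>x. x\<^sup>2) p < \<infinity>" using E by simp
  note fin = energy_square_finite[OF pM this, folded \<mu>_def \<nu>_def]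
  have S0: "0 \<le> S" unfolding S_def by (intro add_nonneg_nonneg integral_nonneg_AE) auto
  have "ennreal c = ennreal (S + D)" using fin(3) unfolding E by (simp only: S_def D_def m_def)
  moreover have "0 \<le> S + D" using S0 by (simp add: D_def)
  ultimately have cS: "c = S + D" using c by (simp add: ennreal_inj)
  obtain \<delta> where \<delta>: "0 < \<delta>" "\<And>q. q \<in> mass_one_pairs \<Longrightarrow> dBL \<mu> (fst q) < \<delta> \<Longrightarrow> dBL \<nu> (snd q) < \<delta> \<Longrightarrow> q \<in> G"
    using pair_topology_neighbourhood[OF G p] unfolding \<mu>_def \<nu>_def by blast
  define t where "t = min (\<delta> / 4) (\<epsilon> / 24)"
  have t: "0 < t" "t \<le> \<delta> / 4" "t \<le> \<epsilon> / 24" using \<delta> \<epsilon> by (auto simp: t_def)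
  obtain R1 M1 where R1: "0 \<le> R1" and Q1: "\<And>M k. M1 \<le> M \<Longrightarrow> \<bar>real k - mass \<mu> * real M\<bar> \<le> 1 \<Longrightarrow>
      \<exists>y. approximates \<mu> t R1 M k y"
    using quantile_points[OF sub(1) fin(1) t(1)] by blast
  obtain R2 M2 where R2: "0 \<le> R2" and Q2: "\<And>M k. M2 \<le> M \<Longrightarrow> \<bar>real k - mass \<nu> * real M\<bar> \<le> 1 \<Longrightarrow>
      \<exists>y. approximates \<nu> t R2 M k y"
    using quantile_points[OF sub(2) fin(2) t(1)] by blast
  define R where "R = max R1 R2"
  have R: "0 \<le> R" using R1 by (simp add: R_def)
  define r where "r = min 1 (min (\<delta> / 8) (t / (4 * R + 4)))"
  have "0 < t / (4 * R + 4)" using t(1) R by simp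
  then have "0 < r" unfolding r_def using \<delta>(1) by simp
  moreover have "r \<le> 1" unfolding r_def by (rule min.cobounded1)
  moreover have "r \<le> \<delta> / 8" unfolding r_def by (rule min.coboundedI2[OF min.cobounded1])
  moreover have "r \<le> t / (4 * R + 4)" unfolding r_def by (rule min.coboundedI2[OF min.cobounded2])
  ultimately have r: "0 < r" "r \<le> 1" "r \<le> \<delta> / 8" "r \<le> t / (4 * R + 4)" by blast+
  have rR: "4 * r * R + 4 * r\<^sup>2 \<le> t"
  proof -
    have "r * r \<le> r * 1" using r by (intro mult_left_mono) auto
    then have "4 * r * R + 4 * r\<^sup>2 \<le> r * (4 * R + 4)" by (simp add: power2_eq_square algebra_simps)
    also have "\<dots> \<le> t" using r(4) R by (simp add: pos_le_divide_eq)
    finally show ?thesis .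
  qed
  \<comment> \<open>relative error of the quadratic approximation, small against \<open>S\<close>\<close>
  define e where "e = min 1 (\<epsilon> / 4 / (S + 1))"
  have e: "0 < e" "e \<le> 1" "e * S \<le> \<epsilon> / 4"
  proof -
    show "0 < e" "e \<le> 1" using \<epsilon> S0 by (auto simp: e_def)
    have S1: "S + 1 \<noteq> 0" using S0 by linarith
    have "e * (S + 1) \<le> \<epsilon> / 4 / (S + 1) * (S + 1)" using S0 by (intro mult_right_mono) (auto simp: e_def)
    also have "\<dots> = \<epsilon> / 4"
    proof -
      have "x / z * z = x" if "z \<noteq> 0" for x z :: real using that by simp
      from this[OF S1] show ?thesis .
    qed
    finally show "e * S \<le> \<epsilon> / 4" using \<open>0 < e\<close> by (simp add: distrib_left)
  qed
  obtain d where d: "0 < d" and wl: "\<And>s. \<bar>s\<bar> \<le> d \<Longrightarrow> well s \<le> (1 + e) * s\<^sup>2"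
    using well_quadratic[OF e(1)] by metis
  define T where "T = min d (1/2) / (R + 2)"
  have T: "0 < T" unfolding T_def using d R by simp
  show ?thesis
    using eventually_ge_at_top[of 1] eventually_\<Theta>_le[OF T] eventually_L_ge[of "4 * (5 + 3 * ln (2 / r)) / \<epsilon>"] eventually_M_ge[of "8 / \<epsilon>"] eventually_M_ge[of "real M1"] eventually_M_ge[of "real M2"]
  proof eventually_elim
    case (elim N)
    note N = elim(1)
    define n where "n = M N"
    have n: "1 \<le> n" "n \<le> N" using M_bounds[OF N] by (auto simp: n_def)
    have M12: "M1 \<le> n" "M2 \<le> n" using elim(5,6) by (auto simp: n_def)
    \<comment> \<open>the number of particles in the right well\<close>
    define k where "k = nat \<lfloor>m * real n\<rfloor>"
    have "real k = of_int \<lfloor>m * real n\<rfloor>" using m01 by (simp add: k_def)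
    then have k: "real k \<le> m * real n" "m * real n - 1 \<le> real k" by linarith+
    have kn: "k \<le> n"
    proof -
      have "m * real n \<le> 1 * real n" using m01 by (intro mult_right_mono) auto
      then have "real k \<le> real n" using k(1) by linarith
      then show ?thesis by simp
    qed
    have l: "real (n - k) = real n - real k" using kn by (simp add: of_nat_diff)
    have "\<bar>real k - mass \<mu> * real n\<bar> \<le> 1" unfolding m_def[symmetric] using k by linarith
    then obtain y1 where y1: "approximates \<mu> t R1 n k y1" using Q1[OF M12(1)] by blast
    have "\<bar>real (n - k) - mass \<nu> * real n\<bar> = \<bar>m * real n - real k\<bar>"
      unfolding m\<nu> l by (simp add: algebra_simps)
    then have "\<bar>real (n - k) - mass \<nu> * real n\<bar> \<le> 1" using k by linarith
    then obtain y2 where y2: "approximates \<nu> t R2 n (n - k) y2" using Q2[OF M12(2)] by blast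
    note y1 = y1[unfolded approximates_def] and y2 = y2[unfolded approximates_def]
    define y where "y i = (if i < k then y1 i else y2 (i - k))" for i
    have yR: "\<bar>y i\<bar> \<le> R" for i using y1 y2 by (auto simp: y_def R_def intro: max.coboundedI1 max.coboundedI2)
    have ymono: "y i \<le> y j" if "i \<le> j" "i < k \<longleftrightarrow> j < k" for i j
      using that y1 y2 by (auto simp: y_def intro: monoD)
    have sumA: "(\<Sum>i<k. f (y i)) = (\<Sum>i<k. f (y1 i))" for f :: "real \<Rightarrow> real" by (simp add: y_def)
    have sumB: "(\<Sum>i\<in>{..<n} - {..<k}. f (y i)) = (\<Sum>i<n - k. f (y2 i))" for f :: "real \<Rightarrow> real"
      by (rule sum.reindex_bij_witness[where i = "\<lambda>i. i + k" and j = "\<lambda>i. i - k"]) (auto simp: y_def)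
    have ysq: "(\<Sum>i<n. (y i)\<^sup>2) \<le> real n * (S + 2 * t)"
    proof -
      have "(\<Sum>i<n. (y i)\<^sup>2) = (\<Sum>i\<in>{..<n} - {..<k}. (y i)\<^sup>2) + (\<Sum>i<k. (y i)\<^sup>2)"
        using kn by (intro sum.subset_diff) auto
      also have "\<dots> = real n * ((\<Sum>i<n - k. (y2 i)\<^sup>2) / real n + (\<Sum>i<k. (y1 i)\<^sup>2) / real n)"
        unfolding sumA[of "\<lambda>x. x\<^sup>2"] sumB[of "\<lambda>x. x\<^sup>2"] using n by (simp add: distrib_left)
      also have "\<dots> \<le> real n * (S + 2 * t)"
      proof (rule mult_left_mono)
        show "(\<Sum>i<n - k. (y2 i)\<^sup>2) / real n + (\<Sum>i<k. (y1 i)\<^sup>2) / real n \<le> S + 2 * t"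
          using y1 y2 unfolding S_def by linarith
      qed simp
      finally show ?thesis .
    qed
    have "\<Theta> N * (R + 2) \<le> min d (1/2)" using elim(2) R unfolding T_def by (simp add: pos_le_divide_eq)
    then have TR: "\<Theta> N * (R + 2) \<le> d" "\<Theta> N * (R + 2) \<le> 1/2" by (simp_all only: min.bounded_iff)
    let ?cost = "(1 + e) * real n * L N * ((\<Sum>i<n. (y i)\<^sup>2) + real n * (4 * r * R + 4 * r\<^sup>2))
        + L N * ((real k)\<^sup>2 + (real (n - k))\<^sup>2) / 2 + real n * L N / 2 + (real n)\<^sup>2 * (5 + 3 * ln (2 / r))"
    have W: "ennreal (exp (- real N * real n * (1 - ln 2) - ?cost))
      \<le> (\<integral>\<^sup>+ lam. ennreal (Q_weight n N lam) * indicator {lam. pair N lam \<in> G} lam \<partial>lborel_vec n)"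
    proof (rule Q_weight_integral_lower[OF n kn \<Theta>_pos[OF N] \<Theta>_le_1[OF N] L_def scale[OF N, folded n_def] _ wl TR r(1,2) yR ymono])
      show "0 \<le> e" using e by simp
      fix lam assume J: "nonneg_indices n lam = {..<k}" and near: "\<And>i. i < n \<Longrightarrow> \<bar>rescaled (\<Theta> N) lam i - y i\<bar> \<le> 2 * r"
      have pe: "pair N lam = empirical_pair n {..<k} (rescaled (\<Theta> N) lam)" unfolding pair_eq n_def[symmetric] J ..
      have small: "t + 2 * r < \<delta>" using t(2) r(3) \<delta>(1) by linarith
      have r0: "0 \<le> 2 * r" using r by simp
      have "pair N lam \<in> G"
      proof (rule \<delta>(2)[OF pair_mem[OF N]])
        show "dBL \<mu> (fst (pair N lam)) < \<delta>" unfolding pe empirical_pair_def fst_conv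
        proof (rule le_less_trans[OF dBL_le_of_averages[OF n(1) _ sub(1) r0 _ near] small])
          show "\<bar>(\<Sum>i<k. f (y i)) / real n - (LINT x|\<mu>. f x)\<bar> \<le> t" if "f \<in> BL_functions" for f
            unfolding sumA using y1 that by blast
        qed (use kn in auto)
        show "dBL \<nu> (snd (pair N lam)) < \<delta>" unfolding pe empirical_pair_def snd_conv
        proof (rule le_less_trans[OF dBL_le_of_averages[OF n(1) _ sub(2) r0 _ near] small])
          show "\<bar>(\<Sum>i\<in>{..<n} - {..<k}. f (y i)) / real n - (LINT x|\<nu>. f x)\<bar> \<le> t" if "f \<in> BL_functions" for f
            unfolding sumB using y2 that by blast
        qed auto
      qed
      then show "lam \<in> {lam. pair N lam \<in> G}" by simp
    qed auto
    have "8 / \<epsilon> \<le> real n" "4 * (5 + 3 * ln (2 / r)) / \<epsilon> \<le> L N" using elim(3,4) by (auto simp: n_def)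
    then have "?cost \<le> (real n)\<^sup>2 * L N / 4 + (real n)\<^sup>2 * L N * (S + (m - (1 - m))\<^sup>2 / 4 + \<epsilon>)"
      by (intro lower_exponent_bound[where t = t] n kn k m01 L_pos[OF N] ysq rR e t \<epsilon>)
    then have B: "normaliser N * exp (- speed N * (c + \<epsilon>)) \<le> exp (- real N * real n * (1 - ln 2) - ?cost)"
      unfolding normaliser_def speed_def n_def[symmetric] cS D_def m\<nu> exp_add[symmetric] exp_le_cancel_iff
      by (simp only: mult_minus_left)
    show ?case unfolding weight_def n_def[symmetric] by (rule order_trans[OF ennreal_leI[OF B] W])
  qed
qed

lemma weight_UNIV: "weight N UNIV = (\<integral>\<^sup>+ lam. ennreal (Q_weight (M N) N lam) \<partial>lborel_vec (M N))"
  by (simp add: weight_def)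

lemma weight_le_UNIV: "weight N A \<le> weight N UNIV"
  unfolding weight_def by (intro nn_integral_mono) (auto simp: indicator_def)

lemma weight_UNIV_bounds: assumes "N \<ge> 1" shows "0 < weight N UNIV" "weight N UNIV < \<infinity>"
  unfolding weight_UNIV using nn_integral_Q_weight_pos nn_integral_Q_weight_finite[OF assms] by auto

definition law :: "nat \<Rightarrow> (real measure \<times> real measure) measure"
  where "law N = distr (Q_law (M N) N) (borel_of pair_topology) (pair N)"

lemma measurable_pair: "N \<ge> 1 \<Longrightarrow> pair N \<in> measurable (Q_law (M N) N) (borel_of pair_topology)"
  unfolding pair_def[abs_def] using M_bounds by (intro measurable_empirical_pair sets_Q_law) auto

lemma emeasure_Q_law:
  assumes A: "A \<in> sets (lborel_vec (M N))"
  shows "emeasure (Q_law (M N) N) A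
    = (\<integral>\<^sup>+ lam. ennreal (Q_weight (M N) N lam) * indicator A lam \<partial>lborel_vec (M N)) / weight N UNIV"
proof -
  have "emeasure (Q_law (M N) N) A
    = (\<integral>\<^sup>+ lam. ennreal (Q_weight (M N) N lam) / weight N UNIV * indicator A lam \<partial>lborel_vec (M N))"
    unfolding Q_law_def weight_UNIV using A by (subst emeasure_density) auto
  also have "\<dots> = (\<integral>\<^sup>+ lam. ennreal (Q_weight (M N) N lam) * indicator A lam / weight N UNIV \<partial>lborel_vec (M N))"
    by (simp add: divide_ennreal_def mult_ac)
  also have "\<dots> = (\<integral>\<^sup>+ lam. ennreal (Q_weight (M N) N lam) * indicator A lam \<partial>lborel_vec (M N)) / weight N UNIV"
    using A by (intro nn_integral_divide) auto
  finally show ?thesis .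
qed

lemma prob_space_Q_law: assumes N: "N \<ge> 1" shows "prob_space (Q_law (M N) N)"
proof (rule prob_spaceI)
  have sp: "space (Q_law (M N) N) = space (lborel_vec (M N))" by (simp add: Q_law_def)
  have "(\<integral>\<^sup>+ lam. ennreal (Q_weight (M N) N lam) * indicator (space (lborel_vec (M N))) lam \<partial>lborel_vec (M N)) = weight N UNIV"
    unfolding weight_UNIV by (intro nn_integral_cong) simp
  then show "emeasure (Q_law (M N) N) (space (Q_law (M N) N)) = 1"
    unfolding sp using weight_UNIV_bounds[OF N] by (subst emeasure_Q_law) (auto intro!: ennreal_divide_self)
qed

lemma measure_law:
  assumes N: "N \<ge> 1" and A: "A \<in> sets (borel_of pair_topology)"
  shows "measure (law N) A = enn2real (weight N A) / enn2real (weight N UNIV)"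
proof -
  let ?B = "pair N -` A \<inter> space (Q_law (M N) N)"
  have B: "?B \<in> sets (lborel_vec (M N))" using measurable_sets[OF measurable_pair[OF N] A] by (simp add: sets_Q_law)
  have sp: "space (Q_law (M N) N) = space (lborel_vec (M N))" by (simp add: Q_law_def)
  have "emeasure (law N) A = emeasure (Q_law (M N) N) ?B"
    unfolding law_def by (rule emeasure_distr[OF measurable_pair[OF N] A])
  also have "\<dots> = (\<integral>\<^sup>+ lam. ennreal (Q_weight (M N) N lam) * indicator ?B lam \<partial>lborel_vec (M N)) / weight N UNIV"
    by (rule emeasure_Q_law[OF B])
  also have "(\<integral>\<^sup>+ lam. ennreal (Q_weight (M N) N lam) * indicator ?B lam \<partial>lborel_vec (M N)) = weight N A"
    unfolding weight_def sp by (intro nn_integral_cong) (simp add: indicator_def)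
  finally have eq: "emeasure (law N) A = weight N A / weight N UNIV" .
  have fin: "weight N A < \<infinity>" using weight_le_UNIV weight_UNIV_bounds(2)[OF N] by (rule le_less_trans)
  obtain a where a: "weight N A = ennreal a" "0 \<le> a" using fin by (cases "weight N A") auto
  obtain b where b: "weight N UNIV = ennreal b" "0 < b"
    using weight_UNIV_bounds[OF N] by (cases "weight N UNIV") (auto simp: ennreal_less_zero_iff)
  show ?thesis unfolding measure_def eq a(1) b(1) using a(2) b(2) by (simp add: divide_ennreal)
qed

lemma normaliser_pos: "0 < normaliser N"
  by (simp add: normaliser_def)

lemma weight_UNIV_eq: "N \<ge> 1 \<Longrightarrow> weight N UNIV = weight N mass_one_pairs"
  unfolding weight_def using pair_mem by (auto intro!: nn_integral_cong)

text \<open>The partition function agrees with the normaliser at the given speed: the upper bound is applied with the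
  trivial level \<open>0\<close>, the lower bound at \<open>balanced_pair\<close>, where the energy vanishes.\<close>
lemma weight_total:
  assumes \<epsilon>: "0 < \<epsilon>"
  shows "\<forall>\<^sub>F N in sequentially. normaliser N * exp (- speed N * \<epsilon>) \<le> enn2real (weight N UNIV)"
    and "\<forall>\<^sub>F N in sequentially. enn2real (weight N UNIV) \<le> normaliser N * exp (speed N * \<epsilon>)"
proof -
  have up: "\<forall>\<^sub>F N in sequentially. weight N mass_one_pairs \<le> ennreal (normaliser N * exp (- speed N * (0 - \<epsilon>)))"
    by (rule weight_upper[of _ 0 0]) (use \<epsilon> in auto)
  have op: "openin pair_topology mass_one_pairs"
    using openin_topspace[of pair_topology] by (simp add: topspace_pair_topology)
  have lo: "\<forall>\<^sub>F N in sequentially. ennreal (normaliser N * exp (- speed N * (0 + \<epsilon>))) \<le> weight N mass_one_pairs"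
    by (rule weight_lower[OF op balanced_pair(1)]) (use \<epsilon> balanced_pair(2) in auto)
  show "\<forall>\<^sub>F N in sequentially. normaliser N * exp (- speed N * \<epsilon>) \<le> enn2real (weight N UNIV)"
    using lo eventually_ge_at_top[of 1]
  proof eventually_elim
    case (elim N)
    have "enn2real (ennreal (normaliser N * exp (- speed N * (0 + \<epsilon>)))) \<le> enn2real (weight N UNIV)"
      using elim weight_UNIV_bounds(2)[of N] by (intro enn2real_mono) (auto simp: weight_UNIV_eq)
    then show ?case using normaliser_pos[of N] by simp
  qed
  show "\<forall>\<^sub>F N in sequentially. enn2real (weight N UNIV) \<le> normaliser N * exp (speed N * \<epsilon>)"
    using up eventually_ge_at_top[of 1]
  proof eventually_elim
    case (elim N)
    have "enn2real (weight N UNIV) \<le> enn2real (ennreal (normaliser N * exp (- speed N * (0 - \<epsilon>))))"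
      using elim by (intro enn2real_mono) (auto simp: weight_UNIV_eq)
    then show ?case using normaliser_pos[of N] by simp
  qed
qed

text \<open>Half of \<open>\<epsilon>\<close> is spent on the numerator and half on the partition function.\<close>
lemma law_upper:
  assumes F: "closedin pair_topology F" and c: "\<And>p. p \<in> F \<Longrightarrow> ennreal c < energy (\<lambda>x. x\<^sup>2) p" and \<epsilon>: "0 < \<epsilon>"
  shows "\<forall>\<^sub>F N in sequentially. measure (law N) F \<le> exp (- speed N * (c - \<epsilon>))"
proof -
  obtain k where k: "\<And>p. p \<in> F \<Longrightarrow> ennreal c < energy (soft_square k) p"
    using closed_above_level_soft_square[OF F c] by auto
  have "\<forall>\<^sub>F N in sequentially. weight N F \<le> ennreal (normaliser N * exp (- speed N * (c - \<epsilon> / 2)))"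
    by (rule weight_upper[of _ _ k]) (use k \<epsilon> in \<open>auto intro: less_imp_le\<close>)
  moreover have "\<forall>\<^sub>F N in sequentially. normaliser N * exp (- speed N * (\<epsilon> / 2)) \<le> enn2real (weight N UNIV)"
    by (rule weight_total) (use \<epsilon> in simp)
  ultimately show ?thesis using eventually_ge_at_top[of 1]
  proof eventually_elim
    case (elim N)
    have "enn2real (weight N F) \<le> enn2real (ennreal (normaliser N * exp (- speed N * (c - \<epsilon> / 2))))"
      using elim(1) by (intro enn2real_mono) auto
    then have "enn2real (weight N F) \<le> normaliser N * exp (- speed N * (c - \<epsilon> / 2))" using normaliser_pos[of N] by simp
    also have "\<dots> = exp (- speed N * (c - \<epsilon>)) * (normaliser N * exp (- speed N * (\<epsilon> / 2)))"
      by (simp add: exp_add[symmetric] algebra_simps)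
    also have "\<dots> \<le> exp (- speed N * (c - \<epsilon>)) * enn2real (weight N UNIV)"
      by (intro mult_left_mono elim(2)) simp
    finally have "enn2real (weight N F) \<le> exp (- speed N * (c - \<epsilon>)) * enn2real (weight N UNIV)" .
    moreover have "0 < enn2real (weight N UNIV)"
      using elim(2) normaliser_pos[of N] by (meson exp_gt_zero less_le_trans mult_pos_pos)
    ultimately show ?case
      unfolding measure_law[OF elim(3) borel_of_closed[OF F]] by (simp add: pos_divide_le_eq)
  qed
qed

lemma law_lower:
  assumes G: "openin pair_topology G" and p: "p \<in> G" and E: "energy (\<lambda>x. x\<^sup>2) p = ennreal c" and c: "0 \<le> c"
    and \<epsilon>: "0 < \<epsilon>"
  shows "\<forall>\<^sub>F N in sequentially. exp (- speed N * (c + \<epsilon>)) \<le> measure (law N) G"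
proof -
  have "\<forall>\<^sub>F N in sequentially. ennreal (normaliser N * exp (- speed N * (c + \<epsilon> / 2))) \<le> weight N G"
    by (rule weight_lower[OF G p E c]) (use \<epsilon> in simp)
  moreover have "\<forall>\<^sub>F N in sequentially. enn2real (weight N UNIV) \<le> normaliser N * exp (speed N * (\<epsilon> / 2))"
    by (rule weight_total) (use \<epsilon> in simp)
  ultimately show ?thesis using eventually_ge_at_top[of 1]
  proof eventually_elim
    case (elim N)
    have fin: "weight N G < \<infinity>" using weight_le_UNIV weight_UNIV_bounds(2)[OF elim(3)] by (rule le_less_trans)
    have pos: "0 < enn2real (weight N UNIV)"
      using weight_UNIV_bounds[OF elim(3)] by (simp add: enn2real_positive_iff)
    have "exp (- speed N * (c + \<epsilon>)) * enn2real (weight N UNIV) \<le> exp (- speed N * (c + \<epsilon>)) * (normaliser N * exp (speed N * (\<epsilon> / 2)))"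
      by (intro mult_left_mono elim(2)) simp
    also have "\<dots> = normaliser N * exp (- speed N * (c + \<epsilon> / 2))"
      by (simp add: exp_add[symmetric] algebra_simps)
    also have "\<dots> = enn2real (ennreal (normaliser N * exp (- speed N * (c + \<epsilon> / 2))))" using normaliser_pos[of N] by simp
    also have "\<dots> \<le> enn2real (weight N G)" using elim(1) fin by (intro enn2real_mono) auto
    finally show ?case
      unfolding measure_law[OF elim(3) borel_of_open[OF G]] using pos by (simp add: pos_le_divide_eq)
  qed
qed

lemma scaled_ln_le:
  assumes N: "N \<ge> 1" and P: "0 \<le> P" "P \<le> exp (- speed N * x)"
  shows "ereal (1 / speed N) * ereal_ln P \<le> ereal (- x)"
proof (cases "P = 0")
  case True
  then show ?thesis using speed_pos[OF N] by (simp add: ereal_ln_def)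
next
  case False
  then have "ln P \<le> - speed N * x" using P ln_le_cancel_iff[of P "exp (- speed N * x)"] by simp
  then have "1 / speed N * ln P \<le> - x" using speed_pos[OF N] by (simp add: field_simps)
  then show ?thesis using False by (simp add: ereal_ln_def)
qed

lemma scaled_ln_ge:
  assumes N: "N \<ge> 1" and P: "exp (- speed N * x) \<le> P"
  shows "ereal (- x) \<le> ereal (1 / speed N) * ereal_ln P"
proof -
  have P0: "0 < P" using P by (meson exp_gt_zero less_le_trans)
  then have "- speed N * x \<le> ln P" using P ln_le_cancel_iff[of "exp (- speed N * x)" P] by simp
  then have "- x \<le> 1 / speed N * ln P" using speed_pos[OF N] by (simp add: field_simps)
  then show ?thesis using P0 by (simp add: ereal_ln_def)
qed

lemma LDP_lower:
  assumes G: "openin pair_topology G"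
  shows "liminf (\<lambda>N. ereal (1 / speed N) * ereal_ln (measure (law N) G)) \<ge> - (INF p\<in>G. I_bar p)"
  unfolding le_Liminf_iff
proof (intro allI impI)
  fix y assume "y < - (INF p\<in>G. I_bar p)"
  then have "(INF p\<in>G. I_bar p) < - y" by (metis ereal_minus_less_minus ereal_uminus_uminus)
  then obtain p where p: "p \<in> G" "I_bar p < - y" by (auto simp: INF_less_iff)
  have pM: "p \<in> mass_one_pairs" using openin_subset[OF G] p by (auto simp: topspace_pair_topology)
  have I: "I_bar p = enn2ereal (energy (\<lambda>x. x\<^sup>2) p)" by (rule I_bar_eq[OF pM])
  have "energy (\<lambda>x. x\<^sup>2) p \<noteq> \<infinity>" using p(2) unfolding I by (auto simp: top_ennreal.rep_eq)
  then obtain c where c: "energy (\<lambda>x. x\<^sup>2) p = ennreal c" "0 \<le> c" by (cases "energy (\<lambda>x. x\<^sup>2) p") auto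
  have "ereal c < - y" using p(2) unfolding I c(1) using c(2) by (simp add: enn2ereal_ennreal)
  then obtain r where r: "ereal c < ereal r" "ereal r < - y" using ereal_dense2 by blast
  then have \<epsilon>: "0 < r - c" by simp
  show "\<forall>\<^sub>F N in sequentially. y < ereal (1 / speed N) * ereal_ln (measure (law N) G)"
    using law_lower[OF G p(1) c \<epsilon>] eventually_ge_at_top[of 1]
  proof eventually_elim
    case (elim N)
    have "y < ereal (- r)" using r(2) by (metis ereal_minus_less_minus ereal_uminus_uminus uminus_ereal.simps(1))
    also have "\<dots> \<le> ereal (1 / speed N) * ereal_ln (measure (law N) G)"
      using scaled_ln_ge[OF elim(2)] elim(1) by simp
    finally show ?case .
  qed
qed

text \<open>Levels \<open>y > 0\<close> are trivial because probabilities are at most one; they must be treated apart because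
  \<open>law_upper\<close> compares with nonnegative energy levels only.\<close>
lemma LDP_upper:
  assumes F: "closedin pair_topology F"
  shows "limsup (\<lambda>N. ereal (1 / speed N) * ereal_ln (measure (law N) F)) \<le> - (INF p\<in>F. I_bar p)"
  unfolding Limsup_le_iff
proof (intro allI impI)
  fix y assume y: "- (INF p\<in>F. I_bar p) < y"
  show "\<forall>\<^sub>F N in sequentially. ereal (1 / speed N) * ereal_ln (measure (law N) F) < y"
  proof (cases "0 < y")
    case True
    show ?thesis using eventually_ge_at_top[of 1]
    proof eventually_elim
      case (elim N)
      interpret prob_space "law N" unfolding law_def
        by (rule prob_space.prob_space_distr[OF prob_space_Q_law[OF elim] measurable_pair[OF elim]])
      have "ereal (1 / speed N) * ereal_ln (measure (law N) F) \<le> ereal (- 0)"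
        by (rule scaled_ln_le[OF elim]) (simp_all add: prob_le_1)
      also have "\<dots> < y" using True by (simp add: zero_ereal_def)
      finally show ?case .
    qed
  next
    case False
    have FM: "F \<subseteq> mass_one_pairs" using closedin_subset[OF F] by (simp add: topspace_pair_topology)
    have "- y < (INF p\<in>F. I_bar p)" using y by (metis ereal_minus_less_minus ereal_uminus_uminus)
    then obtain c where c: "- y < ereal c" "ereal c < (INF p\<in>F. I_bar p)" using ereal_dense2 by blast
    obtain r where r: "- y < ereal r" "ereal r < ereal c" using ereal_dense2[OF c(1)] by blast
    then have \<epsilon>: "0 < c - r" by simp
    have "0 \<le> - y" using False by (metis ereal_0_le_uminus_iff not_less)
    then have c0: "0 \<le> c" using c(1) by (metis ereal_less_eq(5) le_less_trans less_imp_le)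
    have above: "ennreal c < energy (\<lambda>x. x\<^sup>2) p" if "p \<in> F" for p
    proof -
      have "ereal c < I_bar p" using c(2) that by (auto dest: less_INF_D)
      then have "enn2ereal (ennreal c) < enn2ereal (energy (\<lambda>x. x\<^sup>2) p)"
        using I_bar_eq[of p] FM that c0 by (auto simp: enn2ereal_ennreal)
      then show ?thesis by (simp add: less_ennreal.rep_eq)
    qed
    have "\<forall>\<^sub>F N in sequentially. measure (law N) F \<le> exp (- speed N * (c - (c - r)))"
      by (rule law_upper[OF F _ \<epsilon>]) (rule above)
    then show ?thesis using eventually_ge_at_top[of 1]
    proof eventually_elim
      case (elim N)
      have "ereal (1 / speed N) * ereal_ln (measure (law N) F) \<le> ereal (- r)"
        by (rule scaled_ln_le[OF elim(2)]) (use elim(1) in auto)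
      also have "\<dots> < y" using r(1) by (metis ereal_minus_less_minus ereal_uminus_uminus uminus_ereal.simps(1))
      finally show ?case .
    qed
  qed
qed

lemma LDP:
  "satisfies_LDP pair_topology
      (\<lambda>N. Q_law (M N) N)
      (\<lambda>N lam. (mu_alpha (M N) (\<Theta> N) lam, mu_beta (M N) (\<Theta> N) lam))
      (\<lambda>N. (real (M N))\<^sup>2 * ln (\<Theta> N powi (-2)))
      I_bar"
proof -
  let ?a = "\<lambda>N. (real (M N))\<^sup>2 * ln (\<Theta> N powi (-2))"
  have ev: "\<forall>\<^sub>F N in sequentially. ?a N = speed N"
    using eventually_ge_at_top[of 1] by eventually_elim (simp only: speed_def ln_powi)
  have pair: "(\<lambda>lam. (mu_alpha (M N) (\<Theta> N) lam, mu_beta (M N) (\<Theta> N) lam)) = pair N" for N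
    by (simp add: pair_def[abs_def])
  have top: "filterlim ?a at_top sequentially"
    using speed_at_top filterlim_cong[OF refl refl ev] by blast
  have ev': "\<forall>\<^sub>F N in sequentially. ereal (1 / ?a N) * ereal_ln (measure (law N) A) = ereal (1 / speed N) * ereal_ln (measure (law N) A)" for A
    using ev by eventually_elim simp
  have nn: "\<forall>p\<in>topspace pair_topology. 0 \<le> I_bar p"
    by (simp add: topspace_pair_topology I_bar_eq)
  show ?thesis
    unfolding satisfies_LDP_def pair law_def[symmetric]
    using prob_space_Q_law measurable_pair top nn lower_semicontinuous_I_bar LDP_lower LDP_upper
    by (simp add: Liminf_eq[OF ev'] Limsup_eq[OF ev'])
qed

end

theorem theorem3p2:
  fixes M :: "nat \<Rightarrow> nat" and \<Theta> :: "nat \<Rightarrow> real"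
  assumes "\<And>N. N \<ge> 1 \<Longrightarrow> 1 \<le> M N \<and> M N \<le> N"
    and "filterlim M at_top sequentially"
    and "(\<lambda>N. real (M N) / real N) \<longlonglongrightarrow> 0"
    and "\<And>N. N \<ge> 1 \<Longrightarrow> \<Theta> N > 0"
    and "\<Theta> \<longlonglongrightarrow> 0"
    and "\<And>N. N \<ge> 1 \<Longrightarrow>
      (real (M N))\<^sup>2 * ln (\<Theta> N powi (-2)) = real N * real (M N) * (\<Theta> N)\<^sup>2"
  shows "satisfies_LDP pair_topology
      (\<lambda>N. Q_law (M N) N)
      (\<lambda>N lam. (mu_alpha (M N) (\<Theta> N) lam, mu_beta (M N) (\<Theta> N) lam))
      (\<lambda>N. (real (M N))\<^sup>2 * ln (\<Theta> N powi (-2)))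
      I_bar
    \<and> good_rate_function pair_topology I_bar"
proof -
  interpret critical_scaling M \<Theta> by unfold_locales (fact assms)+
  show ?thesis using LDP good_rate_function_I_bar by blast
qed

end
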